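(* Let $\mathcal H$ be a separable Hilbert space and let $T$ be a self-adjoint operator in $\mathcal H$ with domain $\mathcal D(T)$, with discrete spectrum consisting of eigenvalues $1<\mu_1\le\mu_2\le\dots$ (repeated according to multiplicity, $k=1,2,\dots$) and a corresponding complete orthonormal system of eigenvectors $\{\varphi_k\}_{k=1}^\infty$. Let $\alpha>0$ be such that $$\limsup_{r\to\infty}\frac{n(r,T)}{r^\alpha}<\infty ,$$ and suppose that the sequence $\{\mu_k\}_{k=1}^\infty$ is $\alpha$-non-condensing. Let $B$ be a linear operator in $\mathcal H$ such that, for some constants $b>0$ and $\beta\in(-\infty,1)$, $$\mathcal D(B)\supset\mathcal D(T),\qquad \|B\varphi_k\|\le b\,\mu_k^{\beta}\quad\text{for all }k\ge 1 .$$ Assume that $$\gamma:=\max(0,\ \beta,\ 2\beta+\alpha-1)<1 .$$ Then the spectrum of the operator $A=T+B$ (with domain $\mathcal D(T)$) consists of isolated eigenvalues $\{\lambda_k\}$, and there exist positive constants $a,C,C_1$ such that the eigenvalue-counting function $n(r,A)=\sum_{|\lambda_k|<r}1$ satisfies, for all $r>0$, $$|n(r,A)-n(r,T)|\le C\,\bigl[n(r+ar^{\gamma},T)-n(r-ar^{\gamma},T)\bigr]+C_1 .$$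
   Context: For real $r$, $n(r,T)=\sum_{\mu_k<r}1$ is the number of eigenvalues of $T$ (with multiplicity) that are less than $r$. The eigenvalues $\lambda_k$ of $A$ are repeated according to algebraic multiplicity. A sequence $\{\nu_k\}_{k=1}^\infty$ of positive numbers is called non-condensing if there is a number $l$ such that each interval $(t,t+1]$, $t\in\mathbb R^+$, contains at most $l$ members of the sequence (counted with repetition). A sequence $\{\mu_k\}$ satisfying $\limsup_{r\to\infty} n(r,T)/r^\alpha<\infty$ is called $\alpha$-non-condensing if the sequence $\{\mu_k^\alpha\}_{k=1}^\infty$ is non-condensing.
   Formalization: B is also assumed T-bounded, ‖Bx‖ ≤ c(‖x‖+‖Tx‖) on D(T); otherwise Bx = ψ(x)v, with ψ ≠ 0 a linear functional vanishing on all φ_k, is a counterexample, and a discrete spectrum of A forces this bound. *)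

theory Defs
  imports "HOL-Analysis.Analysis"
begin

text \<open>Complex Hilbert spaces, built on the library's real inner product spaces. The inner product
  is linear in the first argument; positivity and the norm come from its real part.\<close>

class complex_hilbert = real_inner + complete_space +
  fixes scaleC :: "complex \<Rightarrow> 'a \<Rightarrow> 'a" (infixr \<open>*\<^sub>C\<close> 75)
    and cinner :: "'a \<Rightarrow> 'a \<Rightarrow> complex"
  assumes scaleC_add_right: "c *\<^sub>C (x + y) = c *\<^sub>C x + c *\<^sub>C y"
    and scaleC_add_left: "(c + d) *\<^sub>C x = c *\<^sub>C x + d *\<^sub>C x"
    and scaleC_scaleC: "c *\<^sub>C (d *\<^sub>C x) = (c * d) *\<^sub>C x"
    and scaleC_of_real: "complex_of_real r *\<^sub>C x = r *\<^sub>R x"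
    and cinner_commute: "cinner x y = cnj (cinner y x)"
    and cinner_add_left: "cinner (x + y) z = cinner x z + cinner y z"
    and cinner_scaleC_left: "cinner (c *\<^sub>C x) y = c * cinner x y"
    and inner_eq_Re_cinner: "inner x y = Re (cinner x y)"

lemma scaleC_one: "1 *\<^sub>C x = (x :: 'a :: complex_hilbert)"
  using scaleC_of_real[of 1 x] by simp

global_interpretation complex_vector:
  vector_space "scaleC :: complex \<Rightarrow> 'a \<Rightarrow> 'a :: complex_hilbert"
  by unfold_locales (simp_all add: scaleC_add_right scaleC_add_left scaleC_scaleC scaleC_one)

definition complete_orthonormal :: "(nat \<Rightarrow> 'a :: complex_hilbert) \<Rightarrow> bool" where
  "complete_orthonormal \<phi> \<longleftrightarrow>
     (\<forall>j k. cinner (\<phi> j) (\<phi> k) = (if j = k then 1 else 0)) \<and>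
     closure (complex_vector.span (range \<phi>)) = UNIV"

text \<open>An operator in the space is given by its domain \<open>D\<close> together with a total function whose
  values outside \<open>D\<close> are irrelevant.\<close>

definition linear_operator :: "'a :: complex_hilbert set \<Rightarrow> ('a \<Rightarrow> 'a) \<Rightarrow> bool" where
  "linear_operator D A \<longleftrightarrow>
     complex_vector.subspace D \<and>
     (\<forall>x\<in>D. \<forall>y\<in>D. A (x + y) = A x + A y) \<and>
     (\<forall>c. \<forall>x\<in>D. A (c *\<^sub>C x) = c *\<^sub>C A x)"

definition adjoint_graph :: "'a :: complex_hilbert set \<Rightarrow> ('a \<Rightarrow> 'a) \<Rightarrow> ('a \<times> 'a) set" where
  "adjoint_graph D A = {(y, z). \<forall>x\<in>D. cinner (A x) y = cinner x z}"

definition self_adjoint :: "'a :: complex_hilbert set \<Rightarrow> ('a \<Rightarrow> 'a) \<Rightarrow> bool" where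
  "self_adjoint D A \<longleftrightarrow>
     linear_operator D A \<and> closure D = UNIV \<and> adjoint_graph D A = (\<lambda>x. (x, A x)) ` D"

definition op_resolvent_set :: "'a :: complex_hilbert set \<Rightarrow> ('a \<Rightarrow> 'a) \<Rightarrow> complex set" where
  "op_resolvent_set D A =
     {z. bij_betw (\<lambda>x. A x - z *\<^sub>C x) D UNIV \<and>
         (\<exists>c. \<forall>x\<in>D. norm x \<le> c * norm (A x - z *\<^sub>C x))}"

definition op_spectrum :: "'a :: complex_hilbert set \<Rightarrow> ('a \<Rightarrow> 'a) \<Rightarrow> complex set" where
  "op_spectrum D A = - op_resolvent_set D A"

definition op_eigenvalue :: "'a :: complex_hilbert set \<Rightarrow> ('a \<Rightarrow> 'a) \<Rightarrow> complex \<Rightarrow> bool" where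
  "op_eigenvalue D A z \<longleftrightarrow> (\<exists>x\<in>D. x \<noteq> 0 \<and> A x = z *\<^sub>C x)"

text \<open>The first conjunct says that \<open>x\<close> lies in the domain of the \<open>n\<close>-th power of \<open>A - z\<close>.\<close>

definition root_space :: "'a :: complex_hilbert set \<Rightarrow> ('a \<Rightarrow> 'a) \<Rightarrow> complex \<Rightarrow> 'a set" where
  "root_space D A z =
     {x. \<exists>n. (\<forall>j<n. ((\<lambda>y. A y - z *\<^sub>C y) ^^ j) x \<in> D) \<and> ((\<lambda>y. A y - z *\<^sub>C y) ^^ n) x = 0}"

text \<open>Meaningful only when the root space is finite dimensional, as \<open>dim\<close> is \<open>0\<close> otherwise.\<close>

definition algebraic_multiplicity ::
    "'a :: complex_hilbert set \<Rightarrow> ('a \<Rightarrow> 'a) \<Rightarrow> complex \<Rightarrow> nat" where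
  "algebraic_multiplicity D A z = complex_vector.dim (root_space D A z)"

text \<open>Discreteness: isolated eigenvalues of finite algebraic multiplicity. The spectrum is closed
  whenever the resolvent set is nonempty, so isolation of its points is the same as absence of
  finite accumulation points.\<close>

definition discrete_spectrum :: "'a :: complex_hilbert set \<Rightarrow> ('a \<Rightarrow> 'a) \<Rightarrow> bool" where
  "discrete_spectrum D A \<longleftrightarrow>
     (\<forall>z. \<not> z islimpt op_spectrum D A) \<and>
     (\<forall>z\<in>op_spectrum D A. op_eigenvalue D A z \<and>
        (\<exists>F. finite F \<and> root_space D A z \<subseteq> complex_vector.span F))"

definition eigenvalue_count :: "'a :: complex_hilbert set \<Rightarrow> ('a \<Rightarrow> 'a) \<Rightarrow> real \<Rightarrow> nat" where
  "eigenvalue_count D A r =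
     (\<Sum>z | z \<in> op_spectrum D A \<and> cmod z < r. algebraic_multiplicity D A z)"

lemma finite_spectrum_in_disc:
  assumes "discrete_spectrum D A"
  shows "finite {z. z \<in> op_spectrum D A \<and> cmod z < r}"
proof (rule ccontr)
  assume inf: "infinite {z. z \<in> op_spectrum D A \<and> cmod z < r}"
  have "{z. z \<in> op_spectrum D A \<and> cmod z < r} \<subseteq> cball 0 r"
    by auto
  then obtain z where "z islimpt {z. z \<in> op_spectrum D A \<and> cmod z < r}"
    using Heine_Borel_imp_Bolzano_Weierstrass[OF compact_cball inf] by blast
  then have "z islimpt op_spectrum D A"
    by (rule islimpt_subset) auto
  with assms show False
    by (simp add: discrete_spectrum_def)
qed

text \<open>Boundedness of \<open>B\<close> on \<open>D\<close> in the graph norm of \<open>T\<close>. For \<open>T\<close> closed on \<open>D\<close> this holds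
  for every closable \<open>B\<close> whose domain contains \<open>D\<close>, by the closed graph theorem. The values of a
  linear \<open>B\<close> on an orthonormal basis alone do not determine it on \<open>D\<close>.\<close>

definition relatively_bounded ::
    "'a :: complex_hilbert set \<Rightarrow> ('a \<Rightarrow> 'a) \<Rightarrow> ('a \<Rightarrow> 'a) \<Rightarrow> bool" where
  "relatively_bounded D T B \<longleftrightarrow> (\<exists>c. \<forall>x\<in>D. norm (B x) \<le> c * (norm x + norm (T x)))"

definition count_below :: "(nat \<Rightarrow> real) \<Rightarrow> real \<Rightarrow> nat" where
  "count_below \<mu> r = card {k. \<mu> k < r}"

definition non_condensing :: "(nat \<Rightarrow> real) \<Rightarrow> bool" where
  "non_condensing \<nu> \<longleftrightarrow>
     (\<forall>k. \<nu> k > 0) \<and>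
     (\<exists>l. \<forall>t>0. finite {k. \<nu> k \<in> {t<..t + 1}} \<and> card {k. \<nu> k \<in> {t<..t + 1}} \<le> l)"

definition alpha_non_condensing :: "real \<Rightarrow> (nat \<Rightarrow> real) \<Rightarrow> bool" where
  "alpha_non_condensing \<alpha> \<mu> \<longleftrightarrow>
     Limsup at_top (\<lambda>r. ereal (real (count_below \<mu> r) / r powr \<alpha>)) < \<infinity> \<and>
     non_condensing (\<lambda>k. \<mu> k powr \<alpha>)"

end

theory Submission
  imports Defs "HOL-Complex_Analysis.Complex_Analysis" "Jordan_Normal_Form.Char_Poly"
begin

text \<open>
  Push the first \<open>M\<close> eigenvalues of \<open>T\<close> so far away that, after adding \<open>B\<close>, the whole disc of
  radius \<open>2 r\<close> belongs to the resolvent set. Then \<open>A = T + B\<close> is a finite-rank perturbation of the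
  resulting operator, and in the disc its eigenvalues, with algebraic multiplicities, are the zeros
  of a finite determinant \<open>f\<close>; so \<open>n(r, A)\<close> is read off from the change of \<open>arg f\<close> along \<open>|z| = r\<close>.

  The non-condensing condition and the choice of \<open>\<gamma>\<close> make the Hilbert-Schmidt norm of \<open>B\<close> times the
  resolvent of \<open>T\<close> at most \<open>1/2\<close> at all points near the circle whose distance from the spectrum of
  \<open>T\<close> is at least \<open>g = c r\<^sup>\<gamma>\<close>. Let \<open>N\<close> be the number of eigenvalues of \<open>T\<close> within \<open>100 g\<close> of
  \<open>r\<close>, and move them to the right end of this window. The new \<open>T'\<close> has a spectral gap around \<open>r\<close>, so
  the homotopy \<open>T' + t B\<close> shows that its determinant \<open>f'\<close> counts exactly the eigenvalues of \<open>T'\<close>.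
  The quotient \<open>f / f'\<close> is an \<open>N \<times> N\<close> determinant. Away from the real axis it stays invertible while
  \<open>T'\<close> is moved back to \<open>T\<close>, so none of its \<open>N\<close> eigenvalues winds around \<open>0\<close>; near the axis its
  modulus is bounded by \<open>9\<^sup>N\<close> in a disc of radius comparable to \<open>g\<close> and is at least \<open>401\<^sup>-\<^sup>N\<close> at the
  centre, which bounds the number of zeros and the oscillation of the argument by a multiple of \<open>N\<close>.
\<close>

section \<open>Complex Hilbert spaces\<close>

text \<open>The operator \<open>A\<close> need not be normal, and the circle of radius
  \<open>r\<close> may pass arbitrarily close to eigenvalues of \<open>T\<close>; so neither a
  min-max argument nor a homotopy from \<open>T\<close> to \<open>A\<close> along that circle is at
  hand. Moreover \<open>B\<close> times the resolvent is controlled only in Hilbert-Schmidt norm,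
  which gives no infinite determinant of \<open>A\<close> relative to \<open>T\<close>; moving
  finitely many eigenvalues leaves finite determinants. The artificial gap is paid for with a factor
  having \<open>N\<close> eigenvalues. All bounds on it are constants to the power \<open>N\<close>,
  and logarithms turn them into multiples of \<open>N\<close>, the bracket in the claim. The
  exponent comes from the Hilbert-Schmidt sum. On average there are at most a multiple of
  r^(\<alpha>-1) eigenvalues per unit length near r, so with a gap g the part near r is at most a
  multiple of r^(2\<beta>) (1/g^2 + r^(\<alpha>-1)/g). For g = c r^\<gamma> with c large this is
  small as soon as \<gamma> \<ge> \<beta> and \<gamma> \<ge> 2\<beta>+\<alpha>-1.\<close>

lemma of_real_cmod_square: "(complex_of_real (cmod c))\<^sup>2 = c * cnj c"
  by (metis complex_norm_square of_real_power)

lemma cinner_zero_left [simp]: "cinner 0 y = 0"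
  using cinner_add_left[of 0 0 y] by simp

lemma cinner_add_right: "cinner x (y + z) = cinner x y + cinner x z"
  by (metis cinner_add_left cinner_commute complex_cnj_add)

lemma cinner_zero_right [simp]: "cinner x 0 = 0"
  using cinner_add_right[of x 0 0] by simp

lemma cinner_scaleC_right: "cinner x (c *\<^sub>C y) = cnj c * cinner x y"
  by (metis cinner_scaleC_left cinner_commute complex_cnj_mult)

lemma cinner_minus_left: "cinner (- x) y = - cinner x y"
  using cinner_add_left[of x "-x" y] by (simp add: add_eq_0_iff)

lemma cinner_diff_left: "cinner (x - z) y = cinner x y - cinner z y"
  using cinner_add_left[of x "-z" y] by (simp add: cinner_minus_left)

lemma cinner_diff_right: "cinner y (x - z) = cinner y x - cinner y z"
  by (metis cinner_diff_left cinner_commute complex_cnj_diff)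

lemma cinner_sum_left: "cinner (\<Sum>i\<in>I. f i) y = (\<Sum>i\<in>I. cinner (f i) y)"
  by (induction I rule: infinite_finite_induct) (auto simp: cinner_add_left)

lemma cinner_sum_right: "cinner y (\<Sum>i\<in>I. f i) = (\<Sum>i\<in>I. cinner y (f i))"
  by (induction I rule: infinite_finite_induct) (auto simp: cinner_add_right)

lemma cinner_self: "cinner x x = complex_of_real ((norm x)\<^sup>2)"
proof -
  have "Im (cinner x x) = 0"
    using cinner_commute[of x x] by (metis cnj.simps(2) neg_equal_zero)
  moreover have "Re (cinner x x) = (norm x)\<^sup>2"
    by (metis inner_eq_Re_cinner power2_norm_eq_inner)
  ultimately show ?thesis by (simp add: complex_eq_iff)
qed

lemma norm_scaleC: "norm (c *\<^sub>C x) = cmod c * norm x"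
proof -
  have "complex_of_real ((norm (c *\<^sub>C x))\<^sup>2) = complex_of_real ((cmod c * norm x)\<^sup>2)"
    unfolding cinner_self[symmetric] cinner_scaleC_left cinner_scaleC_right
    by (simp add: cinner_self power_mult_distrib of_real_cmod_square mult_ac)
  then have "(norm (c *\<^sub>C x))\<^sup>2 = (cmod c * norm x)\<^sup>2" using of_real_eq_iff by blast
  then show ?thesis by (simp add: power2_eq_iff_nonneg)
qed

lemma norm_cinner_le: "cmod (cinner x y) \<le> norm x * norm y"
proof (cases "cinner x y = 0")
  case False
  \<comment> \<open>The phase that makes \<open>cinner (c *\<^sub>C x) y\<close> real and
    nonnegative, so that the real Cauchy-Schwarz inequality applies.\<close>
  define c where "c = cnj (cinner x y) / cmod (cinner x y)"
  have c: "cmod c = 1" using False by (simp add: c_def norm_divide)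
  have "c * cinner x y = cmod (cinner x y)"
    using False of_real_cmod_square[of "cinner x y"]
    by (simp add: c_def power2_eq_square field_simps)
  then have "cmod (cinner x y) = inner (c *\<^sub>C x) y"
    by (simp add: inner_eq_Re_cinner cinner_scaleC_left)
  also have "\<dots> \<le> norm (c *\<^sub>C x) * norm y" by (rule norm_cauchy_schwarz)
  finally show ?thesis by (simp add: norm_scaleC c)
qed simp

lemma scaleC_sum_right: "c *\<^sub>C (\<Sum>i\<in>I. f i) = (\<Sum>i\<in>I. c *\<^sub>C f i)"
  by (induction I rule: infinite_finite_induct) (auto simp: scaleC_add_right)

lemma bounded_linear_cinner_left: "bounded_linear (\<lambda>x. cinner x y)"
  by (rule bounded_linear_intro[where K = "norm y"])
    (auto simp: cinner_add_left norm_cinner_le cinner_scaleC_left scaleR_conv_of_real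
      simp flip: scaleC_of_real)

lemma bounded_linear_cinner_right: "bounded_linear (\<lambda>y. cinner x y)"
  by (rule bounded_linear_intro[where K = "norm x"])
    (auto simp: cinner_add_right norm_cinner_le cinner_scaleC_right scaleR_conv_of_real mult.commute
      simp flip: scaleC_of_real intro: order.trans[OF norm_cinner_le])

lemmas scaleC_algebra = complex_vector.scale_left_diff_distrib complex_vector.scale_right_diff_distrib
  scaleC_add_left scaleC_add_right scaleC_scaleC

section \<open>Fourier expansions in a complete orthonormal system\<close>

locale complete_onb =
  fixes \<phi> :: "nat \<Rightarrow> 'a::complex_hilbert"
  assumes complete: "complete_orthonormal \<phi>"
begin

lemma cinner_basis: "cinner (\<phi> j) (\<phi> k) = (if j = k then 1 else 0)"
  using complete by (simp add: complete_orthonormal_def)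

lemma cinner_finite_comb:
  "finite I \<Longrightarrow> cinner (\<Sum>i\<in>I. c i *\<^sub>C \<phi> i) (\<phi> k) = (if k \<in> I then c k else 0)"
  by (simp add: cinner_sum_left cinner_scaleC_left cinner_basis if_distrib sum.delta' cong: if_cong)

lemma norm_finite_comb:
  assumes "finite I" shows "(norm (\<Sum>i\<in>I. c i *\<^sub>C \<phi> i))\<^sup>2 = (\<Sum>i\<in>I. (cmod (c i))\<^sup>2)"
proof -
  have "complex_of_real ((norm (\<Sum>i\<in>I. c i *\<^sub>C \<phi> i))\<^sup>2) = (\<Sum>i\<in>I. cnj (c i) * c i)"
    unfolding cinner_self[symmetric]
    by (subst cinner_sum_right) (simp add: cinner_scaleC_right cinner_finite_comb assms)
  also have "\<dots> = complex_of_real (\<Sum>i\<in>I. (cmod (c i))\<^sup>2)"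
    by (simp add: of_real_cmod_square mult.commute)
  finally show ?thesis using of_real_eq_iff by blast
qed

definition proj :: "nat \<Rightarrow> 'a \<Rightarrow> 'a" where
  "proj n x = (\<Sum>k<n. cinner x (\<phi> k) *\<^sub>C \<phi> k)"

lemma proj_diff: "proj n (x - y) = proj n x - proj n y"
  by (simp add: proj_def cinner_diff_left scaleC_algebra sum_subtractf)

lemma bessel: "(\<Sum>k<n. (cmod (cinner x (\<phi> k)))\<^sup>2) \<le> (norm x)\<^sup>2"
proof -
  let ?p = "proj n x"
  have 1: "(norm ?p)\<^sup>2 = (\<Sum>k<n. (cmod (cinner x (\<phi> k)))\<^sup>2)"
    unfolding proj_def by (rule norm_finite_comb) simp
  have "cinner (x - ?p) ?p = 0"
    unfolding proj_def
    by (subst cinner_sum_right)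
      (simp add: cinner_scaleC_right cinner_diff_left cinner_finite_comb)
  then have "inner (x - ?p) ?p = 0" by (simp add: inner_eq_Re_cinner)
  then have "(norm x)\<^sup>2 = (norm (x - ?p))\<^sup>2 + (norm ?p)\<^sup>2"
    by (simp add: power2_norm_eq_inner inner_diff_left inner_diff_right inner_commute)
  with 1 show ?thesis by (metis le_add_same_cancel2 zero_le_power2)
qed

lemma norm_proj_le: "norm (proj n x) \<le> norm x"
proof (rule power2_le_imp_le)
  show "(norm (proj n x))\<^sup>2 \<le> (norm x)\<^sup>2"
    unfolding proj_def by (subst norm_finite_comb) (auto intro: bessel)
qed simp

text \<open>Vectors fixed by all late projections form a subspace containing the basis, hence the
  dense span; the projections are contractions, so convergence passes to the closure.\<close>

lemma proj_tendsto: "(\<lambda>n. proj n x) \<longlonglongrightarrow> x"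
proof (rule LIMSEQ_I)
  fix e :: real assume "e > 0"
  define S where "S = {y. \<exists>n0. \<forall>n\<ge>n0. proj n y = y}"
  have "complex_vector.subspace S"
  proof (rule complex_vector.subspaceI)
    show "0 \<in> S" by (simp add: S_def proj_def)
    show "x + y \<in> S" if xy: "x \<in> S" "y \<in> S" for x y
    proof -
      obtain a b where "\<forall>n\<ge>a. proj n x = x" "\<forall>n\<ge>b. proj n y = y" using xy by (auto simp: S_def)
      then have "\<forall>n\<ge>max a b. proj n (x + y) = x + y"
        by (auto simp: proj_def cinner_add_left scaleC_add_left sum.distrib)
      then show ?thesis unfolding S_def by blast
    qed
    show "c *\<^sub>C x \<in> S" if xS: "x \<in> S" for c x
    proof -
      have "proj n (c *\<^sub>C x) = c *\<^sub>C proj n x" for n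
        unfolding proj_def scaleC_sum_right by (simp add: cinner_scaleC_left scaleC_scaleC)
      moreover obtain a where "\<forall>n\<ge>a. proj n x = x" using xS unfolding S_def by blast
      ultimately have "\<forall>n\<ge>a. proj n (c *\<^sub>C x) = c *\<^sub>C x" by simp
      then show ?thesis unfolding S_def by blast
    qed
  qed
  moreover have "range \<phi> \<subseteq> S"
  proof
    fix y assume "y \<in> range \<phi>"
    then obtain k where k: "y = \<phi> k" by blast
    have "proj n y = y" if "n \<ge> Suc k" for n
    proof -
      have "proj n y = (\<Sum>j<n. if k = j then \<phi> k else 0)"
        unfolding proj_def k by (intro sum.cong) (auto simp: cinner_basis scaleC_one)
      then show ?thesis using that k by simp
    qed
    then show "y \<in> S" unfolding S_def by blast
  qed
  ultimately have "complex_vector.span (range \<phi>) \<subseteq> S" by (rule complex_vector.span_minimal[rotated])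
  moreover have "x \<in> closure (complex_vector.span (range \<phi>))"
    using complete by (simp add: complete_orthonormal_def)
  then obtain y where "y \<in> complex_vector.span (range \<phi>)" "dist y x < e/2"
    using \<open>e > 0\<close> unfolding closure_approachable by (metis half_gt_zero)
  ultimately obtain n0 where n0: "\<And>n. n \<ge> n0 \<Longrightarrow> proj n y = y" and y: "norm (x - y) < e/2"
    unfolding S_def by (auto simp: dist_norm norm_minus_commute)
  have "norm (proj n x - x) < e" if "n \<ge> n0" for n
  proof -
    have "proj n x - x = proj n (x - y) - (x - y)" by (simp add: proj_diff n0 that)
    then have "norm (proj n x - x) \<le> norm (proj n (x - y)) + norm (x - y)"
      by (metis norm_triangle_ineq4)
    then show ?thesis using norm_proj_le[of n "x - y"] y by linarith
  qed
  then show "\<exists>n0. \<forall>n\<ge>n0. norm (proj n x - x) < e" by blast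
qed

lemma expansion: "(\<lambda>k. cinner x (\<phi> k) *\<^sub>C \<phi> k) sums x"
  using proj_tendsto[of x] by (simp add: sums_def proj_def[abs_def])

lemma parseval: "(\<lambda>k. (cmod (cinner x (\<phi> k)))\<^sup>2) sums (norm x)\<^sup>2"
proof -
  have "(\<lambda>n. (norm (proj n x))\<^sup>2) \<longlonglongrightarrow> (norm x)\<^sup>2" by (intro tendsto_intros proj_tendsto)
  then show ?thesis by (simp add: sums_def proj_def norm_finite_comb)
qed

lemma coefficients_eqI: "(\<And>k. cinner x (\<phi> k) = cinner y (\<phi> k)) \<Longrightarrow> x = y"
  using sums_unique2[OF expansion[of x]] expansion[of y] by simp

text \<open>By Pythagoras the squared norm of a block of the series is a block of the numerical
  series, so completeness of the space supplies the limit.\<close>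

lemma riesz_fischer:
  assumes "summable (\<lambda>k. (cmod (c k))\<^sup>2)"
  obtains x where "(\<lambda>k. c k *\<^sub>C \<phi> k) sums x" "\<And>k. cinner x (\<phi> k) = c k"
proof -
  have "Cauchy (\<lambda>n. \<Sum>k<n. c k *\<^sub>C \<phi> k)"
  proof (rule CauchyI)
    fix e :: real assume e: "e > 0"
    then obtain N where N: "\<And>m n. m \<ge> N \<Longrightarrow> norm (\<Sum>k=m..<n. (cmod (c k))\<^sup>2) < e\<^sup>2"
      using assms unfolding summable_Cauchy by (metis zero_less_power)
    have *: "norm ((\<Sum>k<n. c k *\<^sub>C \<phi> k) - (\<Sum>k<m. c k *\<^sub>C \<phi> k)) < e" if "m \<ge> N" "m \<le> n" for m n
    proof -
      have "(\<Sum>k<n. c k *\<^sub>C \<phi> k) - (\<Sum>k<m. c k *\<^sub>C \<phi> k) = (\<Sum>k=m..<n. c k *\<^sub>C \<phi> k)"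
        using that sum_diff_nat_ivl[of 0 m n "\<lambda>k. c k *\<^sub>C \<phi> k"] by (simp add: atLeast0LessThan)
      then have "(norm ((\<Sum>k<n. c k *\<^sub>C \<phi> k) - (\<Sum>k<m. c k *\<^sub>C \<phi> k)))\<^sup>2 < e\<^sup>2"
        using N[OF that(1), of n] by (simp add: norm_finite_comb)
      then show ?thesis using e by (simp add: power2_less_imp_less)
    qed
    show "\<exists>N. \<forall>m\<ge>N. \<forall>n\<ge>N. norm ((\<Sum>k<m. c k *\<^sub>C \<phi> k) - (\<Sum>k<n. c k *\<^sub>C \<phi> k)) < e"
      by (metis * nle_le norm_minus_commute)
  qed
  then obtain x where x: "(\<lambda>k. c k *\<^sub>C \<phi> k) sums x"
    unfolding sums_def using Cauchy_convergent convergent_def by blast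
  have "cinner x (\<phi> k) = c k" for k
  proof -
    have "(\<lambda>n. cinner (\<Sum>j<n. c j *\<^sub>C \<phi> j) (\<phi> k)) \<longlonglongrightarrow> cinner x (\<phi> k)"
      using x unfolding sums_def by (rule bounded_linear.tendsto[OF bounded_linear_cinner_left])
    moreover have "eventually (\<lambda>n. cinner (\<Sum>j<n. c j *\<^sub>C \<phi> j) (\<phi> k) = c k) sequentially"
      using eventually_gt_at_top[of k] by eventually_elim (simp add: cinner_finite_comb)
    ultimately show ?thesis using tendsto_unique[OF _ _ tendsto_eventually] by force
  qed
  with x that show thesis by blast
qed

end

section \<open>Determinants of matrices given by their entries\<close>

text \<open>Indexing by plain functions lets continuity and holomorphy be checked entry by entry,
  and lets the same entries be read as matrices of different sizes.\<close>

definition det_fun :: "nat \<Rightarrow> (nat \<Rightarrow> nat \<Rightarrow> complex) \<Rightarrow> complex" where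
  "det_fun n a = det (mat n n (\<lambda>(i, j). a i j))"

lemma det_fun_cong: "(\<And>i j. i < n \<Longrightarrow> j < n \<Longrightarrow> a i j = b i j) \<Longrightarrow> det_fun n a = det_fun n b"
  unfolding det_fun_def by (intro arg_cong[of _ _ det] eq_matI) auto

lemma det_fun_expand:
  "det_fun n a = (\<Sum>p | p permutes {0..<n}. signof p * (\<Prod>i=0..<n. a i (p i)))"
proof -
  have "det_fun n a = (\<Sum>p | p permutes {0..<n}. signof p * (\<Prod>i=0..<n. mat n n (\<lambda>(i, j). a i j) $$ (i, p i)))"
    unfolding det_fun_def by (rule det_def') simp
  also have "\<dots> = (\<Sum>p | p permutes {0..<n}. signof p * (\<Prod>i=0..<n. a i (p i)))"
  proof (intro sum.cong refl arg_cong2[of _ _ _ _ "(*)"] prod.cong)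
    fix p i assume p: "p \<in> {p. p permutes {0..<n}}" and i: "i \<in> {0..<n}"
    then have "p i < n" using permutes_in_image[of p "{0..<n}" i] by simp
    with i show "mat n n (\<lambda>(i, j). a i j) $$ (i, p i) = a i (p i)" by simp
  qed
  finally show ?thesis .
qed

lemma continuous_on_det_fun:
  assumes "\<And>i j. i < n \<Longrightarrow> j < n \<Longrightarrow> continuous_on S (\<lambda>z. a z i j)"
  shows "continuous_on S (\<lambda>z. det_fun n (a z))"
  unfolding det_fun_expand
  by (intro continuous_intros assms) (auto dest: permutes_in_image)

lemma holomorphic_on_det_fun:
  assumes "\<And>i j. i < n \<Longrightarrow> j < n \<Longrightarrow> (\<lambda>z. a z i j) holomorphic_on S"
  shows "(\<lambda>z. det_fun n (a z)) holomorphic_on S"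
  unfolding det_fun_expand
  by (intro holomorphic_intros assms) (auto dest: permutes_in_image)

lemma mult_vec_index:
  "i < n \<Longrightarrow> vec_index (mat n n (\<lambda>(i, j). a i j) *\<^sub>v vec n c) i = (\<Sum>j<n. a i j * c j)"
  by (simp add: scalar_prod_def atLeast0LessThan)

lemma det_fun_eq_0_iff:
  "det_fun n a = 0 \<longleftrightarrow> (\<exists>c. (\<exists>i<n. c i \<noteq> 0) \<and> (\<forall>i<n. (\<Sum>j<n. a i j * c j) = 0))"
proof -
  let ?A = "mat n n (\<lambda>(i, j). a i j)"
  have "det_fun n a = 0 \<longleftrightarrow> (\<exists>v. v \<in> carrier_vec n \<and> v \<noteq> 0\<^sub>v n \<and> ?A *\<^sub>v v = 0\<^sub>v n)"
    unfolding det_fun_def by (rule det_0_iff_vec_prod_zero_field) simp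
  also have "\<dots> \<longleftrightarrow> (\<exists>c. (\<exists>i<n. c i \<noteq> 0) \<and> (\<forall>i<n. (\<Sum>j<n. a i j * c j) = 0))"
  proof
    assume "\<exists>v. v \<in> carrier_vec n \<and> v \<noteq> 0\<^sub>v n \<and> ?A *\<^sub>v v = 0\<^sub>v n"
    then obtain v where v: "v \<in> carrier_vec n" "v \<noteq> 0\<^sub>v n" "?A *\<^sub>v v = 0\<^sub>v n" by blast
    have vv: "v = vec n (vec_index v)" using v(1) by auto
    have "\<exists>i<n. vec_index v i \<noteq> 0" using v(1,2) by (auto simp: vec_eq_iff)
    moreover have "(\<Sum>j<n. a i j * vec_index v j) = 0" if "i < n" for i
      using mult_vec_index[OF that, of a "vec_index v"] v(3) that vv by simp
    ultimately show "\<exists>c. (\<exists>i<n. c i \<noteq> 0) \<and> (\<forall>i<n. (\<Sum>j<n. a i j * c j) = 0)" by blast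
  next
    assume "\<exists>c. (\<exists>i<n. c i \<noteq> 0) \<and> (\<forall>i<n. (\<Sum>j<n. a i j * c j) = 0)"
    then obtain c where c: "\<exists>i<n. c i \<noteq> 0" "\<And>i. i < n \<Longrightarrow> (\<Sum>j<n. a i j * c j) = 0" by blast
    have "vec n c \<noteq> 0\<^sub>v n" using c(1) by (auto simp: vec_eq_iff)
    moreover have "?A *\<^sub>v vec n c = 0\<^sub>v n"
      by (rule eq_vecI) (use c(2) mult_vec_index[of _ n a c] in auto)
    ultimately show "\<exists>v. v \<in> carrier_vec n \<and> v \<noteq> 0\<^sub>v n \<and> ?A *\<^sub>v v = 0\<^sub>v n"
      by (intro exI[of _ "vec n c"]) simp
  qed
  finally show ?thesis .
qed

lemma det_fun_mult: "det_fun n (\<lambda>i j. \<Sum>l<n. a i l * b l j) = det_fun n a * det_fun n b"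
proof -
  let ?A = "mat n n (\<lambda>(i, j). a i j)" and ?B = "mat n n (\<lambda>(i, j). b i j)"
  have "mat n n (\<lambda>(i, j). \<Sum>l<n. a i l * b l j) = ?A * ?B"
    by (rule eq_matI) (auto simp: scalar_prod_def atLeast0LessThan)
  then show ?thesis unfolding det_fun_def by (simp add: det_mult[of ?A n ?B])
qed

lemma det_fun_inverse:
  assumes "det_fun n a \<noteq> 0"
  obtains q where "\<And>i j. i < n \<Longrightarrow> j < n \<Longrightarrow> (\<Sum>l<n. q i l * a l j) = (if i = j then 1 else 0)"
    and "\<And>i j. i < n \<Longrightarrow> j < n \<Longrightarrow> (\<Sum>l<n. a i l * q l j) = (if i = j then 1 else 0)"
proof -
  let ?A = "mat n n (\<lambda>(i, j). a i j)"
  have "?A \<in> Units (ring_mat TYPE(complex) n ())"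
    using assms unfolding det_fun_def by (intro det_non_zero_imp_unit) auto
  then obtain Q where Q: "Q \<in> carrier_mat n n" "Q * ?A = 1\<^sub>m n" "?A * Q = 1\<^sub>m n"
    unfolding Units_def ring_mat_def by auto
  show thesis
  proof (rule that[of "\<lambda>i j. Q $$ (i, j)"])
    fix i j assume ij: "i < n" "j < n"
    have "(Q * ?A) $$ (i, j) = (\<Sum>l<n. Q $$ (i, l) * a l j)"
      using ij Q(1) by (simp add: scalar_prod_def atLeast0LessThan)
    then show "(\<Sum>l<n. Q $$ (i, l) * a l j) = (if i = j then 1 else 0)" using Q(2) ij by simp
    have "(?A * Q) $$ (i, j) = (\<Sum>l<n. a i l * Q $$ (l, j))"
      using ij Q(1) by (simp add: scalar_prod_def atLeast0LessThan)
    then show "(\<Sum>l<n. a i l * Q $$ (l, j)) = (if i = j then 1 else 0)" using Q(3) ij by simp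
  qed
qed

text \<open>Cramer's rule. It evaluates what happens when one vector of a finite-rank perturbation
  is changed, since this alters a single column.\<close>

lemma det_fun_replace_column:
  assumes "k < n"
  shows "det_fun n (\<lambda>i j. if j = k then \<Sum>m<n. a i m * x m else a i j) = x k * det_fun n a"
proof -
  let ?A = "mat n n (\<lambda>(i, j). a i j)"
  have "mat n n (\<lambda>(i, j). if j = k then \<Sum>m<n. a i m * x m else a i j)
      = replace_col ?A (?A *\<^sub>v vec n x) k"
    by (rule eq_matI) (auto simp: replace_col_def scalar_prod_def atLeast0LessThan)
  then show ?thesis
    unfolding det_fun_def using cramer_lemma_mat[of ?A n "vec n x" k] assms by simp
qed

lemma det_fun_diagonal: "det_fun n (\<lambda>i j. if i = j then d i else 0) = (\<Prod>i<n. d i)"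
proof -
  have "det_fun n (\<lambda>i j. if i = j then d i else 0) = prod_list (diag_mat (mat n n (\<lambda>(i, j). if i = j then d i else 0)))"
    unfolding det_fun_def by (rule det_upper_triangular[of _ n]) (auto simp: upper_triangular_def)
  also have "\<dots> = (\<Prod>i<n. d i)"
    by (simp add: prod_list_diag_prod atLeast0LessThan)
  finally show ?thesis .
qed

text \<open>The matrix is block triangular with an identity block. This is how determinants of size
  \<open>M\<close> shrink to the number of eigenvalues actually moved.\<close>

lemma det_fun_leading_block:
  assumes "N \<le> M" and id: "\<And>i j. N \<le> i \<Longrightarrow> i < M \<Longrightarrow> j < M \<Longrightarrow> a i j = (if i = j then 1 else 0)"
  shows "det_fun M a = det_fun N a"
proof -
  let ?A1 = "mat N N (\<lambda>(i, j). a i j)" and ?A2 = "mat N (M - N) (\<lambda>(i, j). a i (j + N))"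
  have "mat M M (\<lambda>(i, j). a i j) = four_block_mat ?A1 ?A2 (0\<^sub>m (M - N) N) (1\<^sub>m (M - N))"
    by (rule eq_matI) (use assms in \<open>auto simp: four_block_mat_def Let_def\<close>)
  then show ?thesis
    unfolding det_fun_def
    using det_four_block_mat_lower_left_zero[of ?A1 N ?A2 "M - N" "0\<^sub>m (M - N) N" "1\<^sub>m (M - N)"] by simp
qed

text \<open>\<open>as\<close> lists the roots of the characteristic polynomial with multiplicity. As
  a product over eigenvalues the determinant can be estimated factor by factor.\<close>

lemma det_fun_eigenvalues:
  obtains as where "length as = n" "\<And>s. det_fun n (\<lambda>i j. (if i = j then 1 else 0) + s * a i j) = (\<Prod>x\<leftarrow>as. 1 + s * x)"
    and "\<And>x. x \<in> set as \<Longrightarrow> \<exists>c. (\<exists>i<n. c i \<noteq> 0) \<and> (\<forall>i<n. (\<Sum>j<n. a i j * c j) = x * c i)"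
proof -
  let ?A = "mat n n (\<lambda>(i, j). a i j)"
  have A: "?A \<in> carrier_mat n n" by simp
  obtain as where as: "char_poly ?A = (\<Prod>x\<leftarrow>as. [:- x, 1:])" "length as = n"
    using char_poly_factorized[OF A] by blast
  have pol: "det_fun n (\<lambda>i j. (if i = j then k else 0) - a i j) = (\<Prod>x\<leftarrow>as. k - x)" for k
  proof -
    have "mat n n (\<lambda>(i, j). (if i = j then k else 0) - a i j) = - (char_matrix ?A k)"
      by (rule eq_matI) (auto simp: char_matrix_def)
    then have "det_fun n (\<lambda>i j. (if i = j then k else 0) - a i j) = poly (char_poly ?A) k"
      unfolding det_fun_def char_poly_matrix[OF A] by simp
    also have "\<dots> = (\<Prod>x\<leftarrow>as. k - x)" unfolding as(1) by (induction as) (auto simp: algebra_simps)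
    finally show ?thesis .
  qed
  have s: "det_fun n (\<lambda>i j. (if i = j then 1 else 0) + s * a i j) = (\<Prod>x\<leftarrow>as. 1 + s * x)" for s
  proof (cases "s = 0")
    case True
    moreover have "(\<Prod>x\<leftarrow>as. 1) = (1::complex)" by (induction as) auto
    ultimately show ?thesis using det_fun_diagonal[of n "\<lambda>_. 1"] by simp
  next
    case False
    \<comment> \<open>\<open>1 + s a\<close> is \<open>- s\<close> times the matrix
      \<open>- 1 / s - a\<close>, whose determinant is the characteristic polynomial at
      \<open>- 1 / s\<close>.\<close>
    let ?B = "mat n n (\<lambda>(i, j). (if i = j then - 1 / s else 0) - a i j)"
    have "mat n n (\<lambda>(i, j). (if i = j then 1 else 0) + s * a i j) = (- s) \<cdot>\<^sub>m ?B"
      by (rule eq_matI) (use False in \<open>auto simp: algebra_simps\<close>)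
    then have "det_fun n (\<lambda>i j. (if i = j then 1 else 0) + s * a i j) = (- s) ^ n * det ?B"
      unfolding det_fun_def by simp
    also have "det ?B = (\<Prod>x\<leftarrow>as. - 1 / s - x)" using pol[of "- 1 / s"] unfolding det_fun_def by simp
    also have "(- s) ^ n * (\<Prod>x\<leftarrow>as. - 1 / s - x) = (\<Prod>x\<leftarrow>as. 1 + s * x)"
      unfolding as(2)[symmetric] using False by (induction as) (auto simp: algebra_simps)
    finally show ?thesis .
  qed
  have "\<exists>c. (\<exists>i<n. c i \<noteq> 0) \<and> (\<forall>i<n. (\<Sum>j<n. a i j * c j) = x * c i)" if "x \<in> set as" for x
  proof -
    have "(\<Prod>y\<leftarrow>as. x - y) = 0" using that by (auto simp: prod_list_zero_iff)
    then have "det_fun n (\<lambda>i j. (if i = j then x else 0) - a i j) = 0" using pol by simp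
    then obtain c where c: "\<exists>i<n. c i \<noteq> 0"
      "\<And>i. i < n \<Longrightarrow> (\<Sum>j<n. ((if i = j then x else 0) - a i j) * c j) = 0"
      unfolding det_fun_eq_0_iff by blast
    have "(\<Sum>j<n. a i j * c j) = x * c i" if "i < n" for i
    proof -
      have "(\<Sum>j<n. (if i = j then x else 0) * c j) = (\<Sum>j<n. if i = j then x * c j else 0)"
        by (intro sum.cong) auto
      then have "(\<Sum>j<n. (if i = j then x else 0) * c j) = x * c i" using that by simp
      then show ?thesis using c(2)[OF that] by (simp add: left_diff_distrib sum_subtractf)
    qed
    with c(1) show ?thesis by blast
  qed
  with as(2) s that show thesis by blast
qed

section \<open>Finite-rank perturbations and multiplicities\<close>

lemma linear_operatorD:
  assumes "linear_operator D A"
  shows "complex_vector.subspace D"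
    and "x \<in> D \<Longrightarrow> y \<in> D \<Longrightarrow> A (x + y) = A x + A y"
    and "x \<in> D \<Longrightarrow> A (c *\<^sub>C x) = c *\<^sub>C A x"
    and "A 0 = 0"
    and "x \<in> D \<Longrightarrow> y \<in> D \<Longrightarrow> A (x - y) = A x - A y"
proof -
  show D: "complex_vector.subspace D"
    and add: "\<And>x y. x \<in> D \<Longrightarrow> y \<in> D \<Longrightarrow> A (x + y) = A x + A y"
    and sc: "\<And>c x. x \<in> D \<Longrightarrow> A (c *\<^sub>C x) = c *\<^sub>C A x"
    using assms by (auto simp: linear_operator_def)
  show "A 0 = 0" using sc[of 0 0] complex_vector.subspace_0[OF D] by simp
  show "A (x - y) = A x - A y" if "x \<in> D" "y \<in> D"
    using add[of "x - y" y] complex_vector.subspace_diff[OF D that] that(2) by simp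
qed

lemma linear_operator_shift:
  assumes "linear_operator D A" shows "linear_operator D (\<lambda>x. A x - z *\<^sub>C x)"
  using assms unfolding linear_operator_def by (auto simp: scaleC_algebra mult.commute)

text \<open>Once a power of \<open>A - z\<close> annihilates a vector, the later iterates are zero
  and stay in \<open>D\<close>; so two vectors can be given a common exponent, up to which the
  powers act linearly.\<close>

lemma root_space_subspace:
  assumes lin: "linear_operator D A"
  shows "complex_vector.subspace (root_space D A z)"
proof -
  define N where "N = (\<lambda>y. A y - z *\<^sub>C y)"
  note linN = linear_operatorD[OF linear_operator_shift[OF lin, of z, folded N_def]]
  note [simp] = complex_vector.subspace_0[OF linN(1)] linN(4)
  define P where "P n x \<longleftrightarrow> (\<forall>j<n. (N ^^ j) x \<in> D) \<and> (N ^^ n) x = 0" for n x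
  have root: "root_space D A z = {x. \<exists>n. P n x}"
    by (simp add: root_space_def P_def N_def)
  have step: "P (Suc n) x" if "P n x" for n x using that by (auto simp: P_def less_Suc_eq)
  have up: "P m x" if "P n x" "n \<le> m" for n m x
    using that(2,1) by (induction m rule: dec_induct) (auto intro: step)
  have add: "(N ^^ j) (x + y) = (N ^^ j) x + (N ^^ j) y"
    if "\<forall>i<n. (N ^^ i) x \<in> D" "\<forall>i<n. (N ^^ i) y \<in> D" "j \<le> n" for x y n j
    using that(3) by (induction j) (use that(1,2) linN(2) in auto)
  have sc: "(N ^^ j) (c *\<^sub>C x) = c *\<^sub>C (N ^^ j) x" if "\<forall>i<n. (N ^^ i) x \<in> D" "j \<le> n" for x c n j
    using that(2) by (induction j) (use that(1) linN(3) in auto)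
  show ?thesis
  proof (rule complex_vector.subspaceI)
    show "0 \<in> root_space D A z" unfolding root by (auto simp: P_def intro!: exI[of _ 0])
    show "x + y \<in> root_space D A z" if xy: "x \<in> root_space D A z" "y \<in> root_space D A z" for x y
    proof -
      obtain n m where "P n x" "P m y" using xy unfolding root by blast
      then have *: "P (max n m) x" "P (max n m) y" using up by (meson max.cobounded1 max.cobounded2)+
      then have "P (max n m) (x + y)"
        unfolding P_def using add[of "max n m" x y] complex_vector.subspace_add[OF linN(1)]
        by (metis add_0 less_imp_le_nat order_refl)
      then show ?thesis unfolding root by blast
    qed
    show "c *\<^sub>C x \<in> root_space D A z" if xr: "x \<in> root_space D A z" for c x
    proof -
      obtain n where n: "P n x" using xr unfolding root by blast
      then have "P n (c *\<^sub>C x)"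
        unfolding P_def using sc[of n x _ c] complex_vector.subspace_scale[OF linN(1)]
        by (simp add: less_imp_le_nat)
      then show ?thesis unfolding root by blast
    qed
  qed
qed

text \<open>\<open>N\<close> sends multiples of \<open>v\<close> to multiples of \<open>v\<close>,
  so agreement of \<open>N\<close> and \<open>N'\<close> modulo \<open>v\<close> survives iteration.
  The lemma is applied in both directions.\<close>

lemma funpow_mod_eigenvector:
  assumes lin: "linear_operator D N" and v: "v \<in> D" "N v = a *\<^sub>C v"
    and N': "\<And>y. y \<in> D \<Longrightarrow> \<exists>c. N y = N' y + c *\<^sub>C v"
    and dom: "\<forall>i<n. (N' ^^ i) x \<in> D" and "j \<le> n"
  shows "\<exists>c. (N ^^ j) x = (N' ^^ j) x + c *\<^sub>C v"
  using \<open>j \<le> n\<close>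
proof (induction j)
  case 0
  show ?case by (auto intro: exI[of _ 0])
next
  case (Suc j)
  then obtain c where c: "(N ^^ j) x = (N' ^^ j) x + c *\<^sub>C v" by auto
  have d: "(N' ^^ j) x \<in> D" using dom Suc by simp
  obtain c' where c': "N ((N' ^^ j) x) = N' ((N' ^^ j) x) + c' *\<^sub>C v" using N'[OF d] by blast
  have "(N ^^ Suc j) x = N ((N' ^^ j) x) + c *\<^sub>C a *\<^sub>C v"
    using linear_operatorD(2,3)[OF lin] d v c complex_vector.subspace_scale[OF linear_operatorD(1)[OF lin]]
    by simp
  also have "\<dots> = (N' ^^ Suc j) x + (c' + c * a) *\<^sub>C v" by (simp add: c' scaleC_algebra)
  finally show ?case by blast
qed

text \<open>Shifting the eigenvalue of \<open>v\<close> by one along any functional \<open>\<psi>\<close> with \<open>\<psi> v = 1\<close> removes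
  exactly one dimension from the root space: modulo \<open>v\<close> the two operators agree.\<close>

lemma root_space_deflate:
  assumes lin: "linear_operator D A" and v: "v \<in> D" "v \<noteq> 0" "A v = z *\<^sub>C v"
    and lin': "linear_operator D A'" and A': "\<And>x. x \<in> D \<Longrightarrow> A' x = A x + \<psi> x *\<^sub>C v" and \<psi>: "\<psi> v = 1"
  shows "root_space D A z = {x. \<exists>c. x - c *\<^sub>C v \<in> root_space D A' z}" and "v \<notin> root_space D A' z"
proof -
  define N where "N = (\<lambda>y. A y - z *\<^sub>C y)"
  define N' where "N' = (\<lambda>y. A' y - z *\<^sub>C y)"
  note linN = linear_operator_shift[OF lin, of z, folded N_def]
  note linN' = linear_operator_shift[OF lin', of z, folded N'_def]
  note sub = linear_operatorD(1)[OF lin]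
  note [simp] = complex_vector.subspace_0[OF sub] complex_vector.subspace_add[OF sub]
    complex_vector.subspace_diff[OF sub] complex_vector.subspace_scale[OF sub]
  have Nv: "N v = 0 *\<^sub>C v" and N'v: "N' v = 1 *\<^sub>C v"
    using v A'[of v] \<psi> by (simp_all add: N_def N'_def)
  have NN': "\<exists>c. N y = N' y + c *\<^sub>C v" if "y \<in> D" for y
    using A'[OF that] by (intro exI[of _ "- \<psi> y"]) (simp add: N_def N'_def)
  have N'N: "\<exists>c. N' y = N y + c *\<^sub>C v" if "y \<in> D" for y
    using A'[OF that] by (intro exI[of _ "\<psi> y"]) (simp add: N_def N'_def)
  have root: "root_space D A z = {x. \<exists>n. (\<forall>j<n. (N ^^ j) x \<in> D) \<and> (N ^^ n) x = 0}"
    and root': "root_space D A' z = {x. \<exists>n. (\<forall>j<n. (N' ^^ j) x \<in> D) \<and> (N' ^^ n) x = 0}"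
    by (simp_all add: root_space_def N_def N'_def)
  show "v \<notin> root_space D A' z"
  proof
    assume "v \<in> root_space D A' z"
    moreover have "(N' ^^ n) v = v" for n by (induction n) (use N'v scaleC_one in auto)
    ultimately show False using v by (auto simp: root')
  qed
  have vroot: "v \<in> root_space D A z"
    unfolding root using Nv v by (auto intro!: exI[of _ 1])
  show "root_space D A z = {x. \<exists>c. x - c *\<^sub>C v \<in> root_space D A' z}"
  proof (intro equalityI subsetI)
    fix x assume "x \<in> root_space D A z"
    then obtain n where n: "\<forall>j<n. (N ^^ j) x \<in> D" "(N ^^ n) x = 0" unfolding root by blast
    note * = funpow_mod_eigenvector[OF linN' v(1) N'v N'N n(1)]
    have dom: "\<forall>j<n. (N' ^^ j) x \<in> D"
    proof (intro allI impI)
      fix j assume "j < n"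
      then show "(N' ^^ j) x \<in> D" using *[of j] n(1) v(1) by auto
    qed
    obtain c where c: "(N' ^^ n) x = c *\<^sub>C v" using *[of n] n(2) by auto
    \<comment> \<open>Since \<open>N'\<close> fixes \<open>v\<close>, subtracting
      \<open>c *\<^sub>C v\<close> lowers each iterate by the same vector, which is exactly what is
      left at step \<open>n\<close>.\<close>
    have pow: "(N' ^^ j) (x - c *\<^sub>C v) = (N' ^^ j) x - c *\<^sub>C v" if "j \<le> n" for j
      using that
    proof (induction j)
      case (Suc j)
      then have "(N' ^^ Suc j) (x - c *\<^sub>C v) = N' ((N' ^^ j) x - c *\<^sub>C v)" by simp
      also have "\<dots> = N' ((N' ^^ j) x) - c *\<^sub>C N' v"
        using dom Suc v(1) by (simp add: linear_operatorD(3,5)[OF linN'])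
      finally show ?case using N'v by (simp add: scaleC_one)
    qed simp
    have "x - c *\<^sub>C v \<in> root_space D A' z"
      unfolding root' using pow dom c v(1) by (auto intro!: exI[of _ n])
    then show "x \<in> {x. \<exists>c. x - c *\<^sub>C v \<in> root_space D A' z}" by blast
  next
    fix x assume "x \<in> {x. \<exists>c. x - c *\<^sub>C v \<in> root_space D A' z}"
    then obtain c n where n: "\<forall>j<n. (N' ^^ j) (x - c *\<^sub>C v) \<in> D" "(N' ^^ n) (x - c *\<^sub>C v) = 0"
      unfolding root' by blast
    note * = funpow_mod_eigenvector[OF linN v(1) Nv NN' n(1)]
    obtain c' where c': "(N ^^ n) (x - c *\<^sub>C v) = c' *\<^sub>C v" using *[of n] n(2) by auto
    \<comment> \<open>One further power is taken because \<open>N ^^ n\<close> leaves a multiple of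
      \<open>v\<close>, which \<open>N\<close> annihilates.\<close>
    have "\<forall>j<Suc n. (N ^^ j) (x - c *\<^sub>C v) \<in> D"
    proof (intro allI impI)
      fix j assume j: "j < Suc n"
      show "(N ^^ j) (x - c *\<^sub>C v) \<in> D"
      proof (cases "j = n")
        case True then show ?thesis using c' v(1) by simp
      next
        case False then show ?thesis using *[of j] n(1) v(1) j by auto
      qed
    qed
    moreover have "(N ^^ Suc n) (x - c *\<^sub>C v) = 0"
      using c' Nv linear_operatorD(3)[OF linN v(1), of c'] by simp
    ultimately have "x - c *\<^sub>C v \<in> root_space D A z" unfolding root by blast
    then have "(x - c *\<^sub>C v) + c *\<^sub>C v \<in> root_space D A z"
      using root_space_subspace[OF lin, of z] vroot
      by (meson complex_vector.subspace_add complex_vector.subspace_scale)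
    then show "x \<in> root_space D A z" by simp
  qed
qed

section \<open>The resolvent: linearity, boundedness, weak holomorphy\<close>

definition resolvent :: "'a::complex_hilbert set \<Rightarrow> ('a \<Rightarrow> 'a) \<Rightarrow> complex \<Rightarrow> 'a \<Rightarrow> 'a" where
  "resolvent D A z = inv_into D (\<lambda>x. A x - z *\<^sub>C x)"

lemma
  assumes "z \<in> op_resolvent_set D A"
  shows resolvent_in: "resolvent D A z y \<in> D"
    and resolvent_right: "A (resolvent D A z y) - z *\<^sub>C resolvent D A z y = y"
    and resolvent_left: "x \<in> D \<Longrightarrow> resolvent D A z (A x - z *\<^sub>C x) = x"
  using assms unfolding op_resolvent_set_def resolvent_def bij_betw_def
  by (auto intro!: inv_into_into inv_into_f_f f_inv_into_f[where f = "\<lambda>x. A x - z *\<^sub>C x"])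

lemma resolvent_eqI:
  assumes "z \<in> op_resolvent_set D A" "x \<in> D" "A x - z *\<^sub>C x = y"
  shows "resolvent D A z y = x"
  using resolvent_left[OF assms(1,2)] assms(3) by simp

lemma
  assumes lin: "linear_operator D A" and z: "z \<in> op_resolvent_set D A"
  shows resolvent_add: "resolvent D A z (x + y) = resolvent D A z x + resolvent D A z y"
    and resolvent_scale: "resolvent D A z (c *\<^sub>C y) = c *\<^sub>C resolvent D A z y"
proof -
  note lN = linear_operatorD[OF linear_operator_shift[OF lin, of z]]
  note in_D = resolvent_in[OF z]
  show "resolvent D A z (x + y) = resolvent D A z x + resolvent D A z y"
    by (rule resolvent_eqI[OF z])
      (use lN(2)[OF in_D in_D] complex_vector.subspace_add[OF lN(1) in_D in_D] resolvent_right[OF z] in auto)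
  show "resolvent D A z (c *\<^sub>C y) = c *\<^sub>C resolvent D A z y"
    by (rule resolvent_eqI[OF z])
      (use lN(3)[OF in_D] complex_vector.subspace_scale[OF lN(1) in_D] resolvent_right[OF z] in auto)
qed

lemma resolvent_diff:
  assumes lin: "linear_operator D A" and z: "z \<in> op_resolvent_set D A"
  shows "resolvent D A z (x - y) = resolvent D A z x - resolvent D A z y"
  using resolvent_add[OF lin z, of "x - y" y] by (simp add: algebra_simps)

lemma resolvent_sum:
  assumes lin: "linear_operator D A" and z: "z \<in> op_resolvent_set D A"
  shows "resolvent D A z (\<Sum>i\<in>I. c i *\<^sub>C f i) = (\<Sum>i\<in>I. c i *\<^sub>C resolvent D A z (f i))"
proof -
  have "resolvent D A z 0 = 0" using resolvent_scale[OF assms, of 0 0] by simp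
  then show ?thesis
    by (induction I rule: infinite_finite_induct) (auto simp: resolvent_add[OF assms] resolvent_scale[OF assms])
qed

lemma resolvent_bounded:
  assumes z: "z \<in> op_resolvent_set D A"
  obtains c where "c > 0" "\<And>y. norm (resolvent D A z y) \<le> c * norm y"
proof -
  obtain c where c: "\<And>x. x \<in> D \<Longrightarrow> norm x \<le> c * norm (A x - z *\<^sub>C x)"
    using z by (auto simp: op_resolvent_set_def)
  have "norm (resolvent D A z y) \<le> (\<bar>c\<bar> + 1) * norm y" for y
  proof -
    have "norm (resolvent D A z y) \<le> c * norm y"
      using c[OF resolvent_in[OF z, of y]] by (simp add: resolvent_right[OF z])
    also have "\<dots> \<le> (\<bar>c\<bar> + 1) * norm y" by (intro mult_right_mono) auto
    finally show ?thesis .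
  qed
  then show thesis by (intro that[of "\<bar>c\<bar> + 1"]) auto
qed

lemma resolvent_identity:
  assumes lin: "linear_operator D A" and zw: "z \<in> op_resolvent_set D A" "w \<in> op_resolvent_set D A"
  shows "resolvent D A w y - resolvent D A z y = (w - z) *\<^sub>C resolvent D A z (resolvent D A w y)"
proof -
  let ?x = "resolvent D A w y"
  have "A ?x - z *\<^sub>C ?x = y + (w - z) *\<^sub>C ?x"
    using resolvent_right[OF zw(2), of y] by (simp add: scaleC_algebra algebra_simps)
  then have "?x = resolvent D A z (y + (w - z) *\<^sub>C ?x)"
    using resolvent_left[OF zw(1) resolvent_in[OF zw(2), of y]] by simp
  then have "?x = resolvent D A z y + (w - z) *\<^sub>C resolvent D A z ?x"
    by (simp add: resolvent_add[OF lin zw(1)] resolvent_scale[OF lin zw(1)])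
  then show ?thesis by (metis add_diff_cancel_left')
qed

text \<open>By the resolvent identity the difference quotient at \<open>z\<close> is
  \<open>R z (R w y)\<close>, so only continuity of \<open>R w y\<close> in \<open>w\<close> is at
  stake; it follows from a bound for \<open>R w\<close> near \<open>z\<close> that the same identity
  gives. Determinants use only such inner products.\<close>

lemma resolvent_holomorphic:
  assumes lin: "linear_operator D A" and U: "open U" "U \<subseteq> op_resolvent_set D A"
  shows "(\<lambda>z. cinner (resolvent D A z y) g) holomorphic_on U"
proof -
  have "\<exists>f'. ((\<lambda>z. cinner (resolvent D A z y) g) has_field_derivative f') (at z)" if zU: "z \<in> U" for z
  proof -
    let ?R = "resolvent D A"
    have z: "z \<in> op_resolvent_set D A" using zU U by blast
    obtain c where c: "c > 0" "\<And>y. norm (?R z y) \<le> c * norm y" using resolvent_bounded[OF z] by metis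
    obtain r where r: "r > 0" "ball z r \<subseteq> U" using U zU openE by blast
    \<comment> \<open>With this radius \<open>cmod (w - z) * c \<le> 1/2\<close>, so the unknown
      norm of \<open>R w y\<close> in the resolvent identity can be absorbed.\<close>
    define s where "s = min r (1 / (2 * c))"
    have s: "s > 0" using r c by (simp add: s_def)
    have w: "w \<in> op_resolvent_set D A" if "w \<in> ball z s" for w
      using that r U(2) by (auto simp: s_def)
    have est: "norm (?R w y - ?R z y) \<le> 2 * c\<^sup>2 * norm y * cmod (w - z)" if ws: "w \<in> ball z s" for w
    proof -
      have id: "?R w y - ?R z y = (w - z) *\<^sub>C ?R z (?R w y)" by (rule resolvent_identity[OF lin z w[OF ws]])
      have half: "cmod (w - z) * c \<le> 1/2"
        using ws c(1) by (auto simp: s_def dist_norm norm_minus_commute field_simps)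
      have 1: "norm (?R w y - ?R z y) \<le> cmod (w - z) * (c * norm (?R w y))"
        unfolding id norm_scaleC by (intro mult_left_mono c) auto
      have "norm (?R w y - ?R z y) \<le> 1/2 * norm (?R w y)"
        using 1 mult_right_mono[OF half, of "norm (?R w y)"] by (simp add: mult.assoc)
      then have "norm (?R w y) \<le> 2 * norm (?R z y)"
        using norm_triangle_ineq2[of "?R w y" "?R z y"] by linarith
      also have "\<dots> \<le> 2 * (c * norm y)" using c(2)[of y] by linarith
      finally have "cmod (w - z) * (c * norm (?R w y)) \<le> cmod (w - z) * (c * (2 * (c * norm y)))"
        using c(1) by (intro mult_left_mono) auto
      with 1 show ?thesis by (simp add: power2_eq_square mult_ac)
    qed
    have ev: "eventually (\<lambda>w. w \<in> ball z s) (at z)"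
      using s by (metis centre_in_ball eventually_at_topological open_ball)
    have lim0: "((\<lambda>w. ?R w y - ?R z y) \<longlongrightarrow> 0) (at z)"
    proof (rule Lim_null_comparison)
      show "eventually (\<lambda>w. norm (?R w y - ?R z y) \<le> 2 * c\<^sup>2 * norm y * cmod (w - z)) (at z)"
        using ev by eventually_elim (rule est)
      have "((\<lambda>w. 2 * c\<^sup>2 * norm y * cmod (w - z)) \<longlongrightarrow> 2 * c\<^sup>2 * norm y * cmod (z - z)) (at z)"
        by (intro tendsto_intros)
      then show "((\<lambda>w. 2 * c\<^sup>2 * norm y * cmod (w - z)) \<longlongrightarrow> 0) (at z)" by simp
    qed
    have "((\<lambda>w. ?R z (?R w y - ?R z y)) \<longlongrightarrow> 0) (at z)"
    proof (rule Lim_null_comparison)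
      show "eventually (\<lambda>w. norm (?R z (?R w y - ?R z y)) \<le> c * norm (?R w y - ?R z y)) (at z)"
        using c by (intro always_eventually) auto
      show "((\<lambda>w. c * norm (?R w y - ?R z y)) \<longlongrightarrow> 0) (at z)"
        using tendsto_mult_right_zero[OF tendsto_norm_zero[OF lim0], of c] .
    qed
    then have lim1: "((\<lambda>w. cinner (?R z (?R w y)) g) \<longlongrightarrow> cinner (?R z (?R z y)) g) (at z)"
      by (intro bounded_linear.tendsto[OF bounded_linear_cinner_left])
        (simp add: resolvent_diff[OF lin z] LIM_zero_iff)
    have "((\<lambda>w. (cinner (?R w y) g - cinner (?R z y) g) / (w - z)) \<longlongrightarrow> cinner (?R z (?R z y)) g) (at z)"
    proof (rule Lim_transform_eventually[OF lim1])
      have "eventually (\<lambda>w. w \<in> ball z s \<and> w \<noteq> z) (at z)"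
        using ev eventually_at_topological by (simp add: eventually_conj_iff eventually_neq_at_within)
      then show "eventually (\<lambda>w. cinner (?R z (?R w y)) g = (cinner (?R w y) g - cinner (?R z y) g) / (w - z)) (at z)"
        by eventually_elim
          (simp add: resolvent_identity[OF lin z w] cinner_scaleC_left flip: cinner_diff_left)
    qed
    then show ?thesis unfolding has_field_derivative_iff by blast
  qed
  then show ?thesis by (simp add: holomorphic_on_open U)
qed

section \<open>The perturbation determinant of a finite-rank perturbation\<close>

definition rank_pert :: "nat \<Rightarrow> (nat \<Rightarrow> 'a::complex_hilbert) \<Rightarrow> (nat \<Rightarrow> 'a) \<Rightarrow> 'a \<Rightarrow> 'a" where
  "rank_pert M g e x = (\<Sum>i<M. cinner x (g i) *\<^sub>C e i)"

text \<open>The entries of 1 + GRE, where E sends the unit vectors to the \<open>e j\<close>, R is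
  the resolvent and G takes inner products with the \<open>g i\<close>. Since det(1 + GRE) = det(1 +
  EGR), the determinant is that of (A - z)(A0 - z)^(-1) for A = A0 + EG, reduced to size
  \<open>M\<close>.\<close>

definition pert_entry ::
    "'a::complex_hilbert set \<Rightarrow> ('a \<Rightarrow> 'a) \<Rightarrow> (nat \<Rightarrow> 'a) \<Rightarrow> (nat \<Rightarrow> 'a) \<Rightarrow> complex \<Rightarrow> nat \<Rightarrow> nat \<Rightarrow> complex" where
  "pert_entry D A g e z i j = (if i = j then 1 else 0) + cinner (resolvent D A z (e j)) (g i)"

definition pert_det ::
    "'a::complex_hilbert set \<Rightarrow> ('a \<Rightarrow> 'a) \<Rightarrow> nat \<Rightarrow> (nat \<Rightarrow> 'a) \<Rightarrow> (nat \<Rightarrow> 'a) \<Rightarrow> complex \<Rightarrow> complex" where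
  "pert_det D A M g e z = det_fun M (pert_entry D A g e z)"

lemma sum_delta_mult:
  "i < (M::nat) \<Longrightarrow> (\<Sum>j<M. (if i = j then 1 else 0) * c j) = (c i :: complex)"
proof -
  assume i: "i < M"
  have "(\<Sum>j<M. (if i = j then 1 else 0) * c j) = (\<Sum>j<M. if i = j then c j else 0)"
    by (intro sum.cong) auto
  then show ?thesis using i by simp
qed

lemma linear_rank_pert:
  assumes "linear_operator D A" shows "linear_operator D (\<lambda>x. A x + rank_pert M g e x)"
  using assms unfolding linear_operator_def rank_pert_def
  by (auto simp: cinner_add_left cinner_scaleC_left sum.distrib scaleC_algebra scaleC_sum_right algebra_simps)

context
  fixes D :: "'a::complex_hilbert set" and A0 :: "'a \<Rightarrow> 'a"
  assumes lin: "linear_operator D A0"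
begin

lemma pert_entry_mult:
  assumes z: "z \<in> op_resolvent_set D A0" and i: "i < M"
  shows "(\<Sum>j<M. pert_entry D A0 g e z i j * c j)
    = c i + cinner (resolvent D A0 z (\<Sum>j<M. c j *\<^sub>C e j)) (g i)"
  unfolding pert_entry_def distrib_right sum.distrib sum_delta_mult[OF i] resolvent_sum[OF lin z]
  by (simp add: cinner_sum_left cinner_scaleC_left mult.commute)

lemma pert_identity:
  assumes z: "z \<in> op_resolvent_set D A0" and x: "x \<in> D"
  shows "x + resolvent D A0 z (rank_pert M g e x)
    = resolvent D A0 z (A0 x + rank_pert M g e x - z *\<^sub>C x)"
proof -
  have "A0 x + rank_pert M g e x - z *\<^sub>C x = (A0 x - z *\<^sub>C x) + rank_pert M g e x" by simp
  then show ?thesis by (simp only: resolvent_add[OF lin z] resolvent_left[OF z x])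
qed

text \<open>The coefficients \<open>cinner x (g j)\<close> thus solve a linear system whose
  right-hand side depends on \<open>x\<close> only through \<open>(A - z) x\<close>. This ties the
  matrix to the operator.\<close>

lemma pert_entry_coefficients:
  assumes z: "z \<in> op_resolvent_set D A0" and x: "x \<in> D" and i: "i < M"
  shows "(\<Sum>j<M. pert_entry D A0 g e z i j * cinner x (g j))
    = cinner (resolvent D A0 z (A0 x + rank_pert M g e x - z *\<^sub>C x)) (g i)"
  unfolding pert_entry_mult[OF z i] pert_identity[OF z x, symmetric]
  by (simp add: cinner_add_left rank_pert_def)

text \<open>Inverting the matrix recovers the coefficients of \<open>x\<close> from
  \<open>u = (A - z) x\<close>, hence the perturbation at \<open>x\<close>, and then
  \<open>x\<close> itself by the resolvent of \<open>A0\<close>: this is injectivity with a bound.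
  For surjectivity the inverse matrix prescribes the coefficients, and the resulting vector is
  checked to have them.\<close>

lemma pert_resolvent_set:
  assumes z: "z \<in> op_resolvent_set D A0" and det: "pert_det D A0 M g e z \<noteq> 0"
  shows "z \<in> op_resolvent_set D (\<lambda>x. A0 x + rank_pert M g e x)"
proof -
  let ?A = "\<lambda>x. A0 x + rank_pert M g e x" and ?R = "resolvent D A0 z" and ?G = "pert_entry D A0 g e z"
  obtain q where q: "\<And>i j. i < M \<Longrightarrow> j < M \<Longrightarrow> (\<Sum>l<M. q i l * ?G l j) = (if i = j then 1 else 0)"
    "\<And>i j. i < M \<Longrightarrow> j < M \<Longrightarrow> (\<Sum>l<M. ?G i l * q l j) = (if i = j then 1 else 0)"
    using det_fun_inverse[of M ?G] det unfolding pert_det_def by blast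
  note sub = linear_operatorD(1)[OF lin]
  note linN = linear_operatorD[OF linear_operator_shift[OF linear_rank_pert[OF lin, of M g e], of z]]
  obtain c0 where c0: "c0 > 0" "\<And>y. norm (?R y) \<le> c0 * norm y" using resolvent_bounded[OF z] by metis
  define C where "C = c0 * (1 + (\<Sum>j<M. norm (e j) * (\<Sum>l<M. cmod (q j l) * (c0 * norm (g l)))))"
  have bound: "norm x \<le> C * norm (?A x - z *\<^sub>C x)" if x: "x \<in> D" for x
  proof -
    define u where "u = ?A x - z *\<^sub>C x"
    have coef: "cinner x (g j) = (\<Sum>l<M. q j l * cinner (?R u) (g l))" if j: "j < M" for j
    proof -
      have "(\<Sum>l<M. q j l * cinner (?R u) (g l)) = (\<Sum>l<M. q j l * (\<Sum>m<M. ?G l m * cinner x (g m)))"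
        by (intro sum.cong) (auto simp: pert_entry_coefficients[OF z x] u_def)
      also have "\<dots> = (\<Sum>m<M. (\<Sum>l<M. q j l * ?G l m) * cinner x (g m))"
        unfolding sum_distrib_left sum_distrib_right by (subst sum.swap) (simp add: mult.assoc)
      also have "\<dots> = cinner x (g j)" using j by (simp add: q(1) sum_delta_mult)
      finally show ?thesis by simp
    qed
    have "cmod (cinner x (g j)) \<le> (\<Sum>l<M. cmod (q j l) * (c0 * norm (g l))) * norm u" if "j < M" for j
    proof -
      have "cmod (cinner x (g j)) \<le> (\<Sum>l<M. cmod (q j l) * cmod (cinner (?R u) (g l)))"
        unfolding coef[OF that] by (rule norm_sum[THEN order_trans]) (simp add: norm_mult)
      also have "\<dots> \<le> (\<Sum>l<M. cmod (q j l) * (c0 * norm u * norm (g l)))"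
        using c0 by (intro sum_mono mult_left_mono order.trans[OF norm_cinner_le] mult_right_mono) auto
      finally show ?thesis by (simp add: sum_distrib_left sum_distrib_right mult_ac)
    qed
    then have "norm (\<Sum>j<M. cinner x (g j) *\<^sub>C e j)
        \<le> (\<Sum>j<M. ((\<Sum>l<M. cmod (q j l) * (c0 * norm (g l))) * norm u) * norm (e j))"
      by (intro norm_sum[THEN order_trans] sum_mono) (auto simp: norm_scaleC intro: mult_right_mono)
    then have "norm (u - rank_pert M g e x) \<le> norm u + (\<Sum>j<M. ((\<Sum>l<M. cmod (q j l) * (c0 * norm (g l))) * norm u) * norm (e j))"
      unfolding rank_pert_def using norm_triangle_ineq4[of u "\<Sum>j<M. cinner x (g j) *\<^sub>C e j"] by linarith
    moreover have "x = ?R (u - rank_pert M g e x)"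
      using resolvent_left[OF z x] by (simp add: u_def)
    ultimately have "norm x \<le> c0 * (norm u + (\<Sum>j<M. ((\<Sum>l<M. cmod (q j l) * (c0 * norm (g l))) * norm u) * norm (e j)))"
      using c0 by (metis (no_types, lifting) less_imp_le mult_left_mono order_trans)
    also have "\<dots> = C * norm u"
      unfolding C_def by (simp add: distrib_left distrib_right sum_distrib_left sum_distrib_right mult_ac)
    finally show ?thesis by (simp add: u_def)
  qed
  have "inj_on (\<lambda>x. ?A x - z *\<^sub>C x) D"
  proof (rule inj_onI)
    fix x y assume "x \<in> D" "y \<in> D" "?A x - z *\<^sub>C x = ?A y - z *\<^sub>C y"
    then show "x = y"
      using bound[of "x - y"] linN(5)[of x y] complex_vector.subspace_diff[OF sub, of x y] by simp
  qed
  moreover have "y \<in> (\<lambda>x. ?A x - z *\<^sub>C x) ` D" for y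
  proof -
    define c where "c j = (\<Sum>l<M. q j l * cinner (?R y) (g l))" for j
    define x where "x = ?R (y - (\<Sum>j<M. c j *\<^sub>C e j))"
    have x: "x \<in> D" unfolding x_def by (rule resolvent_in[OF z])
    have "cinner x (g i) = c i" if i: "i < M" for i
    proof -
      have "(\<Sum>j<M. ?G i j * c j) = (\<Sum>l<M. (\<Sum>j<M. ?G i j * q j l) * cinner (?R y) (g l))"
        unfolding c_def sum_distrib_left sum_distrib_right by (subst sum.swap) (simp add: mult.assoc)
      also have "\<dots> = cinner (?R y) (g i)" using i by (simp add: q(2) sum_delta_mult)
      finally have "c i + cinner (?R (\<Sum>j<M. c j *\<^sub>C e j)) (g i) = cinner (?R y) (g i)"
        unfolding pert_entry_mult[OF z i] .
      then show ?thesis by (simp add: x_def resolvent_diff[OF lin z] cinner_diff_left algebra_simps)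
    qed
    then have "rank_pert M g e x = (\<Sum>j<M. c j *\<^sub>C e j)" by (simp add: rank_pert_def)
    moreover have "A0 x - z *\<^sub>C x = y - (\<Sum>j<M. c j *\<^sub>C e j)" unfolding x_def by (rule resolvent_right[OF z])
    ultimately have "?A x - z *\<^sub>C x = y" by (simp add: algebra_simps)
    with x show ?thesis by blast
  qed
  ultimately show ?thesis
    unfolding op_resolvent_set_def bij_betw_def using bound by blast
qed

text \<open>Let \<open>c\<close> be a null vector of the matrix. The resolvent, applied to the
  combination of the \<open>e j\<close> with coefficients \<open>c j\<close>, has coefficients
  \<open>- c i\<close>; so the perturbation cancels \<open>(A0 - z) x\<close>, and \<open>x\<close>
  is not zero.\<close>

lemma pert_eigenvector:
  assumes z: "z \<in> op_resolvent_set D A0" and det: "pert_det D A0 M g e z = 0"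
  obtains x where "x \<in> D" "x \<noteq> 0" "A0 x + rank_pert M g e x = z *\<^sub>C x"
proof -
  let ?R = "resolvent D A0 z" and ?G = "pert_entry D A0 g e z"
  obtain c i0 where c: "i0 < M" "c i0 \<noteq> 0" "\<And>i. i < M \<Longrightarrow> (\<Sum>j<M. ?G i j * c j) = 0"
    using det unfolding pert_det_def det_fun_eq_0_iff by blast
  define x where "x = ?R (\<Sum>j<M. c j *\<^sub>C e j)"
  have coef: "cinner x (g i) = - c i" if "i < M" for i
    using c(3)[OF that] unfolding pert_entry_mult[OF z that] x_def by (simp add: add_eq_0_iff)
  have "rank_pert M g e x = - (\<Sum>j<M. c j *\<^sub>C e j)"
    unfolding rank_pert_def by (simp add: coef sum_negf)
  moreover have "A0 x - z *\<^sub>C x = (\<Sum>j<M. c j *\<^sub>C e j)" unfolding x_def by (rule resolvent_right[OF z])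
  ultimately have "A0 x + rank_pert M g e x = z *\<^sub>C x" by (simp add: algebra_simps)
  moreover have "x \<noteq> 0" using coef[OF c(1)] c(2) by auto
  moreover have "x \<in> D" unfolding x_def by (rule resolvent_in[OF z])
  ultimately show thesis using that by blast
qed

lemma pert_spectrum_iff:
  assumes z: "z \<in> op_resolvent_set D A0"
  shows "z \<in> op_spectrum D (\<lambda>x. A0 x + rank_pert M g e x) \<longleftrightarrow> pert_det D A0 M g e z = 0"
    and "z \<in> op_spectrum D (\<lambda>x. A0 x + rank_pert M g e x) \<Longrightarrow> op_eigenvalue D (\<lambda>x. A0 x + rank_pert M g e x) z"
proof -
  let ?A = "\<lambda>x. A0 x + rank_pert M g e x"
  have ev: "op_eigenvalue D ?A z" if "pert_det D A0 M g e z = 0"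
    using pert_eigenvector[OF z that] unfolding op_eigenvalue_def by metis
  have "z \<in> op_spectrum D ?A" if "op_eigenvalue D ?A z"
  proof -
    obtain x where x: "x \<in> D" "x \<noteq> 0" "?A x = z *\<^sub>C x" using \<open>op_eigenvalue D ?A z\<close> unfolding op_eigenvalue_def by blast
    have "?A 0 = z *\<^sub>C 0" using linear_operatorD(4)[OF linear_rank_pert[OF lin, of M g e]] by simp
    then have "\<not> inj_on (\<lambda>x. ?A x - z *\<^sub>C x) D"
      using x complex_vector.subspace_0[OF linear_operatorD(1)[OF lin]]
      unfolding inj_on_def by (metis diff_self)
    then show ?thesis by (simp add: op_spectrum_def op_resolvent_set_def bij_betw_def)
  qed
  then show "z \<in> op_spectrum D ?A \<longleftrightarrow> pert_det D A0 M g e z = 0"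
    using ev pert_resolvent_set[OF z] unfolding op_spectrum_def by blast
  then show "z \<in> op_spectrum D ?A \<Longrightarrow> op_eigenvalue D ?A z" using ev by blast
qed

lemma pert_det_holomorphic:
  assumes "open U" "U \<subseteq> op_resolvent_set D A0"
  shows "pert_det D A0 M g e holomorphic_on U"
  unfolding pert_det_def[abs_def] pert_entry_def[abs_def]
  by (intro holomorphic_on_det_fun holomorphic_intros resolvent_holomorphic[OF lin assms])

text \<open>Adding to \<open>e i0\<close> a multiple of \<open>v\<close>, normalised by
  \<open>cinner v (g i0)\<close>, turns the eigenvalue \<open>z\<close> of \<open>v\<close> into
  \<open>z + 1\<close>. The determinant changes by \<open>(z + 1 - w) / (z - w)\<close>, as a
  product of eigenvalue factors would.\<close>

lemma pert_det_deflate: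
  assumes w: "w \<in> op_resolvent_set D A0" and v: "v \<in> D" "A0 v + rank_pert M g e v = z *\<^sub>C v"
    and i0: "i0 < M" "cinner v (g i0) \<noteq> 0" and wz: "w \<noteq> z"
  shows "pert_det D A0 M g (e(i0 := e i0 + (1 / cinner v (g i0)) *\<^sub>C v)) w
    = (1 + 1 / (z - w)) * pert_det D A0 M g e w"
proof -
  let ?R = "resolvent D A0 w" and ?G = "pert_entry D A0 g e w"
  define c where "c = 1 / cinner v (g i0)"
  \<comment> \<open>Coordinates of the new column \<open>i0\<close> in terms of the old columns. The
    added part is expressed through the coefficients of \<open>v\<close> because
    \<open>(A - w) v = (z - w) v\<close>.\<close>
  define x where "x i = (if i = i0 then 1 else 0) + c * cinner v (g i) / (z - w)" for i
  have Gv: "(\<Sum>m<M. ?G i m * cinner v (g m)) = (z - w) * cinner (?R v) (g i)" if "i < M" for i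
  proof -
    have "A0 v + rank_pert M g e v - w *\<^sub>C v = (z - w) *\<^sub>C v" using v(2) by (simp add: scaleC_algebra)
    then show ?thesis
      unfolding pert_entry_coefficients[OF w v(1) that]
      by (simp add: resolvent_scale[OF lin w] cinner_scaleC_left)
  qed
  have Gx: "(\<Sum>m<M. ?G i m * x m) = ?G i i0 + c * cinner (?R v) (g i)" if "i < M" for i
  proof -
    have "(\<Sum>m<M. ?G i m * x m) = (\<Sum>m<M. (if i0 = m then 1 else 0) * ?G i m)
        + (c / (z - w)) * (\<Sum>m<M. ?G i m * cinner v (g m))"
      unfolding x_def sum_distrib_left sum.distrib[symmetric]
      by (intro sum.cong) (auto simp: algebra_simps)
    also have "\<dots> = ?G i i0 + (c / (z - w)) * ((z - w) * cinner (?R v) (g i))"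
      by (simp only: sum_delta_mult[OF i0(1)] Gv[OF that])
    also have "\<dots> = ?G i i0 + c * cinner (?R v) (g i)" using wz by simp
    finally show ?thesis .
  qed
  have "pert_det D A0 M g (e(i0 := e i0 + c *\<^sub>C v)) w
      = det_fun M (\<lambda>i j. if j = i0 then \<Sum>m<M. ?G i m * x m else ?G i j)"
    unfolding pert_det_def
  proof (rule det_fun_cong)
    fix i j assume "i < M" "j < M"
    then show "pert_entry D A0 g (e(i0 := e i0 + c *\<^sub>C v)) w i j
        = (if j = i0 then \<Sum>m<M. ?G i m * x m else ?G i j)"
      by (simp only: Gx) (simp add: pert_entry_def resolvent_add[OF lin w] resolvent_scale[OF lin w]
          cinner_add_left cinner_scaleC_left)
  qed
  also have "\<dots> = x i0 * pert_det D A0 M g e w"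
    unfolding pert_det_def by (rule det_fun_replace_column[OF i0(1)])
  also have "x i0 = 1 + 1 / (z - w)" using i0(2) by (simp add: x_def c_def)
  finally show ?thesis unfolding c_def .
qed

text \<open>Deflating one eigenvector at a time lowers the order of the zero of the perturbation
  determinant and the dimension of the root space by one each.\<close>

lemma root_space_basis:
  assumes U: "open U" "U \<subseteq> op_resolvent_set D A0" "z \<in> U"
    and ord: "eventually (\<lambda>w. pert_det D A0 M g e w = (w - z) ^ n * h w) (at z)" "isCont h z" "h z \<noteq> 0"
  shows "\<exists>b. finite b \<and> \<not> complex_vector.dependent b \<and> card b = n \<and>
    complex_vector.span b = root_space D (\<lambda>x. A0 x + rank_pert M g e x) z"
  using ord
proof (induction n arbitrary: e h)
  case 0
  let ?A = "\<lambda>x. A0 x + rank_pert M g e x"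
  have z: "z \<in> op_resolvent_set D A0" using U by blast
  have "isCont (pert_det D A0 M g e) z"
    using holomorphic_on_imp_continuous_on[OF pert_det_holomorphic[OF U(1,2)]] U(1,3)
    by (simp add: continuous_on_eq_continuous_at)
  then have "((\<lambda>w. (w - z) ^ 0 * h w) \<longlongrightarrow> pert_det D A0 M g e z) (at z)"
    using 0(1) by (simp add: isCont_def Lim_transform_eventually)
  moreover have "((\<lambda>w. (w - z) ^ 0 * h w) \<longlongrightarrow> (z - z) ^ 0 * h z) (at z)"
    using 0(2) unfolding isCont_def by (intro tendsto_intros)
  ultimately have "pert_det D A0 M g e z = h z"
    using tendsto_unique[OF at_neq_bot] by fastforce
  then have "z \<in> op_resolvent_set D ?A" using 0(3) by (intro pert_resolvent_set[OF z]) simp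
  then have inj: "inj_on (\<lambda>x. ?A x - z *\<^sub>C x) D" by (simp add: op_resolvent_set_def bij_betw_def)
  note linN = linear_operatorD[OF linear_operator_shift[OF linear_rank_pert[OF lin, of M g e], of z]]
  have "root_space D ?A z = {0}"
  proof (intro equalityI subsetI)
    fix x assume "x \<in> root_space D ?A z"
    then obtain n where n: "\<forall>j<n. ((\<lambda>y. ?A y - z *\<^sub>C y) ^^ j) x \<in> D" "((\<lambda>y. ?A y - z *\<^sub>C y) ^^ n) x = 0"
      unfolding root_space_def by blast
    then show "x \<in> {0}"
    proof (induction n)
      case (Suc n)
      let ?y = "((\<lambda>y. ?A y - z *\<^sub>C y) ^^ n) x"
      have "?y \<in> D" "?A ?y - z *\<^sub>C ?y = ?A 0 - z *\<^sub>C 0" using Suc(2,3) linN(4) by auto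
      then have "?y = 0" using inj complex_vector.subspace_0[OF linN(1)] unfolding inj_on_def by blast
      then show ?case using Suc by simp
    qed simp
  qed (use complex_vector.subspace_0[OF root_space_subspace[OF linear_rank_pert[OF lin]]] in auto)
  then show ?case
    by (intro exI[of _ "{}"]) (simp add: complex_vector.span_empty complex_vector.independent_empty)
next
  case (Suc n)
  let ?A = "\<lambda>x. A0 x + rank_pert M g e x"
  have z: "z \<in> op_resolvent_set D A0" using U by blast
  have "isCont (pert_det D A0 M g e) z"
    using holomorphic_on_imp_continuous_on[OF pert_det_holomorphic[OF U(1,2)]] U(1,3)
    by (simp add: continuous_on_eq_continuous_at)
  then have "((\<lambda>w. (w - z) ^ Suc n * h w) \<longlongrightarrow> pert_det D A0 M g e z) (at z)"
    using Suc(2) unfolding isCont_def by (rule Lim_transform_eventually)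
  moreover have "((\<lambda>w. (w - z) ^ Suc n * h w) \<longlongrightarrow> (z - z) ^ Suc n * h z) (at z)"
    using Suc(3) unfolding isCont_def by (intro tendsto_intros)
  ultimately have "pert_det D A0 M g e z = 0"
    using tendsto_unique[OF at_neq_bot] by fastforce
  then obtain v where v: "v \<in> D" "v \<noteq> 0" "?A v = z *\<^sub>C v" using pert_eigenvector[OF z] by blast
  \<comment> \<open>If every \<open>g i\<close> were orthogonal to \<open>v\<close>, then
    \<open>v\<close> would be an eigenvector of \<open>A0\<close> at a point of its resolvent
    set.\<close>
  have "\<exists>i<M. cinner v (g i) \<noteq> 0"
  proof (rule ccontr)
    assume "\<not> (\<exists>i<M. cinner v (g i) \<noteq> 0)"
    then have "rank_pert M g e v = 0" by (simp add: rank_pert_def)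
    then have "v = resolvent D A0 z 0" using v resolvent_left[OF z v(1)] by simp
    then show False using v(2) resolvent_scale[OF lin z, of 0 0] by simp
  qed
  then obtain i0 where i0: "i0 < M" "cinner v (g i0) \<noteq> 0" by blast
  let ?e = "e(i0 := e i0 + (1 / cinner v (g i0)) *\<^sub>C v)"
  let ?A' = "\<lambda>x. A0 x + rank_pert M g ?e x"
  have "eventually (\<lambda>w. w \<in> U) (at z)" using U(1,3) by (metis eventually_at_topological)
  then have "eventually (\<lambda>w. w \<in> U \<and> w \<noteq> z) (at z)"
    by (simp add: eventually_conj_iff eventually_neq_at_within)
  \<comment> \<open>One factor \<open>w - z\<close> is consumed: together with the factor from the
    deflation it becomes \<open>w - z - 1\<close>, which is nonzero at \<open>z\<close> and joins
    the cofactor.\<close>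
  with Suc(2) have ev: "eventually (\<lambda>w. pert_det D A0 M g ?e w = (w - z) ^ n * ((w - z - 1) * h w)) (at z)"
  proof eventually_elim
    case (elim w)
    have "pert_det D A0 M g ?e w = (1 + 1 / (z - w)) * ((w - z) ^ Suc n * h w)"
      using pert_det_deflate[OF _ v(1,3) i0] elim U(2) by auto
    also have "\<dots> = ((1 + 1 / (z - w)) * (w - z)) * ((w - z) ^ n * h w)" by simp
    also have "(1 + 1 / (z - w)) * (w - z) = w - z - 1"
    proof -
      have "(w - z) / (z - w) = - 1" using elim by (auto simp: divide_eq_eq)
      then show ?thesis by (simp add: distrib_right)
    qed
    also have "(w - z - 1) * ((w - z) ^ n * h w) = (w - z) ^ n * ((w - z - 1) * h w)"
      by (rule mult.left_commute)
    finally show ?case .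
  qed
  have "isCont (\<lambda>w. (w - z - 1) * h w) z" using Suc(3) by (intro continuous_intros)
  moreover have "(z - z - 1) * h z \<noteq> 0" using Suc(4) by simp
  ultimately obtain b where b: "finite b" "\<not> complex_vector.dependent b" "card b = n"
      "complex_vector.span b = root_space D ?A' z"
    using Suc(1)[OF ev] by blast
  have rp: "rank_pert M g ?e x = rank_pert M g e x + (cinner x (g i0) / cinner v (g i0)) *\<^sub>C v" for x
  proof -
    have "rank_pert M g ?e x = (\<Sum>i<M. cinner x (g i) *\<^sub>C e i + (if i0 = i then (cinner x (g i0) / cinner v (g i0)) *\<^sub>C v else 0))"
      unfolding rank_pert_def by (intro sum.cong) (auto simp: scaleC_algebra)
    then show ?thesis using i0(1) by (simp add: rank_pert_def sum.distrib)
  qed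
  note defl = root_space_deflate[OF linear_rank_pert[OF lin, of M g e] v(1,2,3) linear_rank_pert[OF lin, of M g ?e],
      of "\<lambda>x. cinner x (g i0) / cinner v (g i0)"]
  have d1: "root_space D ?A z = {x. \<exists>c. x - c *\<^sub>C v \<in> root_space D ?A' z}" and d2: "v \<notin> root_space D ?A' z"
    by (rule defl; use rp i0(2) in simp)+
  have vb: "v \<notin> b" using d2 b(4) complex_vector.span_base by metis
  show ?case
  proof (intro exI[of _ "insert v b"] conjI)
    show "\<not> complex_vector.dependent (insert v b)"
      using complex_vector.independent_insert[of v b] vb b(2,4) d2 by simp
    show "complex_vector.span (insert v b) = root_space D ?A z"
      unfolding complex_vector.span_insert b(4) d1 ..
  qed (use b vb in auto)
qed

text \<open>Multiplicativity of perturbation determinants through an intermediate operator. The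
  common \<open>e\<close> makes it a product of two matrices of the same size.\<close>

lemma pert_det_chain:
  assumes z: "z \<in> op_resolvent_set D A0" and z1: "z \<in> op_resolvent_set D (\<lambda>x. A0 x + rank_pert M g1 e x)"
  shows "pert_det D A0 M g e z
    = pert_det D (\<lambda>x. A0 x + rank_pert M g1 e x) M (\<lambda>i. g i - g1 i) e z * pert_det D A0 M g1 e z"
proof -
  let ?A1 = "\<lambda>x. A0 x + rank_pert M g1 e x"
  let ?R = "resolvent D A0 z" and ?R1 = "resolvent D ?A1 z"
  let ?G = "pert_entry D A0 g e z" and ?G1 = "pert_entry D A0 g1 e z"
  let ?H = "pert_entry D ?A1 (\<lambda>i. g i - g1 i) e z"
  note lin1 = linear_rank_pert[OF lin, of M g1 e]
  have R: "?R (e j) = (\<Sum>l<M. ?G1 l j *\<^sub>C ?R1 (e l))" if j: "j < M" for j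
  proof -
    have "?A1 (?R (e j)) - z *\<^sub>C ?R (e j) = e j + rank_pert M g1 e (?R (e j))"
      using resolvent_right[OF z, of "e j"] by (simp add: algebra_simps)
    also have "\<dots> = (\<Sum>l<M. ?G1 l j *\<^sub>C e l)"
    proof -
      have "(\<Sum>l<M. (if l = j then 1 else 0) *\<^sub>C e l) = (\<Sum>l<M. if l = j then e l else 0)"
        by (intro sum.cong) (auto simp: scaleC_one)
      then show ?thesis using j by (simp add: rank_pert_def pert_entry_def scaleC_add_left sum.distrib)
    qed
    finally have "?R (e j) = ?R1 (\<Sum>l<M. ?G1 l j *\<^sub>C e l)"
      using resolvent_eqI[OF z1 resolvent_in[OF z]] by metis
    then show ?thesis by (simp add: resolvent_sum[OF lin1 z1])
  qed
  have "pert_det D A0 M g e z = det_fun M (\<lambda>i j. \<Sum>l<M. ?H i l * ?G1 l j)"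
    unfolding pert_det_def
  proof (rule det_fun_cong)
    fix i j assume ij: "i < M" "j < M"
    have "(\<Sum>l<M. ?H i l * ?G1 l j) = ?G1 i j + cinner (\<Sum>l<M. ?G1 l j *\<^sub>C ?R1 (e l)) (g i - g1 i)"
      unfolding pert_entry_def[of D ?A1] distrib_right sum.distrib sum_delta_mult[OF ij(1)]
      by (simp add: cinner_sum_left cinner_scaleC_left mult.commute)
    also have "\<dots> = ?G1 i j + cinner (?R (e j)) (g i - g1 i)" by (simp only: R[OF ij(2)])
    also have "\<dots> = ?G i j" by (simp add: pert_entry_def cinner_diff_right)
    finally show "?G i j = (\<Sum>l<M. ?H i l * ?G1 l j)" by simp
  qed
  also have "\<dots> = pert_det D ?A1 M (\<lambda>i. g i - g1 i) e z * pert_det D A0 M g1 e z"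
    unfolding pert_det_def by (rule det_fun_mult)
  finally show ?thesis .
qed

end

section \<open>Perturbations of a diagonal operator\<close>

locale diagonal_operator = complete_onb \<phi> for \<phi> :: "nat \<Rightarrow> 'a::complex_hilbert" +
  fixes D :: "'a set" and T :: "'a \<Rightarrow> 'a" and \<mu> :: "nat \<Rightarrow> real"
  assumes self_adjoint: "self_adjoint D T"
    and basis_in_domain: "\<phi> k \<in> D"
    and T_basis: "T (\<phi> k) = complex_of_real (\<mu> k) *\<^sub>C \<phi> k"
begin

lemma subspace_D: "complex_vector.subspace D"
  using self_adjoint by (simp add: self_adjoint_def linear_operator_def)

lemmas D_closed [simp] = complex_vector.subspace_0[OF subspace_D] complex_vector.subspace_add[OF subspace_D]
  complex_vector.subspace_diff[OF subspace_D] complex_vector.subspace_scale[OF subspace_D]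

lemma T_add: "x \<in> D \<Longrightarrow> y \<in> D \<Longrightarrow> T (x + y) = T x + T y"
  and T_scale: "x \<in> D \<Longrightarrow> T (c *\<^sub>C x) = c *\<^sub>C T x"
  using self_adjoint by (simp_all add: self_adjoint_def linear_operator_def)

lemma cinner_T_basis:
  assumes "x \<in> D" shows "cinner (T x) (\<phi> k) = \<mu> k * cinner x (\<phi> k)"
proof -
  have "(\<phi> k, T (\<phi> k)) \<in> adjoint_graph D T"
    using self_adjoint basis_in_domain by (auto simp: self_adjoint_def)
  then show ?thesis
    using assms by (simp add: adjoint_graph_def T_basis cinner_scaleC_right)
qed

lemma proj_in_D: "proj n x \<in> D"
  unfolding proj_def
  by (intro complex_vector.subspace_sum[OF subspace_D] complex_vector.subspace_scale[OF subspace_D]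
      basis_in_domain)

lemma T_finite_comb:
  "finite I \<Longrightarrow> (\<Sum>i\<in>I. c i *\<^sub>C \<phi> i) \<in> D \<and> T (\<Sum>i\<in>I. c i *\<^sub>C \<phi> i) = (\<Sum>i\<in>I. c i *\<^sub>C T (\<phi> i))"
proof (induction I rule: finite_induct)
  case empty
  have "T 0 = 0" using T_scale[of 0 0] by simp
  then show ?case by simp
next
  case (insert i I)
  then show ?case by (simp add: T_add T_scale basis_in_domain)
qed

lemma T_proj: "x \<in> D \<Longrightarrow> T (proj n x) = proj n (T x)"
  unfolding proj_def
  by (simp add: T_finite_comb T_basis cinner_T_basis scaleC_scaleC mult.commute)

text \<open>A self-adjoint operator equals its adjoint, so it suffices to exhibit the value that the
  adjoint takes at \<open>x\<close>; Riesz-Fischer builds it from its coefficients.\<close>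

lemma in_domainI:
  assumes "summable (\<lambda>k. (cmod (\<mu> k * cinner x (\<phi> k)))\<^sup>2)"
  shows "x \<in> D"
proof -
  obtain z where z: "\<And>k. cinner z (\<phi> k) = \<mu> k * cinner x (\<phi> k)"
    using riesz_fischer[OF assms] by blast
  have "cinner (T w) x = cinner w z" if "w \<in> D" for w
  proof -
    have "(\<lambda>k. cinner (T w) (cinner x (\<phi> k) *\<^sub>C \<phi> k)) sums cinner (T w) x"
      by (rule bounded_linear.sums[OF bounded_linear_cinner_right expansion])
    moreover have "(\<lambda>k. cinner w (cinner z (\<phi> k) *\<^sub>C \<phi> k)) sums cinner w z"
      by (rule bounded_linear.sums[OF bounded_linear_cinner_right expansion])
    moreover have "cinner (T w) (cinner x (\<phi> k) *\<^sub>C \<phi> k) = cinner w (cinner z (\<phi> k) *\<^sub>C \<phi> k)" for k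
      by (simp add: cinner_scaleC_right z cinner_T_basis[OF that])
    ultimately show ?thesis by (simp add: sums_iff)
  qed
  then have "(x, z) \<in> adjoint_graph D T" by (simp add: adjoint_graph_def)
  then show ?thesis using self_adjoint by (auto simp: self_adjoint_def)
qed

text \<open>A finite sum is added, so the domain stays \<open>D\<close>. Statements that read
  \<open>\<nu>\<close> as the whole diagonal therefore carry the condition
  \<open>\<nu> k = \<mu> k\<close> for \<open>k \<ge> M\<close>.\<close>

definition modified :: "nat \<Rightarrow> (nat \<Rightarrow> real) \<Rightarrow> 'a \<Rightarrow> 'a" where
  "modified M \<nu> x = T x + (\<Sum>k<M. (complex_of_real (\<nu> k - \<mu> k) * cinner x (\<phi> k)) *\<^sub>C \<phi> k)"

lemma linear_modified: "linear_operator D (modified M \<nu>)"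
  unfolding linear_operator_def modified_def
  by (auto simp: subspace_D T_add T_scale cinner_add_left cinner_scaleC_left sum.distrib
      sum_subtractf scaleC_algebra scaleC_sum_right algebra_simps)

lemma cinner_modified:
  assumes "x \<in> D" "\<And>k. k \<ge> M \<Longrightarrow> \<nu> k = \<mu> k"
  shows "cinner (modified M \<nu> x - z *\<^sub>C x) (\<phi> k) = (complex_of_real (\<nu> k) - z) * cinner x (\<phi> k)"
proof -
  have "cinner (\<Sum>k<M. (complex_of_real (\<nu> k - \<mu> k) * cinner x (\<phi> k)) *\<^sub>C \<phi> k) (\<phi> k)
      = complex_of_real (\<nu> k - \<mu> k) * cinner x (\<phi> k)"
    using assms(2)[of k] by (subst cinner_finite_comb) auto
  then show ?thesis
    by (simp add: modified_def cinner_diff_left cinner_add_left cinner_T_basis assms(1)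
        cinner_scaleC_left algebra_simps)
qed

lemma modified_bounded_below:
  assumes "x \<in> D" "\<And>k. k \<ge> M \<Longrightarrow> \<nu> k = \<mu> k" "d > 0" "\<And>k. d \<le> cmod (complex_of_real (\<nu> k) - z)"
  shows "d * norm x \<le> norm (modified M \<nu> x - z *\<^sub>C x)"
proof (rule power2_le_imp_le)
  let ?y = "modified M \<nu> x - z *\<^sub>C x"
  have 1: "(\<lambda>k. (cmod (cinner ?y (\<phi> k)))\<^sup>2) sums (norm ?y)\<^sup>2" by (rule parseval)
  have 2: "(\<lambda>k. d\<^sup>2 * (cmod (cinner x (\<phi> k)))\<^sup>2) sums (d\<^sup>2 * (norm x)\<^sup>2)"
    by (rule sums_mult[OF parseval])
  have "d\<^sup>2 * (cmod (cinner x (\<phi> k)))\<^sup>2 \<le> (cmod (cinner ?y (\<phi> k)))\<^sup>2" for k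
    using assms(3) assms(4)[of k]
    by (simp add: cinner_modified[OF assms(1,2)] norm_mult power_mult_distrib mult_right_mono power_mono)
  then have "d\<^sup>2 * (norm x)\<^sup>2 \<le> (norm ?y)\<^sup>2" by (rule sums_le[OF _ 2 1])
  then show "(d * norm x)\<^sup>2 \<le> (norm ?y)\<^sup>2" by (simp add: power_mult_distrib)
qed simp

text \<open>The gap \<open>d\<close> keeps the divided coefficients square summable. For
  \<open>k \<ge> M\<close>, \<open>\<mu> k * c k\<close> is the coefficient of \<open>y\<close> plus
  \<open>z * c k\<close>, which puts the solution into \<open>D\<close>.\<close>

lemma modified_surj:
  assumes \<nu>: "\<And>k. k \<ge> M \<Longrightarrow> \<nu> k = \<mu> k" and d: "d > 0" "\<And>k. d \<le> cmod (complex_of_real (\<nu> k) - z)"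
  obtains x where "x \<in> D" "modified M \<nu> x - z *\<^sub>C x = y"
proof -
  define c where "c k = cinner y (\<phi> k) / (complex_of_real (\<nu> k) - z)" for k
  have nz: "complex_of_real (\<nu> k) - z \<noteq> 0" for k using d(1) d(2)[of k] by auto
  have y2: "summable (\<lambda>k. (cmod (cinner y (\<phi> k)))\<^sup>2)" using parseval by (rule sums_summable)
  have c_le: "cmod (c k) \<le> cmod (cinner y (\<phi> k)) / d" for k
    unfolding c_def norm_divide by (intro divide_left_mono mult_pos_pos d) (use d(1) nz in auto)
  have "(cmod (c k))\<^sup>2 \<le> (1/d\<^sup>2) * (cmod (cinner y (\<phi> k)))\<^sup>2" for k
    using power_mono[OF c_le[of k], of 2] by (simp add: power_divide)
  then have c2: "summable (\<lambda>k. (cmod (c k))\<^sup>2)"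
    by (intro summable_comparison_test'[OF summable_mult[OF y2, of "1/d\<^sup>2"]]) auto
  obtain x where x: "\<And>k. cinner x (\<phi> k) = c k" using riesz_fischer[OF c2] by blast
  have "(cmod (\<mu> k * c k))\<^sup>2 \<le> 2 * (cmod (cinner y (\<phi> k)))\<^sup>2 + 2 * (cmod z)\<^sup>2 * (cmod (c k))\<^sup>2"
    if "k \<ge> M" for k
  proof -
    have "\<mu> k * c k = cinner y (\<phi> k) + z * c k"
      using nz[of k] \<nu>[OF that] by (simp add: c_def field_simps)
    then have "cmod (\<mu> k * c k) \<le> cmod (cinner y (\<phi> k)) + cmod z * cmod (c k)"
      by (metis norm_triangle_ineq norm_mult)
    then have "(cmod (\<mu> k * c k))\<^sup>2 \<le> (cmod (cinner y (\<phi> k)) + cmod z * cmod (c k))\<^sup>2"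
      by (intro power_mono) auto
    also have "\<dots> \<le> 2 * (cmod (cinner y (\<phi> k)))\<^sup>2 + 2 * (cmod z * cmod (c k))\<^sup>2"
      using sum_squares_bound[of "cmod (cinner y (\<phi> k))" "cmod z * cmod (c k)"]
      by (simp add: power2_sum)
    finally show ?thesis by (simp add: power_mult_distrib)
  qed
  then have "summable (\<lambda>k. (cmod (\<mu> k * c k))\<^sup>2)"
    by (intro summable_comparison_test'[OF summable_add[OF summable_mult[OF y2, of 2]
          summable_mult[OF c2, of "2 * (cmod z)\<^sup>2"]], of M]) auto
  then have xD: "x \<in> D" by (intro in_domainI) (simp add: x)
  have "modified M \<nu> x - z *\<^sub>C x = y"
    by (rule coefficients_eqI) (use nz in \<open>simp add: cinner_modified[OF xD \<nu>] x c_def\<close>)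
  with xD that show thesis by blast
qed

end

section \<open>Adding \<open>B\<close>: solvability from the Hilbert-Schmidt bound\<close>

locale perturbed_diagonal = diagonal_operator +
  fixes DB :: "'a set" and B :: "'a \<Rightarrow> 'a"
  assumes B_linear: "linear_operator DB B"
    and B_domain: "D \<subseteq> DB"
    and B_relatively_bounded: "relatively_bounded D T B"
begin

lemma B_add: "x \<in> D \<Longrightarrow> y \<in> D \<Longrightarrow> B (x + y) = B x + B y"
  and B_scale: "x \<in> D \<Longrightarrow> B (c *\<^sub>C x) = c *\<^sub>C B x"
  using B_linear B_domain unfolding linear_operator_def by blast+

lemma B_diff: "x \<in> D \<Longrightarrow> y \<in> D \<Longrightarrow> B (x - y) = B x - B y"
  using B_add[of "x - y" y] by (simp add: algebra_simps)

lemma B_finite_comb: "finite I \<Longrightarrow> B (\<Sum>i\<in>I. c i *\<^sub>C \<phi> i) = (\<Sum>i\<in>I. c i *\<^sub>C B (\<phi> i))"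
proof (induction I rule: finite_induct)
  case empty
  have "B 0 = 0" using B_scale[of 0 0] by simp
  then show ?case by simp
next
  case (insert i I)
  then show ?case by (simp add: B_add B_scale basis_in_domain T_finite_comb)
qed

text \<open>\<open>T\<close> commutes with the partial sums of the expansion, so these converge to
  \<open>x\<close> in the graph norm. Relative boundedness thereby lets the values on the basis
  control \<open>B\<close> on all of \<open>D\<close>.\<close>

lemma B_proj_tendsto:
  assumes "x \<in> D" shows "(\<lambda>n. B (proj n x)) \<longlonglongrightarrow> B x"
proof -
  obtain c where c: "\<And>x. x \<in> D \<Longrightarrow> norm (B x) \<le> c * (norm x + norm (T x))"
    using B_relatively_bounded by (auto simp: relatively_bounded_def)
  have T_diff: "T (proj n x - x) = proj n (T x) - T x" for n
    using T_add[of "proj n x - x" x] assms proj_in_D by (simp add: T_proj algebra_simps)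
  have "(\<lambda>n. c * (norm (proj n x - x) + norm (proj n (T x) - T x))) \<longlonglongrightarrow> c * (norm (x - x) + norm (T x - T x))"
    by (intro tendsto_intros proj_tendsto)
  then have lim: "(\<lambda>n. c * (norm (proj n x - x) + norm (proj n (T x) - T x))) \<longlonglongrightarrow> 0" by simp
  have "(\<lambda>n. B (proj n x) - B x) \<longlonglongrightarrow> 0"
    by (rule Lim_null_comparison[OF _ lim], rule always_eventually)
      (metis B_diff T_diff assms c proj_in_D D_closed(3))
  then show ?thesis by (simp add: LIM_zero_iff)
qed

text \<open>\<open>t\<close> is a homotopy parameter: at \<open>t = 0\<close> the operator is
  diagonal and determinants are explicit, at \<open>t = 1\<close> with \<open>\<nu> = \<mu>\<close>
  it is \<open>A\<close>.\<close>

definition perturbed :: "nat \<Rightarrow> (nat \<Rightarrow> real) \<Rightarrow> real \<Rightarrow> 'a \<Rightarrow> 'a" where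
  "perturbed M \<nu> t x = modified M \<nu> x + complex_of_real t *\<^sub>C B x"

lemma linear_perturbed: "linear_operator D (perturbed M \<nu> t)"
  using linear_modified[of M \<nu>] unfolding linear_operator_def perturbed_def
  by (auto simp: B_add B_scale scaleC_algebra mult.commute)

text \<open>The last clause bounds the Hilbert-Schmidt norm of \<open>B\<close> times the resolvent by \<open>1/2\<close>.\<close>

definition admissible :: "nat \<Rightarrow> (nat \<Rightarrow> real) \<Rightarrow> complex \<Rightarrow> real \<Rightarrow> bool" where
  "admissible M \<nu> z d \<longleftrightarrow> (\<forall>k\<ge>M. \<nu> k = \<mu> k) \<and> d > 0 \<and> (\<forall>k. d \<le> cmod (complex_of_real (\<nu> k) - z)) \<and>
     (\<forall>n. (\<Sum>k<n. (norm (B (\<phi> k)) / cmod (complex_of_real (\<nu> k) - z))\<^sup>2) \<le> 1/4)"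

text \<open>The coefficients of \<open>x\<close> are those of
  \<open>(modified M \<nu> - z) x\<close> divided by \<open>\<nu> k - z\<close>, so Cauchy-Schwarz
  bounds \<open>B (proj n x)\<close> by the square root of the Hilbert-Schmidt sum; then
  \<open>n\<close> tends to infinity.\<close>

lemma B_half_bound:
  assumes ad: "admissible M \<nu> z d" and x: "x \<in> D"
  shows "norm (B x) \<le> norm (modified M \<nu> x - z *\<^sub>C x) / 2"
proof -
  let ?y = "modified M \<nu> x - z *\<^sub>C x"
  have nz: "cmod (complex_of_real (\<nu> k) - z) > 0" for k using ad unfolding admissible_def by (blast intro: order.strict_trans2)
  have "norm (B (proj n x)) \<le> norm ?y / 2" for n
  proof -
    have "norm (B (proj n x)) \<le> (\<Sum>k<n. cmod (cinner x (\<phi> k)) * norm (B (\<phi> k)))"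
      unfolding proj_def by (simp add: B_finite_comb norm_sum[THEN order_trans] norm_scaleC)
    also have "\<dots> = (\<Sum>k<n. cmod (cinner ?y (\<phi> k)) * (norm (B (\<phi> k)) / cmod (complex_of_real (\<nu> k) - z)))"
      using nz ad by (intro sum.cong) (auto simp: cinner_modified[OF x] admissible_def norm_mult)
    finally have "(norm (B (proj n x)))\<^sup>2
        \<le> (\<Sum>k<n. cmod (cinner ?y (\<phi> k)) * (norm (B (\<phi> k)) / cmod (complex_of_real (\<nu> k) - z)))\<^sup>2"
      by (intro power_mono) auto
    also have "\<dots> \<le> (\<Sum>k<n. (cmod (cinner ?y (\<phi> k)))\<^sup>2) * (\<Sum>k<n. (norm (B (\<phi> k)) / cmod (complex_of_real (\<nu> k) - z))\<^sup>2)"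
      by (rule Cauchy_Schwarz_ineq_sum)
    also have "\<dots> \<le> (norm ?y)\<^sup>2 * (1/4)"
      using ad bessel[of ?y n] by (intro mult_mono) (auto simp: admissible_def intro!: sum_nonneg)
    also have "\<dots> = (norm ?y / 2)\<^sup>2" by (simp add: power_divide)
    finally show ?thesis by (rule power2_le_imp_le) simp
  qed
  then show ?thesis
    by (intro LIMSEQ_le_const2[OF tendsto_norm[OF B_proj_tendsto[OF x]]]) auto
qed

lemma perturbed_bounded_below:
  assumes ad: "admissible M \<nu> z d" and x: "x \<in> D" and t: "0 \<le> t" "t \<le> 1"
  shows "norm x \<le> 2 / d * norm (perturbed M \<nu> t x - z *\<^sub>C x)"
proof -
  let ?y = "modified M \<nu> x - z *\<^sub>C x"
  have d: "d > 0" using ad by (simp add: admissible_def)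
  have "norm (complex_of_real t *\<^sub>C B x) \<le> norm (B x)"
    using t by (simp add: norm_scaleC mult_left_le_one_le)
  then have "norm (perturbed M \<nu> t x - z *\<^sub>C x) \<ge> norm ?y - norm ?y / 2"
    using norm_triangle_ineq4[of "?y + complex_of_real t *\<^sub>C B x" "complex_of_real t *\<^sub>C B x"]
      B_half_bound[OF ad x] by (simp add: perturbed_def algebra_simps)
  moreover have "d * norm x \<le> norm ?y"
    using ad by (intro modified_bounded_below x) (auto simp: admissible_def)
  ultimately show ?thesis using d by (simp add: field_simps)
qed

lemma perturbed_bij:
  assumes ad: "admissible M \<nu> z d" and t: "0 \<le> t" "t \<le> 1"
  shows "bij_betw (\<lambda>x. perturbed M \<nu> t x - z *\<^sub>C x) D UNIV"
proof (rule bij_betw_imageI)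
  let ?P = "\<lambda>x. perturbed M \<nu> t x - z *\<^sub>C x"
  show "inj_on ?P D"
  proof (rule inj_onI)
    fix x y assume xy: "x \<in> D" "y \<in> D" "?P x = ?P y"
    have "?P x = ?P (x - y) + ?P y"
      using linear_perturbed[of M \<nu> t] xy(1,2)
      unfolding linear_operator_def by (metis (no_types, lifting) add_diff_add diff_add_cancel D_closed(3)
          scaleC_add_right)
    with xy have "?P (x - y) = 0" by simp
    then show "x = y" using perturbed_bounded_below[OF ad _ t, of "x - y"] xy by simp
  qed
  show "?P ` D = UNIV"
  proof (rule UNIV_eq_I[symmetric])
    fix y
    have "\<exists>x. x \<in> D \<and> modified M \<nu> x - z *\<^sub>C x = u" for u
      using modified_surj[of M \<nu> d z u] ad unfolding admissible_def by metis
    then obtain R where R: "\<And>u. R u \<in> D" "\<And>u. modified M \<nu> (R u) - z *\<^sub>C R u = u" by metis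
    \<comment> \<open>With \<open>x = R u\<close> the equation to be solved reads
      \<open>u + t B (R u) = y\<close>, and the half bound makes \<open>F\<close> a
      contraction.\<close>
    define F where "F u = y - complex_of_real t *\<^sub>C B (R u)" for u
    have "dist (F u) (F v) \<le> (1/2) * dist u v" for u v
    proof -
      have lin: "modified M \<nu> (R u) = modified M \<nu> (R u - R v) + modified M \<nu> (R v)"
        using linear_modified[of M \<nu>] R(1)
        unfolding linear_operator_def by (metis diff_add_cancel D_closed(3))
      have "u - v = (modified M \<nu> (R u) - z *\<^sub>C R u) - (modified M \<nu> (R v) - z *\<^sub>C R v)"
        by (simp only: R(2))
      also have "\<dots> = modified M \<nu> (R u - R v) - z *\<^sub>C (R u - R v)"
        unfolding lin by (simp add: scaleC_algebra)
      finally have "norm (B (R u - R v)) \<le> norm (u - v) / 2"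
        using B_half_bound[OF ad, of "R u - R v"] R(1) by simp
      moreover have "dist (F u) (F v) = norm (complex_of_real t *\<^sub>C B (R u - R v))"
        using R(1) by (simp add: F_def dist_norm B_diff scaleC_algebra norm_minus_commute)
      moreover have "\<dots> \<le> norm (B (R u - R v))"
        using t by (simp add: norm_scaleC mult_left_le_one_le)
      ultimately show ?thesis by (simp add: dist_norm)
    qed
    then obtain u where u: "F u = u"
      using banach_fix_type[of "1/2" F] by auto
    have "?P (R u) = u + complex_of_real t *\<^sub>C B (R u)"
      using R(2)[of u] by (simp add: perturbed_def algebra_simps)
    also have "\<dots> = y" using u by (simp add: F_def algebra_simps)
    finally show "y \<in> ?P ` D" using R(1) by blast
  qed
qed

lemma perturbed_resolvent:
  assumes "admissible M \<nu> z d" "0 \<le> t" "t \<le> 1"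
  shows "z \<in> op_resolvent_set D (perturbed M \<nu> t)"
  unfolding op_resolvent_set_def
  using perturbed_bij[OF assms] perturbed_bounded_below[OF assms(1) _ assms(2,3)] by blast

end

section \<open>Changes of argument\<close>

text \<open>The zeros in the compact set are finite in number and are divided out one at a time. The
  quotient, completed at the zero by the local cofactor, is holomorphic on all of \<open>S\<close>
  and has one zero fewer in \<open>K\<close>.\<close>

lemma holomorphic_factorization:
  assumes "f holomorphic_on S" "open S" "connected S" "compact K" "K \<subseteq> S" "\<exists>w\<in>S. f w \<noteq> 0"
  shows "\<exists>n g. finite {z\<in>K. f z = 0} \<and> (\<forall>z\<in>K. f z = 0 \<longrightarrow> n z > (0::nat)) \<and> g holomorphic_on S \<and>
    (\<forall>w\<in>K. g w \<noteq> 0) \<and> (\<forall>w\<in>S. f w = (\<Prod>z\<in>{z\<in>K. f z = 0}. (w - z) ^ n z) * g w)"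
proof -
  have fin: "finite {z\<in>K. f z = 0}" if "f holomorphic_on S" "\<exists>w\<in>S. f w \<noteq> 0" for f
  proof (cases "\<exists>z\<in>K. f z = 0")
    case True
    then have "\<not> f constant_on S" using that(2) \<open>K \<subseteq> S\<close> unfolding constant_on_def by (metis subsetD)
    then show ?thesis using holomorphic_compact_finite_zeros assms that by blast
  next
    case False
    then have "{z\<in>K. f z = 0} = {}" by blast
    then show ?thesis by (metis finite.emptyI)
  qed
  show ?thesis
    using assms(1,6)
  proof (induction "card {z\<in>K. f z = 0}" arbitrary: f)
    case 0
    then have *: "{z\<in>K. f z = 0} = {}" using fin[of f] by simp
    show ?case unfolding * using 0 * by (intro exI[of _ "\<lambda>_. 1"] exI[of _ f]) auto
  next
    case (Suc m)
    have finf: "finite {z\<in>K. f z = 0}" using fin Suc by blast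
    obtain z0 where z0: "z0 \<in> K" "f z0 = 0" using Suc(2)
      by (metis (mono_tags, lifting) card.empty empty_Collect_eq nat.distinct(1))
    then have z0S: "z0 \<in> S" using \<open>K \<subseteq> S\<close> by blast
    have nonconst: "\<not> f constant_on S" using Suc(4) z0 z0S unfolding constant_on_def by metis
    obtain h r n where h: "0 < n" "0 < r" "ball z0 r \<subseteq> S" "h holomorphic_on ball z0 r"
      "\<And>w. w \<in> ball z0 r \<Longrightarrow> f w = (w - z0) ^ n * h w" "\<And>w. w \<in> ball z0 r \<Longrightarrow> h w \<noteq> 0"
      by (rule holomorphic_factor_zero_nonconstant[OF Suc(3) assms(2,3) z0S z0(2) nonconst], rule that)
    define f1 where "f1 w = (if w \<in> ball z0 r then h w else f w / (w - z0) ^ n)" for w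
    have "f1 holomorphic_on (ball z0 r \<union> (S - {z0}))"
      unfolding f1_def
    proof (rule holomorphic_on_If_Un)
      show "(\<lambda>w. f w / (w - z0) ^ n) holomorphic_on S - {z0}"
        by (intro holomorphic_intros holomorphic_on_subset[OF Suc(3)]) auto
      show "h z = f z / (z - z0) ^ n" if "z \<in> ball z0 r" "z \<in> S - {z0}" for z
        using h(5)[OF that(1)] that(2) by simp
    qed (use h assms in auto)
    moreover have "ball z0 r \<union> (S - {z0}) = S" using h(2,3) by auto
    ultimately have f1: "f1 holomorphic_on S" by simp
    have ff1: "f w = (w - z0) ^ n * f1 w" if "w \<in> S" for w
      using h(5)[of w] h(2) that by (auto simp: f1_def)
    have f1z0: "f1 z0 \<noteq> 0" using h(2,6) by (simp add: f1_def)
    have zeros: "{z\<in>K. f1 z = 0} = {z\<in>K. f z = 0} - {z0}"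
      using ff1 f1z0 \<open>K \<subseteq> S\<close> by auto
    have ne: "\<exists>w\<in>S. f1 w \<noteq> 0" using f1z0 z0 \<open>K \<subseteq> S\<close> by blast
    have "m = card {z\<in>K. f1 z = 0}" unfolding zeros using Suc(2) z0 finf by simp
    from Suc(1)[OF this f1 ne] obtain n1 g where g: "\<forall>z\<in>K. f1 z = 0 \<longrightarrow> n1 z > (0::nat)"
      "g holomorphic_on S" "\<forall>w\<in>K. g w \<noteq> 0" "\<forall>w\<in>S. f1 w = (\<Prod>z\<in>{z\<in>K. f1 z = 0}. (w - z) ^ n1 z) * g w"
      by blast
    let ?n = "n1(z0 := n)"
    have "f w = (\<Prod>z\<in>{z\<in>K. f z = 0}. (w - z) ^ ?n z) * g w" if "w \<in> S" for w
    proof -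
      have "(\<Prod>z\<in>{z\<in>K. f z = 0}. (w - z) ^ ?n z)
          = (w - z0) ^ ?n z0 * (\<Prod>z\<in>{z\<in>K. f z = 0} - {z0}. (w - z) ^ ?n z)"
        using finf z0 by (intro prod.remove) auto
      also have "(\<Prod>z\<in>{z\<in>K. f z = 0} - {z0}. (w - z) ^ ?n z) = (\<Prod>z\<in>{z\<in>K. f1 z = 0}. (w - z) ^ n1 z)"
        unfolding zeros by (intro prod.cong) auto
      finally show ?thesis using ff1[OF that] g(4) that by (simp add: mult.assoc)
    qed
    moreover have "\<forall>z\<in>K. f z = 0 \<longrightarrow> ?n z > 0"
    proof (intro ballI impI)
      fix z assume "z \<in> K" "f z = 0"
      then have "z \<noteq> z0 \<Longrightarrow> f1 z = 0" using zeros by blast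
      then show "?n z > 0" using g(1) h(1) \<open>z \<in> K\<close> by auto
    qed
    ultimately show ?case using g(2,3) finf by blast
  qed
qed

text \<open>A continuous logarithm along an interval is used instead of a winding number because the
  circle will be cut into arcs, which are not closed.\<close>

definition arg_change :: "(real \<Rightarrow> complex) \<Rightarrow> real \<Rightarrow> real \<Rightarrow> real \<Rightarrow> bool" where
  "arg_change F a b \<delta> \<longleftrightarrow>
     (\<exists>q. continuous_on {a..b} q \<and> (\<forall>u\<in>{a..b}. F u = exp (q u)) \<and> \<delta> = Im (q b) - Im (q a))"

lemma arg_changeI:
  "continuous_on {a..b} q \<Longrightarrow> (\<And>u. u \<in> {a..b} \<Longrightarrow> F u = exp (q u)) \<Longrightarrow> \<delta> = Im (q b) - Im (q a)
    \<Longrightarrow> arg_change F a b \<delta>"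
  unfolding arg_change_def by blast

lemma arg_change_cong:
  "arg_change F a b \<delta> \<Longrightarrow> (\<And>u. u \<in> {a..b} \<Longrightarrow> F u = G u) \<Longrightarrow> arg_change G a b \<delta>"
  unfolding arg_change_def by fastforce

text \<open>The values of \<open>d\<close> are integer multiples of 2 pi i, hence mutually
  separated.\<close>

lemma exp_eq_1_imp_constant:
  fixes d :: "'a::topological_space \<Rightarrow> complex"
  assumes "connected S" "continuous_on S d" "\<And>x. x \<in> S \<Longrightarrow> exp (d x) = 1" "x \<in> S" "y \<in> S"
  shows "d x = d y"
proof -
  have "\<exists>e>0. \<forall>y. y \<in> S \<and> d y \<noteq> d x \<longrightarrow> e \<le> norm (d y - d x)" if "x \<in> S" for x
  proof (intro exI[of _ "2 * pi"] conjI allI impI)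
    fix y assume y: "y \<in> S \<and> d y \<noteq> d x"
    have "exp (d y) = exp (d x)" using assms(3) that y by simp
    then obtain n :: int where n: "d y = d x + of_int (2 * n) * pi * \<i>"
      unfolding exp_eq by blast
    with y have "n \<noteq> 0" by auto
    then have "1 \<le> \<bar>real_of_int n\<bar>" by linarith
    then have "2 * pi * 1 \<le> 2 * pi * \<bar>real_of_int n\<bar>" by (intro mult_left_mono) auto
    also have "\<dots> = norm (d y - d x)" by (simp add: n norm_mult)
    finally show "2 * pi \<le> norm (d y - d x)" by simp
  qed simp
  then have "d constant_on S" by (rule continuous_discrete_range_constant[OF assms(1,2)])
  then show ?thesis using assms(4,5) unfolding constant_on_def by metis
qed

lemma log_increment_unique:
  fixes q q' :: "'a::topological_space \<Rightarrow> complex"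
  assumes "connected S" "continuous_on S q" "continuous_on S q'"
    and "\<And>u. u \<in> S \<Longrightarrow> exp (q u) = exp (q' u)" "x \<in> S" "y \<in> S"
  shows "q y - q x = q' y - q' x"
proof -
  have "exp (q u - q' u) = 1" if "u \<in> S" for u using assms(4)[OF that] by (simp add: exp_diff)
  then have "(\<lambda>u. q u - q' u) x = (\<lambda>u. q u - q' u) y"
    by (intro exp_eq_1_imp_constant[OF assms(1)] continuous_intros assms) auto
  then show ?thesis by (simp add: algebra_simps)
qed

lemma arg_change_unique:
  assumes "a \<le> b" "arg_change F a b \<delta>" "arg_change F a b \<delta>'" shows "\<delta> = \<delta>'"
proof -
  obtain q where q: "continuous_on {a..b} q" "\<And>u. u \<in> {a..b} \<Longrightarrow> F u = exp (q u)" "\<delta> = Im (q b) - Im (q a)"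
    using assms(2) unfolding arg_change_def by blast
  obtain q' where q': "continuous_on {a..b} q'" "\<And>u. u \<in> {a..b} \<Longrightarrow> F u = exp (q' u)" "\<delta>' = Im (q' b) - Im (q' a)"
    using assms(3) unfolding arg_change_def by blast
  have "q b - q a = q' b - q' a"
    using assms(1) q(2) q'(2) by (intro log_increment_unique[OF _ q(1) q'(1)]) auto
  then show ?thesis using q(3) q'(3) by (metis minus_complex.simps(2))
qed

lemma arg_change_exists:
  assumes "continuous_on {a..b} F" "\<And>u. u \<in> {a..b} \<Longrightarrow> F u \<noteq> 0"
  obtains \<delta> where "arg_change F a b \<delta>"
proof -
  have "contractible {a..b}" by (intro convex_imp_contractible convex_real_interval)
  from continuous_logarithm_on_contractible[OF assms(1) this assms(2)]
  obtain q where "continuous_on {a..b} q" "\<And>u. u \<in> {a..b} \<Longrightarrow> F u = exp (q u)" by metis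
  then show thesis using that unfolding arg_change_def by blast
qed

lemma arg_change_mult:
  assumes "arg_change F a b \<delta>" "arg_change G a b \<epsilon>"
  shows "arg_change (\<lambda>u. F u * G u) a b (\<delta> + \<epsilon>)"
proof -
  obtain q where q: "continuous_on {a..b} q" "\<And>u. u \<in> {a..b} \<Longrightarrow> F u = exp (q u)" "\<delta> = Im (q b) - Im (q a)"
    using assms(1) unfolding arg_change_def by blast
  obtain q' where q': "continuous_on {a..b} q'" "\<And>u. u \<in> {a..b} \<Longrightarrow> G u = exp (q' u)" "\<epsilon> = Im (q' b) - Im (q' a)"
    using assms(2) unfolding arg_change_def by blast
  show ?thesis
    by (rule arg_changeI[of _ _ "\<lambda>u. q u + q' u"]) (use q q' in \<open>auto intro: continuous_intros simp: exp_add\<close>)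
qed

lemma arg_change_1: "arg_change (\<lambda>_. 1) a b 0"
  by (rule arg_changeI[of _ _ "\<lambda>_. 0"]) auto

lemma arg_change_inverse:
  assumes "arg_change F a b \<delta>" shows "arg_change (\<lambda>u. inverse (F u)) a b (- \<delta>)"
proof -
  obtain q where "continuous_on {a..b} q" "\<And>u. u \<in> {a..b} \<Longrightarrow> F u = exp (q u)" "\<delta> = Im (q b) - Im (q a)"
    using assms(1) unfolding arg_change_def by blast
  then show ?thesis
    by (intro arg_changeI[of _ _ "\<lambda>u. - q u"]) (auto intro: continuous_intros simp: exp_minus)
qed

lemma arg_change_prod:
  assumes "finite I" "\<And>i. i \<in> I \<Longrightarrow> arg_change (F i) a b (\<delta> i)"
  shows "arg_change (\<lambda>u. \<Prod>i\<in>I. F i u) a b (\<Sum>i\<in>I. \<delta> i)"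
  using assms by (induction I rule: finite_induct) (auto intro: arg_change_1 arg_change_mult)

lemma arg_change_power:
  assumes "arg_change F a b \<delta>" shows "arg_change (\<lambda>u. F u ^ n) a b (real n * \<delta>)"
  using arg_change_prod[of "{..<n}" "\<lambda>_. F" a b "\<lambda>_. \<delta>"] assms by simp

lemma arg_change_split:
  assumes "arg_change F a c \<delta>" "a \<le> b" "b \<le> c"
  obtains \<delta>1 \<delta>2 where "arg_change F a b \<delta>1" "arg_change F b c \<delta>2" "\<delta> = \<delta>1 + \<delta>2"
proof -
  obtain q where q: "continuous_on {a..c} q" "\<And>u. u \<in> {a..c} \<Longrightarrow> F u = exp (q u)" "\<delta> = Im (q c) - Im (q a)"
    using assms(1) unfolding arg_change_def by blast
  show thesis
  proof (rule that)
    show "arg_change F a b (Im (q b) - Im (q a))"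
      by (rule arg_changeI[of _ _ q]) (use q assms in \<open>auto intro: continuous_on_subset\<close>)
    show "arg_change F b c (Im (q c) - Im (q b))"
      by (rule arg_changeI[of _ _ q]) (use q assms in \<open>auto intro: continuous_on_subset\<close>)
  qed (use q in simp)
qed

section \<open>Changes of argument around a circle and under homotopies\<close>

definition circle_point :: "real \<Rightarrow> real \<Rightarrow> complex" where
  "circle_point \<rho> u = of_real \<rho> * cis u"

lemma norm_circle_point: "\<rho> \<ge> 0 \<Longrightarrow> cmod (circle_point \<rho> u) = \<rho>"
  by (simp add: circle_point_def norm_mult)

lemma circle_point_pi: "circle_point \<rho> (- pi) = circle_point \<rho> pi"
  by (simp add: circle_point_def complex_eq_iff)

lemma continuous_circle_point [continuous_intros]: "continuous_on S (circle_point \<rho>)"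
  unfolding circle_point_def[abs_def] cis_conv_exp by (intro continuous_intros)

lemma one_minus_notin_nonpos: "cmod z < 1 \<Longrightarrow> 1 - z \<notin> \<real>\<^sub>\<le>\<^sub>0"
  using complex_Re_le_cmod[of z] by (auto simp: complex_nonpos_Reals_iff)

text \<open>The difference is the circle point itself, of argument \<open>u\<close>, times
  \<open>1 - z / circle_point \<rho> u\<close>, which stays in the right half plane and returns to
  its initial value.\<close>

lemma arg_change_linear_inside:
  assumes "cmod z < \<rho>"
  shows "arg_change (\<lambda>u. circle_point \<rho> u - z) (- pi) pi (2 * pi)"
proof -
  have \<rho>: "\<rho> > 0" using assms norm_ge_zero[of z] by linarith
  then have nz: "circle_point \<rho> u \<noteq> 0" for u by (simp add: circle_point_def)
  have small: "cmod (z / circle_point \<rho> u) < 1" for u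
    using assms \<rho> by (simp add: norm_divide norm_circle_point)
  show ?thesis
  proof (rule arg_changeI[of _ _ "\<lambda>u. \<i> * of_real u + of_real (ln \<rho>) + Ln (1 - z / circle_point \<rho> u)"])
    show "continuous_on {- pi..pi} (\<lambda>u. \<i> * of_real u + of_real (ln \<rho>) + Ln (1 - z / circle_point \<rho> u))"
      by (intro continuous_intros one_minus_notin_nonpos small) (use nz in auto)
    fix u
    have "1 - z / circle_point \<rho> u \<noteq> 0" using small[of u] by auto
    then show "circle_point \<rho> u - z = exp (\<i> * of_real u + of_real (ln \<rho>) + Ln (1 - z / circle_point \<rho> u))"
      using nz[of u] \<rho>
      by (simp add: exp_add exp_of_real circle_point_def cis_conv_exp field_simps)
  qed (simp add: circle_point_pi)
qed

lemma arg_change_linear_outside: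
  assumes "\<rho> < cmod z" "\<rho> > 0"
  shows "arg_change (\<lambda>u. circle_point \<rho> u - z) (- pi) pi 0"
proof -
  have nz: "z \<noteq> 0" using assms by auto
  have small: "cmod (circle_point \<rho> u / z) < 1" for u
    using assms by (simp add: norm_divide norm_circle_point divide_less_eq)
  show ?thesis
  proof (rule arg_changeI[of _ _ "\<lambda>u. Ln (- z) + Ln (1 - circle_point \<rho> u / z)"])
    show "continuous_on {- pi..pi} (\<lambda>u. Ln (- z) + Ln (1 - circle_point \<rho> u / z))"
      by (intro continuous_intros one_minus_notin_nonpos small) (use nz in auto)
    fix u
    have "1 - circle_point \<rho> u / z \<noteq> 0" using small[of u] by auto
    then show "circle_point \<rho> u - z = exp (Ln (- z) + Ln (1 - circle_point \<rho> u / z))"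
      using nz by (simp add: exp_add field_simps)
  qed (simp add: circle_point_pi)
qed

lemma arg_change_zero_free:
  assumes "continuous_on (cball 0 \<rho>) g" "\<And>w. w \<in> cball 0 \<rho> \<Longrightarrow> g w \<noteq> 0" "\<rho> > 0"
  shows "arg_change (\<lambda>u. g (circle_point \<rho> u)) (- pi) pi 0"
proof -
  obtain h where h: "continuous_on (cball 0 \<rho>) h" "\<And>z. z \<in> cball 0 \<rho> \<Longrightarrow> g z = exp (h z)"
    using continuous_logarithm_on_cball[OF assms(1,2)] by metis
  have in_ball: "circle_point \<rho> u \<in> cball 0 \<rho>" for u
    using assms(3) by (simp add: norm_circle_point)
  show ?thesis
  proof (rule arg_changeI[of _ _ "\<lambda>u. h (circle_point \<rho> u)"])
    show "continuous_on {- pi..pi} (\<lambda>u. h (circle_point \<rho> u))"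
      by (rule continuous_on_compose2[OF h(1) continuous_circle_point]) (use in_ball in auto)
  qed (use h(2)[OF in_ball] in \<open>auto simp: circle_point_pi\<close>)
qed

text \<open>The rectangle is contractible, so a single logarithm exists on it. Along the sides
  \<open>u = a\<close> and \<open>u = b\<close> it is a logarithm of the same function of
  \<open>s\<close>, so its increments there agree.\<close>

lemma arg_change_homotopy:
  fixes H :: "real \<Rightarrow> real \<Rightarrow> complex"
  assumes "continuous_on ({0..1} \<times> {a..b}) (\<lambda>x. H (fst x) (snd x))" "a \<le> b"
    and "\<And>s u. s \<in> {0..1} \<Longrightarrow> u \<in> {a..b} \<Longrightarrow> H s u \<noteq> 0" "\<And>s. s \<in> {0..1} \<Longrightarrow> H s a = H s b"
    and "arg_change (H 0) a b \<delta>" "arg_change (H 1) a b \<delta>'"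
  shows "\<delta> = \<delta>'"
proof -
  have contr: "contractible ({0..1} \<times> {a..b} :: (real \<times> real) set)"
    by (intro convex_imp_contractible convex_Times convex_real_interval)
  have nz: "\<And>x. x \<in> {0..1} \<times> {a..b} \<Longrightarrow> H (fst x) (snd x) \<noteq> 0" using assms(3) by auto
  obtain g where g: "continuous_on ({0..1} \<times> {a..b}) g"
    "\<And>x. x \<in> {0..1} \<times> {a..b} \<Longrightarrow> H (fst x) (snd x) = exp (g x)"
    using continuous_logarithm_on_contractible[OF assms(1) contr nz] by blast
  have cs: "continuous_on {0..1} (\<lambda>s. g (s, u))" if "u \<in> {a..b}" for u
    by (rule continuous_on_compose2[OF g(1)]) (use that in \<open>auto intro!: continuous_intros\<close>)
  have cu: "continuous_on {a..b} (\<lambda>u. g (s, u))" if "s \<in> {0..1}" for s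
    by (rule continuous_on_compose2[OF g(1)]) (use that in \<open>auto intro!: continuous_intros\<close>)
  have "g (1, b) - g (0, b) = g (1, a) - g (0, a)"
    by (rule log_increment_unique[OF _ cs cs]) (use assms(2,4) g(2) in force)+
  moreover have "arg_change (H s) a b (Im (g (s, b)) - Im (g (s, a)))" if "s \<in> {0..1}" for s
    by (rule arg_changeI[OF cu[OF that]]) (use g(2) that in force)+
  then have "\<delta> = Im (g (0, b)) - Im (g (0, a))" "\<delta>' = Im (g (1, b)) - Im (g (1, a))"
    using arg_change_unique[OF assms(2)] assms(5,6) by force+
  ultimately show ?thesis by (simp add: complex_eq_iff)
qed

text \<open>The linear factors \<open>1 + s * x\<close> stay off the negative axis, so their principal arguments
  continue the argument of \<open>H\<close> from \<open>s = 0\<close>, where \<open>H = 1\<close>, to \<open>s = 1\<close>.\<close>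

lemma arg_change_product_bound:
  fixes H :: "real \<Rightarrow> real \<Rightarrow> complex"
  assumes cont: "continuous_on ({0..1} \<times> {a..b}) (\<lambda>x. H (fst x) (snd x))" and ab: "a \<le> b"
    and nz: "\<And>s u. s \<in> {0..1} \<Longrightarrow> u \<in> {a..b} \<Longrightarrow> H s u \<noteq> 0"
    and H: "\<And>s u. s \<in> {0..1} \<Longrightarrow> u \<in> {a..b} \<Longrightarrow> H s u = (\<Prod>x\<leftarrow>as u. 1 + complex_of_real s * x)"
    and len: "\<And>u. u \<in> {a..b} \<Longrightarrow> length (as u) = N"
    and \<delta>: "arg_change (H 1) a b \<delta>"
  shows "\<bar>\<delta>\<bar> \<le> 2 * pi * N"
proof -
  have contr: "contractible ({0..1} \<times> {a..b} :: (real \<times> real) set)"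
    by (intro convex_imp_contractible convex_Times convex_real_interval)
  have nz': "\<And>x. x \<in> {0..1} \<times> {a..b} \<Longrightarrow> H (fst x) (snd x) \<noteq> 0" using nz by auto
  obtain g where g: "continuous_on ({0..1} \<times> {a..b}) g"
    "\<And>x. x \<in> {0..1} \<times> {a..b} \<Longrightarrow> H (fst x) (snd x) = exp (g x)"
    using continuous_logarithm_on_contractible[OF cont contr nz'] by blast
  have cs: "continuous_on {0..1} (\<lambda>s. g (s, u))" if "u \<in> {a..b}" for u
    by (rule continuous_on_compose2[OF g(1)]) (use that in \<open>auto intro!: continuous_intros\<close>)
  have cu: "continuous_on {a..b} (\<lambda>u. g (s, u))" if "s \<in> {0..1}" for s
    by (rule continuous_on_compose2[OF g(1)]) (use that in \<open>auto intro!: continuous_intros\<close>)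
  \<comment> \<open>Only the direction \<open>s\<close> is used, at fixed \<open>u\<close>; the
    lists \<open>as u\<close> may depend discontinuously on \<open>u\<close>.\<close>
  have bound: "\<bar>Im (g (1, u)) - Im (g (0, u))\<bar> \<le> pi * N" if u: "u \<in> {a..b}" for u
  proof -
    have notin: "1 + complex_of_real s * x \<notin> \<real>\<^sub>\<le>\<^sub>0" if s: "s \<in> {0..1}" and x: "x \<in> set (as u)" for s x
    proof
      assume "1 + complex_of_real s * x \<in> \<real>\<^sub>\<le>\<^sub>0"
      then have *: "1 + s * Re x \<le> 0" "s * Im x = 0" by (auto simp: complex_nonpos_Reals_iff)
      then have "s \<noteq> 0" by auto
      then have s0: "s > 0" and im: "Im x = 0" using s * by auto
      have re: "Re x \<le> - 1"
      proof -
        have "Re x < 0" using * s0 mult_nonneg_nonneg[of s "Re x"] by (cases "Re x \<ge> 0") linarith+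
        then have "s * Re x \<ge> Re x" using s mult_right_mono_neg[of s 1 "Re x"] by simp
        then show ?thesis using * by linarith
      qed
      \<comment> \<open>The parameter at which the factor of a real \<open>x \<le> - 1\<close>
        vanishes; it lies in the unit interval, where \<open>H\<close> has no zero.\<close>
      define t where "t = - 1 / Re x"
      have t: "t \<in> {0..1}" using re by (auto simp: t_def field_simps)
      have "1 + complex_of_real t * x = 0" using re im by (simp add: t_def complex_eq_iff)
      then have "H t u = 0" unfolding H[OF t u] prod_list_zero_iff using x by force
      then show False using nz[OF t u] by simp
    qed
    define p where "p s = (\<Sum>x\<leftarrow>as u. Ln (1 + complex_of_real s * x))" for s
    have p: "continuous_on {0..1} p \<and> (\<forall>s\<in>{0..1}. exp (p s) = H s u)"
    proof -
      have "continuous_on {0..1} (\<lambda>s. \<Sum>x\<leftarrow>xs. Ln (1 + complex_of_real s * x)) \<and>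
          (\<forall>s\<in>{0..1}. exp (\<Sum>x\<leftarrow>xs. Ln (1 + complex_of_real s * x)) = (\<Prod>x\<leftarrow>xs. 1 + complex_of_real s * x))"
        if "set xs \<subseteq> set (as u)" for xs
        using that
      proof (induction xs)
        case (Cons y xs)
        have y: "1 + complex_of_real s * y \<notin> \<real>\<^sub>\<le>\<^sub>0" if "s \<in> {0..1}" for s
          using notin[OF that, of y] Cons(2) by simp
        then have y0: "1 + complex_of_real s * y \<noteq> 0" if "s \<in> {0..1}" for s
          using that by (metis nonpos_Reals_zero_I)
        show ?case using Cons y y0
          by (auto intro!: continuous_intros simp: exp_add)
      qed auto
      then show ?thesis unfolding p_def using H u by force
    qed
    have "g (1, u) - g (0, u) = p 1 - p 0"
      using p g(2) u by (intro log_increment_unique[OF _ cs[OF u]]) force+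
    moreover have "p 0 = 0" unfolding p_def by (induction "as u") auto
    moreover have "\<bar>Im (p 1)\<bar> \<le> pi * N"
    proof -
      have "\<bar>Im (\<Sum>x\<leftarrow>xs. Ln (1 + complex_of_real 1 * x))\<bar> \<le> pi * length xs"
        if "set xs \<subseteq> set (as u)" for xs
        using that
      proof (induction xs)
        case (Cons y xs)
        have "1 + y \<notin> \<real>\<^sub>\<le>\<^sub>0" using notin[of 1 y] Cons(2) by simp
        then have "1 + y \<noteq> 0" by (metis nonpos_Reals_zero_I)
        then have "\<bar>Im (Ln (1 + y))\<bar> \<le> pi"
          using Im_Ln_le_pi[of "1 + y"] mpi_less_Im_Ln[of "1 + y"] by linarith
        then show ?case using Cons by (simp add: algebra_simps)
      qed simp
      from this[of "as u"] show ?thesis unfolding p_def using len[OF u] by simp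
    qed
    ultimately show ?thesis by (simp add: complex_eq_iff)
  qed
  have "g (0, a) = g (0, b)"
  proof (rule exp_eq_1_imp_constant[OF _ cu])
    fix u assume u: "u \<in> {a..b}"
    have "H 0 u = 1" using H[OF _ u, of 0] by (simp add: map_replicate_const)
    then show "exp (g (0, u)) = 1" using g(2)[of "(0, u)"] u by simp
  qed (use ab in auto)
  moreover have "arg_change (H 1) a b (Im (g (1, b)) - Im (g (1, a)))"
    by (rule arg_changeI[OF cu[of 1]]) (use g(2) in force)+
  then have "\<delta> = Im (g (1, b)) - Im (g (1, a))" using arg_change_unique[OF ab \<delta>] by blast
  ultimately show ?thesis using bound[of a] bound[of b] ab by (simp add: abs_le_iff)
qed

text \<open>A strictly increasing imaginary part vanishes at most once. A change of argument above
  \<open>2 * pi\<close> would pass two consecutive multiples of \<open>pi\<close>, at each of which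
  the imaginary part is zero.\<close>

lemma arg_change_monotone_Im:
  assumes ab: "a \<le> b" and \<delta>: "arg_change F a b \<delta>"
    and mono: "\<And>u v. u \<in> {a..b} \<Longrightarrow> v \<in> {a..b} \<Longrightarrow> u < v \<Longrightarrow> Im (F u) < Im (F v)"
  shows "\<bar>\<delta>\<bar> \<le> 2 * pi"
proof (rule ccontr)
  assume big: "\<not> \<bar>\<delta>\<bar> \<le> 2 * pi"
  obtain q where q: "continuous_on {a..b} q" "\<And>u. u \<in> {a..b} \<Longrightarrow> F u = exp (q u)" "\<delta> = Im (q b) - Im (q a)"
    using \<delta> unfolding arg_change_def by blast
  define m where "m = min (Im (q a)) (Im (q b))"
  \<comment> \<open>The first multiple of \<open>pi\<close> above \<open>m\<close>; it and the next
    one lie within \<open>2 * pi\<close> of \<open>m\<close>.\<close>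
  define k where "k = \<lfloor>m / pi\<rfloor> + 1"
  have k: "m \<le> k * pi" "(k + 1) * pi \<le> m + 2 * pi"
  proof -
    have "m / pi \<le> k" "k \<le> m / pi + 1" unfolding k_def by linarith+
    then show "m \<le> k * pi" "(k + 1) * pi \<le> m + 2 * pi"
      using pi_gt_zero by (simp_all add: field_simps)
  qed
  have "connected ((\<lambda>u. Im (q u)) ` {a..b})"
    by (intro connected_continuous_image continuous_intros q) auto
  moreover have "m \<in> (\<lambda>u. Im (q u)) ` {a..b}" "m + \<bar>\<delta>\<bar> \<in> (\<lambda>u. Im (q u)) ` {a..b}"
    using ab q(3) by (auto simp: m_def min_def abs_if image_iff)
  ultimately have icc: "{m..m + \<bar>\<delta>\<bar>} \<subseteq> (\<lambda>u. Im (q u)) ` {a..b}"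
    by (rule connected_contains_Icc)
  have "k * pi \<in> {m..m + \<bar>\<delta>\<bar>}" "(k + 1) * pi \<in> {m..m + \<bar>\<delta>\<bar>}"
    using k big pi_gt_zero by (auto simp: algebra_simps)
  then have "k * pi \<in> (\<lambda>u. Im (q u)) ` {a..b}" "(k + 1) * pi \<in> (\<lambda>u. Im (q u)) ` {a..b}"
    using icc by blast+
  then obtain u v where uv: "u \<in> {a..b}" "Im (q u) = k * pi" "v \<in> {a..b}" "Im (q v) = (k + 1) * pi"
    by (elim imageE) simp
  have "Im (F u) = 0" "Im (F v) = 0"
    using uv q(2) sin_times_pi_eq_0[of "of_int k"] sin_times_pi_eq_0[of "of_int (k + 1)"]
    by (simp_all add: Im_exp)
  moreover have "u \<noteq> v" using uv pi_gt_zero by (auto simp: algebra_simps)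
  ultimately show False using mono[OF uv(1,3)] mono[OF uv(3,1)] by fastforce
qed

text \<open>The map sending \<psi> to \<psi> / (2A - \<psi>) takes the half plane Re < A into the
  unit disc and fixes 0, so Schwarz's lemma applies. At half the radius it yields |\<psi>| \<le> (2A
  + |\<psi>|) / 2, that is, |\<psi>| \<le> 2A.\<close>

lemma borel_caratheodory:
  assumes holo: "l holomorphic_on ball p \<rho>" and \<rho>: "\<rho> > 0" and A: "A > 0"
    and Re: "\<And>w. w \<in> ball p \<rho> \<Longrightarrow> Re (l w - l p) < A" and w: "w \<in> ball p (\<rho> / 2)"
  shows "cmod (l w - l p) \<le> 2 * A"
proof -
  define \<psi> where "\<psi> \<xi> = l (p + complex_of_real \<rho> * \<xi>) - l p" for \<xi> :: complex
  have in_ball: "p + \<rho> * \<xi> \<in> ball p \<rho>" if "cmod \<xi> < 1" for \<xi> :: complex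
    using that \<rho> by (simp add: dist_norm norm_mult)
  have \<psi>A: "Re (\<psi> \<xi>) < A" if "cmod \<xi> < 1" for \<xi> using Re[OF in_ball[OF that]] by (simp add: \<psi>_def)
  have lt: "cmod (\<psi> \<xi>) < cmod (2 * A - \<psi> \<xi>)" if "cmod \<xi> < 1" for \<xi>
  proof -
    have "(cmod (2 * A - \<psi> \<xi>))\<^sup>2 - (cmod (\<psi> \<xi>))\<^sup>2 = 4 * A * (A - Re (\<psi> \<xi>))"
      unfolding cmod_power2 by (simp add: power2_eq_square algebra_simps)
    also have "\<dots> > 0" using A \<psi>A[OF that] by simp
    finally show ?thesis by (simp add: power2_less_imp_less)
  qed
  have nz: "2 * A - \<psi> \<xi> \<noteq> 0" if "cmod \<xi> < 1" for \<xi>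
    using lt[OF that] by auto
  have \<psi>h: "\<psi> holomorphic_on ball 0 1"
    unfolding \<psi>_def
  proof (intro holomorphic_intros)
    have "(\<lambda>\<xi>. p + complex_of_real \<rho> * \<xi>) ` ball 0 1 \<subseteq> ball p \<rho>" using in_ball by auto
    moreover have "(\<lambda>\<xi>. p + complex_of_real \<rho> * \<xi>) holomorphic_on ball 0 1" by (intro holomorphic_intros)
    ultimately show "(\<lambda>\<xi>. l (p + \<rho> * \<xi>)) holomorphic_on ball 0 1"
      using holomorphic_on_compose_gen[OF _ holo] by (auto simp: o_def)
  qed
  define \<xi> where "\<xi> = (w - p) / \<rho>"
  have \<xi>: "cmod \<xi> < 1/2" "p + \<rho> * \<xi> = w"
    using w \<rho> by (auto simp: \<xi>_def norm_divide dist_norm norm_minus_commute field_simps)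
  have "cmod (\<psi> \<xi> / (2 * A - \<psi> \<xi>)) \<le> cmod \<xi>"
  proof (rule Schwarz_Lemma(1)[where f = "\<lambda>\<xi>. \<psi> \<xi> / (2 * A - \<psi> \<xi>)"])
    show "(\<lambda>\<xi>. \<psi> \<xi> / (2 * A - \<psi> \<xi>)) holomorphic_on ball 0 1"
      by (intro holomorphic_intros \<psi>h) (use nz in auto)
    show "cmod (\<psi> z / (2 * A - \<psi> z)) < 1" if "cmod z < 1" for z
      using lt[OF that] nz[OF that] by (simp add: norm_divide)
  qed (use \<xi> in \<open>auto simp: \<psi>_def\<close>)
  then have "cmod (\<psi> \<xi> / (2 * A - \<psi> \<xi>)) \<le> 1/2" using \<xi> by simp
  moreover have "cmod (2 * A - \<psi> \<xi>) > 0" using nz[of \<xi>] \<xi> by simp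
  ultimately have "cmod (\<psi> \<xi>) \<le> 1/2 * cmod (2 * A - \<psi> \<xi>)"
    by (simp add: norm_divide field_simps)
  also have "cmod (2 * A - \<psi> \<xi>) \<le> 2 * A + cmod (\<psi> \<xi>)"
    using norm_triangle_ineq4[of "complex_of_real (2 * A)" "\<psi> \<xi>"] A by simp
  finally show ?thesis using \<xi>(2) by (simp add: \<psi>_def)
qed

text \<open>A Jensen type argument. The zeros in the disc of radius \<open>R/4\<close> form a
  polynomial \<open>P\<close> of degree \<open>m\<close>, which is at least \<open>(R/2) ^ m\<close>
  on the circle of radius \<open>3 * R / 4\<close> but at most \<open>(R/4) ^ m\<close> at
  \<open>p\<close>; by the maximum principle for the quotient \<open>g\<close> the discrepancy
  \<open>2 ^ m\<close> is at most \<open>exp (2 * L)\<close>. Being zero-free near \<open>p\<close>,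
  \<open>g\<close> has a logarithm with real part bounded above, and Borel-Caratheodory bounds it on
  half the radius.\<close>

lemma zero_count_and_log_bound:
  assumes holo: "h holomorphic_on ball p R" and R: "R > 0" and L: "L > 0"
    and upper: "\<And>w. w \<in> ball p R \<Longrightarrow> cmod (h w) \<le> exp L" and lower: "exp (- L) \<le> cmod (h p)"
  obtains Z n l where "finite Z" "real (\<Sum>z\<in>Z. n z) \<le> 4 * L" "continuous_on (ball p (R/8)) l"
    "\<And>w. w \<in> ball p (R/8) \<Longrightarrow> h w = (\<Prod>z\<in>Z. (w - z) ^ n z) * exp (l w)"
    "\<And>w. w \<in> ball p (R/8) \<Longrightarrow> cmod (l w - l p) \<le> 6 * L"
proof -
  define Z where "Z = {z \<in> cball p (R/4). h z = 0}"
  have sub: "cball p (R/4) \<subseteq> ball p R" using R by auto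
  have hp: "h p \<noteq> 0" using lower by (metis exp_gt_zero norm_zero not_le)
  obtain n g where fin: "finite Z" and g: "g holomorphic_on ball p R"
    "\<And>w. w \<in> cball p (R/4) \<Longrightarrow> g w \<noteq> 0" "\<And>w. w \<in> ball p R \<Longrightarrow> h w = (\<Prod>z\<in>Z. (w - z) ^ n z) * g w"
  proof -
    have "\<exists>w\<in>ball p R. h w \<noteq> 0" using hp R by (intro bexI[of _ p]) auto
    from holomorphic_factorization[OF holo open_ball connected_ball compact_cball sub this]
    show ?thesis using that unfolding Z_def[symmetric] by blast
  qed
  define P where "P w = (\<Prod>z\<in>Z. (w - z) ^ n z)" for w
  define m where "m = (\<Sum>z\<in>Z. n z)"
  have P_lower: "(R/2) ^ m \<le> cmod (P w)" if "cmod (w - p) = 3 * R / 4" for w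
  proof -
    have "(R/2) ^ m = (\<Prod>z\<in>Z. (R/2) ^ n z)" by (simp add: m_def power_sum)
    also have "\<dots> \<le> (\<Prod>z\<in>Z. cmod (w - z) ^ n z)"
    proof (intro prod_mono conjI power_mono)
      fix z assume "z \<in> Z"
      then have "cmod (p - z) \<le> R/4" by (simp add: Z_def dist_norm)
      then show "R/2 \<le> cmod (w - z)" using that norm_triangle_ineq2[of "w - p" "z - p"]
        by (simp add: norm_minus_commute)
    qed (use R in auto)
    finally show ?thesis by (simp add: P_def norm_power flip: prod_norm)
  qed
  have P_upper: "cmod (P p) \<le> (R/4) ^ m"
  proof -
    have "(\<Prod>z\<in>Z. cmod (p - z) ^ n z) \<le> (\<Prod>z\<in>Z. (R/4) ^ n z)"
      by (intro prod_mono conjI power_mono) (auto simp: Z_def dist_norm)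
    then show ?thesis by (simp add: P_def norm_power m_def power_sum flip: prod_norm)
  qed
  have g_upper: "cmod (g w) \<le> exp L / (R/2) ^ m" if "w \<in> cball p (3 * R / 4)" for w
  proof (rule maximum_modulus_frontier[of g "cball p (3 * R / 4)"])
    show "g holomorphic_on interior (cball p (3 * R / 4))" "continuous_on (closure (cball p (3 * R / 4))) g"
      using R by (auto intro!: holomorphic_on_imp_continuous_on intro: holomorphic_on_subset[OF g(1)])
    fix z assume "z \<in> frontier (cball p (3 * R / 4))"
    then have z: "cmod (z - p) = 3 * R / 4"
      using R by (simp add: dist_norm norm_minus_commute)
    then have "z \<in> ball p R" using R by (simp add: dist_norm norm_minus_commute)
    then have "cmod (P z) * cmod (g z) \<le> exp L"
      using upper g(3) by (metis P_def norm_mult)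
    moreover have "(R/2) ^ m * cmod (g z) \<le> cmod (P z) * cmod (g z)"
      using P_lower[OF z] by (intro mult_right_mono) auto
    ultimately have "cmod (g z) * (R/2) ^ m \<le> exp L" by (simp only: mult.commute[of "cmod (g z)"])
    then show "cmod (g z) \<le> exp L / (R/2) ^ m" using R by (subst pos_le_divide_eq) auto
  qed (use that in auto)
  have g_lower: "exp (- L) \<le> (R/4) ^ m * cmod (g p)"
  proof -
    have "exp (- L) \<le> cmod (P p) * cmod (g p)"
      using lower g(3)[of p] R by (simp add: P_def norm_mult)
    also have "\<dots> \<le> (R/4) ^ m * cmod (g p)" using P_upper by (intro mult_right_mono) auto
    finally show ?thesis .
  qed
  have ratio: "2 ^ m * cmod (g w) \<le> exp (2 * L) * cmod (g p)" if "w \<in> cball p (3 * R / 4)" for w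
  proof -
    have "(R/2) ^ m = 2 ^ m * (R/4) ^ m" by (simp flip: power_mult_distrib)
    then have "2 ^ m * cmod (g w) * (R/4) ^ m = cmod (g w) * (R/2) ^ m" by simp
    also have "\<dots> \<le> exp L" using g_upper[OF that] R by (subst (asm) pos_le_divide_eq) auto
    also have "\<dots> = exp (2 * L) * exp (- L)" by (simp flip: exp_add)
    also have "\<dots> \<le> exp (2 * L) * ((R/4) ^ m * cmod (g p))" using g_lower by (intro mult_left_mono) auto
    finally have "(2 ^ m * cmod (g w)) * (R/4) ^ m \<le> (exp (2 * L) * cmod (g p)) * (R/4) ^ m"
      by (simp add: mult_ac)
    then show ?thesis using R by (simp add: mult_le_cancel_right)
  qed
  have gp: "cmod (g p) > 0" using g(2)[of p] R by simp
  have "real m \<le> 4 * L"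
  proof -
    have "exp (real m / 2) = exp (1/2) ^ m" by (simp flip: exp_of_nat_mult)
    also have "\<dots> \<le> 2 ^ m" by (intro power_mono exp_half_le2) auto
    also have "\<dots> \<le> exp (2 * L)" using ratio[of p] gp R by simp
    finally show ?thesis by simp
  qed
  have gh: "g holomorphic_on ball p (R/4)" using R by (intro holomorphic_on_subset[OF g(1)]) auto
  have gnz: "\<And>w. w \<in> ball p (R/4) \<Longrightarrow> g w \<noteq> 0" using g(2) by auto
  have pR: "p \<in> ball p (R/4)" using R by simp
  obtain l where l: "l holomorphic_on ball p (R/4)" "\<And>w. w \<in> ball p (R/4) \<Longrightarrow> exp (l w) = g w"
    using holomorphic_logarithm_exists[OF convex_ball open_ball gh gnz pR] by blast
  \<comment> \<open>The estimate gives \<open>2 * L\<close>; the larger constant turns it into the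
    strict inequality that the next step asks for, and doubling it produces
    \<open>6 * L\<close>.\<close>
  have "Re (l w - l p) < 3 * L" if w: "w \<in> ball p (R/4)" for w
  proof -
    have "exp (Re (l w - l p)) = cmod (exp (l w)) / cmod (exp (l p))" by (simp add: exp_diff)
    also have "\<dots> = cmod (g w) / cmod (g p)" using l(2)[OF w] l(2)[of p] R by simp
    also have "\<dots> \<le> exp (2 * L)"
    proof -
      have "1 * cmod (g w) \<le> 2 ^ m * cmod (g w)" by (intro mult_right_mono) auto
      then show ?thesis using ratio[of w] w gp R by (simp add: divide_le_eq)
    qed
    finally show ?thesis using L by simp
  qed
  then have "cmod (l w - l p) \<le> 6 * L" if "w \<in> ball p (R/8)" for w
    using borel_caratheodory[OF l(1), of "3 * L" w] that R L by simp
  moreover have "h w = (\<Prod>z\<in>Z. (w - z) ^ n z) * exp (l w)" if "w \<in> ball p (R/8)" for w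
    using g(3)[of w] l(2)[of w] that R by simp
  moreover have "continuous_on (ball p (R/8)) l"
    using R by (intro holomorphic_on_imp_continuous_on holomorphic_on_subset[OF l(1)]) auto
  ultimately show thesis using that fin \<open>real m \<le> 4 * L\<close> unfolding m_def by blast
qed

section \<open>Sums over non-condensing sequences\<close>

text \<open>Terms are grouped by the interval from \<open>n\<close> to \<open>n + 1\<close>
  containing \<open>t k\<close>. As \<open>t k > 1\<close>, only \<open>n \<ge> 1\<close> occurs,
  which matters because the counting hypothesis speaks of positive left ends.\<close>

lemma sum_unit_intervals_le:
  fixes t F :: "nat \<Rightarrow> real"
  assumes t: "\<And>k. t k > 1"
    and card: "\<And>s. s > 0 \<Longrightarrow> finite {k. t k \<in> {s<..s + 1}} \<and> card {k. t k \<in> {s<..s + 1}} \<le> l"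
    and c: "\<And>n. c n \<ge> 0" "\<And>m. (\<Sum>n<m. c n) \<le> C"
    and F: "\<And>k n. k \<in> K \<Longrightarrow> real n < t k \<Longrightarrow> t k \<le> real n + 1 \<Longrightarrow> F k \<le> c n"
    and K: "finite K"
  shows "(\<Sum>k\<in>K. F k) \<le> real l * C"
proof -
  \<comment> \<open>Ceiling minus one rather than floor, because the intervals are open on the
    left.\<close>
  define idx where "idx k = nat (\<lceil>t k\<rceil> - 1)" for k
  have idx: "real (idx k) < t k" "t k \<le> real (idx k) + 1" "idx k \<ge> 1" for k
    using t[of k] unfolding idx_def by linarith+
  have "(\<Sum>k\<in>K. F k) \<le> (\<Sum>k\<in>K. c (idx k))"
    by (intro sum_mono F idx)
  also have "\<dots> = (\<Sum>n\<in>idx ` K. \<Sum>k\<in>{k\<in>K. idx k = n}. c (idx k))"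
    by (rule sum.image_gen[OF K])
  also have "\<dots> \<le> (\<Sum>n\<in>idx ` K. real l * c n)"
  proof (intro sum_mono)
    fix n assume "n \<in> idx ` K"
    then have n: "n \<ge> 1" using idx by auto
    have "{k\<in>K. idx k = n} \<subseteq> {k. t k \<in> {real n<..real n + 1}}" using idx by auto
    moreover have "finite {k. t k \<in> {real n<..real n + 1}}" "card {k. t k \<in> {real n<..real n + 1}} \<le> l"
      using card[of "real n"] n by simp_all
    ultimately have "card {k\<in>K. idx k = n} \<le> l" using card_mono order.trans by blast
    then have "real (card {k\<in>K. idx k = n}) * c n \<le> real l * c n"
      by (intro mult_right_mono c) simp
    then show "(\<Sum>k\<in>{k\<in>K. idx k = n}. c (idx k)) \<le> real l * c n" by simp
  qed
  also have "\<dots> = real l * (\<Sum>n\<in>idx ` K. c n)" by (simp add: sum_distrib_left)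
  also have "\<dots> \<le> real l * C"
  proof (intro mult_left_mono)
    have "idx ` K \<subseteq> {..<Suc (Max (idx ` K))}"
      using K by (auto simp: less_Suc_eq_le)
    then have "(\<Sum>n\<in>idx ` K. c n) \<le> (\<Sum>n<Suc (Max (idx ` K)). c n)"
      by (intro sum_mono2 c) auto
    then show "(\<Sum>n\<in>idx ` K. c n) \<le> C" using c(2) order_trans by blast
  qed simp
  finally show ?thesis .
qed

text \<open>Telescoping with \<open>1 / (j + G)\<close>. The terms for \<open>j = 0\<close> and
  \<open>j = 1\<close> both equal \<open>1 / G\<^sup>2\<close> and are kept apart.\<close>

lemma sum_inverse_square_le:
  fixes G :: real assumes G: "G > 0"
  shows "(\<Sum>j<m. 1 / (max 0 (real j - 1) + G)\<^sup>2) \<le> 2 / G\<^sup>2 + 1 / G"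
proof -
  let ?d = "\<lambda>j. 1 / (max 0 (real j - 1) + G)\<^sup>2"
  have *: "(\<Sum>j<Suc (Suc m). ?d j) \<le> 2 / G\<^sup>2 + 1 / G - 1 / (real m + G)" for m
  proof (induction m)
    case 0
    then show ?case by simp
  next
    case (Suc m)
    have "?d (Suc (Suc m)) = 1 / (real m + 1 + G)\<^sup>2" by (simp add: max_def add_ac)
    also have "\<dots> \<le> 1 / ((real m + G) * (real m + 1 + G))"
      using G by (intro divide_left_mono) (auto simp: power2_eq_square intro!: mult_right_mono mult_pos_pos)
    also have "\<dots> = 1 / (real m + G) - 1 / (real (Suc m) + G)"
      using G by (simp add: field_simps)
    finally show ?case using Suc by simp
  qed
  have "(\<Sum>j<m. ?d j) \<le> (\<Sum>j<Suc (Suc m). ?d j)" by (intro sum_mono2) auto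
  moreover have "1 / (real m + G) \<ge> 0" using G by simp
  ultimately show ?thesis using *[of m] by linarith
qed

text \<open>The expression with \<open>max\<close> is the distance from \<open>\<tau>\<close> to the
  interval from \<open>n\<close> to \<open>n + 1\<close>. The distance of \<open>n\<close> to the
  floor of \<open>\<tau>\<close> is injective on either side of that floor, so each side is bounded
  by a sum of the preceding kind.\<close>

lemma sum_inverse_square_centered_le:
  fixes G \<tau> :: real assumes G: "G > 0"
  shows "(\<Sum>n<m. 1 / (max 0 (max (real n - \<tau>) (\<tau> - real n - 1)) + G)\<^sup>2) \<le> 4 / G\<^sup>2 + 2 / G"
proof -
  let ?c = "\<lambda>n. 1 / (max 0 (max (real n - \<tau>) (\<tau> - real n - 1)) + G)\<^sup>2"
  let ?d = "\<lambda>j. 1 / (max 0 (real j - 1) + G)\<^sup>2"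
  define j0 where "j0 = \<lfloor>\<tau>\<rfloor>"
  define dist0 where "dist0 n = nat \<bar>int n - j0\<bar>" for n
  have cd: "?c n \<le> ?d (dist0 n)" for n
  proof -
    have "max 0 (real (dist0 n) - 1) \<le> max 0 (max (real n - \<tau>) (\<tau> - real n - 1))"
      unfolding dist0_def j0_def by linarith
    then show ?thesis using G by (intro divide_left_mono power_mono mult_pos_pos) (auto simp: add_nonneg_pos)
  qed
  have half: "(\<Sum>n\<in>S. ?c n) \<le> 2 / G\<^sup>2 + 1 / G" if S: "finite S" "inj_on dist0 S" for S
  proof -
    have "(\<Sum>n\<in>S. ?c n) \<le> (\<Sum>n\<in>S. ?d (dist0 n))" by (intro sum_mono cd)
    also have "\<dots> = (\<Sum>j\<in>dist0 ` S. ?d j)" using S by (simp add: sum.reindex)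
    also have "\<dots> \<le> (\<Sum>j<Suc (Max (dist0 ` S)). ?d j)"
    proof (rule sum_mono2)
      show "dist0 ` S \<subseteq> {..<Suc (Max (dist0 ` S))}" using S(1) by (auto simp: less_Suc_eq_le)
    qed auto
    also have "\<dots> \<le> 2 / G\<^sup>2 + 1 / G" by (rule sum_inverse_square_le[OF G])
    finally show ?thesis .
  qed
  have "{..<m} = {n\<in>{..<m}. int n \<ge> j0} \<union> {n\<in>{..<m}. int n < j0}" by auto
  then have "(\<Sum>n<m. ?c n) = (\<Sum>n\<in>{n\<in>{..<m}. int n \<ge> j0}. ?c n) + (\<Sum>n\<in>{n\<in>{..<m}. int n < j0}. ?c n)"
    by (metis (no_types, lifting) finite_lessThan finite_Un sum.union_disjoint disjoint_iff mem_Collect_eq not_le)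
  also have "\<dots> \<le> (2 / G\<^sup>2 + 1 / G) + (2 / G\<^sup>2 + 1 / G)"
    by (intro add_mono half) (auto simp: inj_on_def dist0_def)
  finally show ?thesis by simp
qed

section \<open>Sums of powers of the eigenvalues, near \<open>r\<close> and away from it\<close>

lemma powr_le_near:
  fixes x r s :: real
  assumes r: "r > 0" and x: "r / 2 \<le> x" "x \<le> 2 * r"
  shows "x powr s \<le> 2 powr \<bar>s\<bar> * r powr s"
proof -
  have x0: "x > 0" using r x by linarith
  have "(x / r) powr s \<le> 2 powr \<bar>s\<bar>"
  proof (cases "s \<ge> 0")
    case True
    then show ?thesis using x r x0 by (auto intro!: powr_mono2 simp: field_simps)
  next
    case False
    have "(x / r) powr s = (r / x) powr (- s)"
      using r x0 by (simp add: powr_minus powr_divide field_simps)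
    also have "\<dots> \<le> 2 powr (- s)" using False x r x0 by (intro powr_mono2) (auto simp: field_simps)
    finally show ?thesis using False by simp
  qed
  then show ?thesis using r x0 by (simp add: powr_divide field_simps)
qed

lemma powr_diff_le:
  fixes x r \<alpha> :: real
  assumes r: "r > 0" and x: "r / 2 \<le> x" "x \<le> 2 * r" and \<alpha>: "\<alpha> > 0"
  shows "\<bar>x powr \<alpha> - r powr \<alpha>\<bar> \<le> \<alpha> * 2 powr \<bar>\<alpha> - 1\<bar> * r powr (\<alpha> - 1) * \<bar>x - r\<bar>"
proof -
  have "norm (x powr \<alpha> - r powr \<alpha>) \<le> (\<alpha> * (2 powr \<bar>\<alpha> - 1\<bar> * r powr (\<alpha> - 1))) * norm (x - r)"
  proof (rule field_differentiable_bound[where S = "{r / 2..2 * r}" and f' = "\<lambda>y. \<alpha> * y powr (\<alpha> - 1)"])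
    fix y assume y: "y \<in> {r / 2..2 * r}"
    then have "y > 0" using r by auto
    then show "((\<lambda>y. y powr \<alpha>) has_field_derivative \<alpha> * y powr (\<alpha> - 1)) (at y within {r / 2..2 * r})"
      by (rule has_field_derivative_at_within[OF has_real_derivative_powr])
    have "y powr (\<alpha> - 1) \<le> 2 powr \<bar>\<alpha> - 1\<bar> * r powr (\<alpha> - 1)"
      using y by (intro powr_le_near[OF r]) auto
    then have "\<alpha> * y powr (\<alpha> - 1) \<le> \<alpha> * (2 powr \<bar>\<alpha> - 1\<bar> * r powr (\<alpha> - 1))"
      using \<alpha> by (intro mult_left_mono) auto
    then show "norm (\<alpha> * y powr (\<alpha> - 1)) \<le> \<alpha> * (2 powr \<bar>\<alpha> - 1\<bar> * r powr (\<alpha> - 1))"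
      using \<alpha> by (simp only: real_norm_def abs_mult abs_of_pos abs_of_nonneg powr_ge_zero)
  qed (use r x in auto)
  then show ?thesis by (simp add: mult.assoc)
qed

context
  fixes \<mu> :: "nat \<Rightarrow> real" and \<alpha> \<beta> \<gamma> :: real and l :: nat
  assumes \<mu>: "\<And>k. \<mu> k > 1" and \<alpha>: "\<alpha> > 0"
    and l: "\<And>s. s > 0 \<Longrightarrow> finite {k. \<mu> k powr \<alpha> \<in> {s<..s + 1}} \<and> card {k. \<mu> k powr \<alpha> \<in> {s<..s + 1}} \<le> l"
    and exponents: "2 * \<beta> + \<alpha> - 1 < 1"
begin

lemma powr_gt_1: "\<mu> k powr \<alpha> > 1"
  using \<mu>[of k] \<alpha> by (intro gr_one_powr)

text \<open>In the variable \<open>t = \<mu> k powr \<alpha>\<close> the terms are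
  \<open>t powr p\<close>, and \<open>2 * \<beta> + \<alpha> - 1 < 1\<close> says exactly that
  \<open>p < - 1\<close>.\<close>

lemma summable_\<mu>: "summable (\<lambda>k. \<mu> k powr (2 * \<beta> - 2))"
proof (rule bounded_imp_summable)
  define p where "p = (2 * \<beta> - 2) / \<alpha>"
  have p: "p < - 1" using exponents \<alpha> by (simp add: p_def field_simps)
  then have sum: "summable (\<lambda>n. real n powr p)" by (simp add: summable_real_powr_iff)
  fix m
  have "(\<Sum>k<Suc m. \<mu> k powr (2 * \<beta> - 2)) \<le> real l * (\<Sum>n. real n powr p)"
  proof (rule sum_unit_intervals_le[where t = "\<lambda>k. \<mu> k powr \<alpha>" and c = "\<lambda>n. real n powr p"])
    show "(\<Sum>n<m. real n powr p) \<le> (\<Sum>n. real n powr p)" for m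
      by (intro sum_le_suminf sum) auto
    fix k n assume n: "real n < \<mu> k powr \<alpha>" "\<mu> k powr \<alpha> \<le> real n + 1"
    then have "n > 0" using powr_gt_1[of k] by (cases n) auto
    then have "(\<mu> k powr \<alpha>) powr p \<le> real n powr p" using n p by (intro powr_mono2') auto
    moreover have "(\<mu> k powr \<alpha>) powr p = \<mu> k powr (2 * \<beta> - 2)"
      using \<alpha> by (simp add: powr_powr p_def)
    ultimately show "\<mu> k powr (2 * \<beta> - 2) \<le> real n powr p" by simp
  qed (use powr_gt_1 l in auto)
  then show "(\<Sum>k\<le>m. \<mu> k powr (2 * \<beta> - 2)) \<le> real l * (\<Sum>n. real n powr p)"
    by (simp add: lessThan_Suc_atMost)
qed simp

text \<open>After the substitution \<open>t = \<mu> powr \<alpha>\<close> there are at most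
  \<open>l\<close> members per unit interval. \<open>Q\<close> bounds the derivative of the
  substitution between \<open>r / 2\<close> and \<open>2 * r\<close>, so distances grow at most by
  \<open>Q\<close> and the gap \<open>g\<close> becomes \<open>G = Q * g\<close>. The term with
  \<open>1 / g\<^sup>2\<close> stems from the intervals nearest to \<open>r\<close>, the one with
  \<open>1 / g\<close> from the remaining ones.\<close>

lemma middle_sum_le:
  assumes r: "r > 0" and g: "g > 0" and K: "finite K" "\<And>k. k \<in> K \<Longrightarrow> r / 2 \<le> \<mu> k \<and> \<mu> k \<le> 2 * r"
  shows "(\<Sum>k\<in>K. \<mu> k powr (2 * \<beta>) / (\<bar>\<mu> k - r\<bar> + g)\<^sup>2)
    \<le> 2 powr \<bar>2 * \<beta>\<bar> * real l * (4 * r powr (2 * \<beta>) / g\<^sup>2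
        + 2 * (\<alpha> * 2 powr \<bar>\<alpha> - 1\<bar>) * r powr (2 * \<beta> + \<alpha> - 1) / g)"
proof -
  define Q where "Q = \<alpha> * 2 powr \<bar>\<alpha> - 1\<bar> * r powr (\<alpha> - 1)"
  have Q: "Q > 0" using \<alpha> r by (simp add: Q_def)
  define G where "G = Q * g"
  have G: "G > 0" using Q g by (simp add: G_def)
  define \<tau> where "\<tau> = r powr \<alpha>"
  let ?t = "\<lambda>k. \<mu> k powr \<alpha>"
  let ?c = "\<lambda>n. 1 / (max 0 (max (real n - \<tau>) (\<tau> - real n - 1)) + G)\<^sup>2"
  have grouped: "(\<Sum>k\<in>K. 1 / (\<bar>?t k - \<tau>\<bar> + G)\<^sup>2) \<le> real l * (4 / G\<^sup>2 + 2 / G)"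
  proof (rule sum_unit_intervals_le[where t = ?t and c = ?c])
    fix k n assume "real n < ?t k" "?t k \<le> real n + 1"
    then have "max 0 (max (real n - \<tau>) (\<tau> - real n - 1)) \<le> \<bar>?t k - \<tau>\<bar>" by auto
    then show "1 / (\<bar>?t k - \<tau>\<bar> + G)\<^sup>2 \<le> ?c n"
      using G by (intro divide_left_mono power_mono) (auto intro!: mult_pos_pos add_nonneg_pos simp: zero_less_power)
  qed (use powr_gt_1 l K sum_inverse_square_centered_le[OF G] in auto)
  have termwise: "\<mu> k powr (2 * \<beta>) / (\<bar>\<mu> k - r\<bar> + g)\<^sup>2
      \<le> (2 powr \<bar>2 * \<beta>\<bar> * r powr (2 * \<beta>) * Q\<^sup>2) * (1 / (\<bar>?t k - \<tau>\<bar> + G)\<^sup>2)" if k: "k \<in> K" for k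
  proof -
    have "\<bar>?t k - \<tau>\<bar> + G \<le> Q * (\<bar>\<mu> k - r\<bar> + g)"
      using powr_diff_le[OF r _ _ \<alpha>, of "\<mu> k"] K(2)[OF k] by (simp add: Q_def \<tau>_def G_def algebra_simps)
    then have "(\<bar>?t k - \<tau>\<bar> + G)\<^sup>2 \<le> (Q * (\<bar>\<mu> k - r\<bar> + g))\<^sup>2" using G by (intro power_mono) auto
    then have le: "(\<bar>?t k - \<tau>\<bar> + G)\<^sup>2 \<le> Q\<^sup>2 * (\<bar>\<mu> k - r\<bar> + g)\<^sup>2" by (simp only: power_mult_distrib)
    have inv_le: "1 / y \<le> q * (1 / x)" if "x \<le> q * y" "x > 0" "y > 0" for x y q :: real
      using that by (simp add: field_simps)
    have 1: "1 / (\<bar>\<mu> k - r\<bar> + g)\<^sup>2 \<le> Q\<^sup>2 * (1 / (\<bar>?t k - \<tau>\<bar> + G)\<^sup>2)"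
      by (rule inv_le[OF le]) (use G g in \<open>auto simp: add_nonneg_pos zero_less_power\<close>)
    have "\<mu> k powr (2 * \<beta>) \<le> 2 powr \<bar>2 * \<beta>\<bar> * r powr (2 * \<beta>)"
      using K(2)[OF k] by (intro powr_le_near r) auto
    then have "\<mu> k powr (2 * \<beta>) * (1 / (\<bar>\<mu> k - r\<bar> + g)\<^sup>2)
        \<le> (2 powr \<bar>2 * \<beta>\<bar> * r powr (2 * \<beta>)) * (Q\<^sup>2 * (1 / (\<bar>?t k - \<tau>\<bar> + G)\<^sup>2))"
      using 1 by (intro mult_mono) auto
    then show ?thesis by (simp add: mult.assoc)
  qed
  define R where "R = r powr (2 * \<beta>)"
  define P where "P = 2 powr \<bar>2 * \<beta>\<bar>"
  have RP: "R \<ge> 0" "P \<ge> 0" by (simp_all add: R_def P_def)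
  have "(\<Sum>k\<in>K. \<mu> k powr (2 * \<beta>) / (\<bar>\<mu> k - r\<bar> + g)\<^sup>2)
      \<le> (\<Sum>k\<in>K. (P * R * Q\<^sup>2) * (1 / (\<bar>?t k - \<tau>\<bar> + G)\<^sup>2))"
    unfolding R_def P_def by (rule sum_mono[OF termwise])
  also have "\<dots> = (P * R * Q\<^sup>2) * (\<Sum>k\<in>K. 1 / (\<bar>?t k - \<tau>\<bar> + G)\<^sup>2)"
    by (rule sum_distrib_left[symmetric])
  also have "\<dots> \<le> (P * R * Q\<^sup>2) * (real l * (4 / G\<^sup>2 + 2 / G))"
    using RP by (intro mult_left_mono[OF grouped]) auto
  also have "\<dots> = P * real l * R * (Q\<^sup>2 * (4 / G\<^sup>2 + 2 / G))" by (simp only: mult_ac)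
  also have "Q\<^sup>2 * (4 / G\<^sup>2 + 2 / G) = 4 / g\<^sup>2 + 2 * Q / g"
    using Q g by (simp add: G_def field_simps power2_eq_square)
  also have "P * real l * R * (4 / g\<^sup>2 + 2 * Q / g) = P * real l * (4 * R / g\<^sup>2 + 2 * (R * Q) / g)"
    by (simp add: distrib_left mult_ac)
  finally have "(\<Sum>k\<in>K. \<mu> k powr (2 * \<beta>) / (\<bar>\<mu> k - r\<bar> + g)\<^sup>2)
      \<le> P * real l * (4 * R / g\<^sup>2 + 2 * (R * Q) / g)" .
  moreover have "R * Q = (\<alpha> * 2 powr \<bar>\<alpha> - 1\<bar>) * r powr (2 * \<beta> + \<alpha> - 1)"
    by (simp add: R_def Q_def powr_add[symmetric] algebra_simps)
  ultimately show ?thesis by (simp add: P_def R_def mult.assoc)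
qed

text \<open>Both conditions on \<open>\<gamma>\<close> concern the eigenvalues between
  \<open>r / 2\<close> and \<open>2 * r\<close>: they make the two terms of the middle sum at most
  multiples of \<open>1 / c\<close>. The other eigenvalues are at distance at least
  \<open>r / 2\<close> and at least \<open>\<mu> k / 2\<close> from \<open>r\<close>; the tail of a
  convergent series handles all but finitely many of them, the factor \<open>1 / r\<^sup>2\<close>
  the rest.\<close>

lemma resolvent_sum_small:
  assumes \<gamma>: "\<gamma> \<ge> \<beta>" "\<gamma> \<ge> 2 * \<beta> + \<alpha> - 1" and \<epsilon>: "\<epsilon> > 0"
  shows "\<exists>c>0. \<exists>r0\<ge>1. \<forall>r\<ge>r0. \<forall>n. (\<Sum>k<n. \<mu> k powr (2 * \<beta>) / (\<bar>\<mu> k - r\<bar> + c * r powr \<gamma>)\<^sup>2) \<le> \<epsilon>"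
proof -
  define P where "P = 2 powr \<bar>2 * \<beta>\<bar> * real l"
  define Q where "Q = \<alpha> * 2 powr \<bar>\<alpha> - 1\<bar>"
  have PQ: "P \<ge> 0" "Q > 0" using \<alpha> by (auto simp: P_def Q_def)
  \<comment> \<open>Chosen to bring the middle sum below a third of \<open>\<epsilon>\<close>; the
    maximum with 1 allows \<open>1 / c\<^sup>2 \<le> 1 / c\<close>.\<close>
  define c where "c = max 1 (3 * P * (4 + 2 * Q) / \<epsilon>)"
  have c: "c \<ge> 1" "P * (4 + 2 * Q) / c \<le> \<epsilon> / 3"
  proof -
    show "c \<ge> 1" by (simp add: c_def)
    have "3 * P * (4 + 2 * Q) / \<epsilon> \<le> c" by (simp add: c_def)
    then show "P * (4 + 2 * Q) / c \<le> \<epsilon> / 3" using \<open>c \<ge> 1\<close> \<epsilon> by (simp add: field_simps)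
  qed
  have "summable (\<lambda>k. 4 * \<mu> k powr (2 * \<beta> - 2))" by (rule summable_mult[OF summable_\<mu>])
  then obtain m0 where m0: "\<And>n. norm (\<Sum>k=m0..<n. 4 * \<mu> k powr (2 * \<beta> - 2)) < \<epsilon> / 3"
    unfolding summable_Cauchy using \<epsilon> by (metis divide_pos_pos order_refl zero_less_numeral)
  define S0 where "S0 = (\<Sum>k<m0. 4 * \<mu> k powr (2 * \<beta>))"
  have S0: "S0 \<ge> 0" by (auto simp: S0_def intro: sum_nonneg)
  define r0 where "r0 = max 1 (3 * S0 / \<epsilon>)"
  have main: "(\<Sum>k<n. \<mu> k powr (2 * \<beta>) / (\<bar>\<mu> k - r\<bar> + c * r powr \<gamma>)\<^sup>2) \<le> \<epsilon>" if r: "r \<ge> r0" for r n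
  proof -
    have r1: "r \<ge> 1" "3 * S0 / \<epsilon> \<le> r" using r by (auto simp: r0_def)
    define g where "g = c * r powr \<gamma>"
    have g: "g > 0" using c(1) r1 by (simp add: g_def)
    let ?f = "\<lambda>k. \<mu> k powr (2 * \<beta>) / (\<bar>\<mu> k - r\<bar> + g)\<^sup>2"
    define K where "K = {k. k < n \<and> r / 2 \<le> \<mu> k \<and> \<mu> k \<le> 2 * r}"
    define O1 where "O1 = {k. k < n \<and> \<not> (r / 2 \<le> \<mu> k \<and> \<mu> k \<le> 2 * r)}"
    have outer: "r / 2 \<le> \<bar>\<mu> k - r\<bar>" "\<mu> k / 2 \<le> \<bar>\<mu> k - r\<bar>" if "k \<in> O1" for k
      using that r1 by (auto simp: O1_def)
    have outer1: "?f k \<le> 4 * \<mu> k powr (2 * \<beta>) / r\<^sup>2" if k: "k \<in> O1" for k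
    proof -
      have "(r / 2)\<^sup>2 \<le> (\<bar>\<mu> k - r\<bar> + g)\<^sup>2" using outer(1)[OF k] g r1 by (intro power_mono) auto
      then have "?f k \<le> \<mu> k powr (2 * \<beta>) / (r / 2)\<^sup>2"
        using g r1 by (intro divide_left_mono mult_pos_pos) (auto simp: add_nonneg_pos zero_less_power)
      then show ?thesis by (simp add: power_divide field_simps)
    qed
    have outer2: "?f k \<le> 4 * \<mu> k powr (2 * \<beta> - 2)" if k: "k \<in> O1" for k
    proof -
      have "(\<mu> k / 2)\<^sup>2 \<le> (\<bar>\<mu> k - r\<bar> + g)\<^sup>2" using outer(2)[OF k] g \<mu>[of k] by (intro power_mono) auto
      then have "?f k \<le> \<mu> k powr (2 * \<beta>) / (\<mu> k / 2)\<^sup>2"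
        using g \<mu>[of k] by (intro divide_left_mono mult_pos_pos) (auto simp: add_nonneg_pos zero_less_power)
      also have "\<dots> = 4 * \<mu> k powr (2 * \<beta> - 2)"
        using \<mu>[of k] by (simp add: powr_diff power_divide powr_numeral)
      finally show ?thesis .
    qed
    have "{..<n} = K \<union> O1" "K \<inter> O1 = {}" "finite K" "finite O1" by (auto simp: K_def O1_def)
    then have "(\<Sum>k<n. ?f k) = sum ?f K + sum ?f O1" by (simp add: sum.union_disjoint)
    moreover have "sum ?f O1 \<le> \<epsilon> / 3 + \<epsilon> / 3"
    proof -
      have "sum ?f O1 \<le> (\<Sum>k\<in>O1. if k < m0 then 4 * \<mu> k powr (2 * \<beta>) / r\<^sup>2 else 4 * \<mu> k powr (2 * \<beta> - 2))"
        by (intro sum_mono) (use outer1 outer2 in auto)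
      also have "\<dots> \<le> (\<Sum>k<max m0 n. if k < m0 then 4 * \<mu> k powr (2 * \<beta>) / r\<^sup>2 else 4 * \<mu> k powr (2 * \<beta> - 2))"
        by (intro sum_mono2) (auto simp: O1_def)
      also have "{..<max m0 n} = {..<m0} \<union> {m0..<max m0 n}" by auto
      also have "(\<Sum>k\<in>{..<m0} \<union> {m0..<max m0 n}. if k < m0 then 4 * \<mu> k powr (2 * \<beta>) / r\<^sup>2 else 4 * \<mu> k powr (2 * \<beta> - 2))
          = S0 / r\<^sup>2 + (\<Sum>k=m0..<max m0 n. 4 * \<mu> k powr (2 * \<beta> - 2))"
        by (subst sum.union_disjoint) (auto simp: S0_def sum_divide_distrib)
      also have "(\<Sum>k=m0..<max m0 n. 4 * \<mu> k powr (2 * \<beta> - 2)) \<le> \<epsilon> / 3" using m0[of "max m0 n"] by simp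
      also have "S0 / r\<^sup>2 \<le> \<epsilon> / 3"
      proof -
        have "3 * S0 \<le> \<epsilon> * r" using r1 \<epsilon> by (simp add: field_simps)
        also have "\<dots> \<le> \<epsilon> * r\<^sup>2" using r1 \<epsilon> by (intro mult_left_mono) (auto simp: power2_eq_square)
        finally show ?thesis using r1 by (simp add: field_simps)
      qed
      finally show ?thesis by simp
    qed
    moreover have "sum ?f K \<le> \<epsilon> / 3"
    proof -
      have "sum ?f K \<le> P * (4 * r powr (2 * \<beta>) / g\<^sup>2 + 2 * Q * r powr (2 * \<beta> + \<alpha> - 1) / g)"
        unfolding P_def Q_def
        by (rule middle_sum_le[OF _ g \<open>finite K\<close>]) (use r1 in \<open>auto simp: K_def\<close>)
      also have "\<dots> \<le> P * (4 / c + 2 * Q / c)"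
      proof (intro mult_left_mono add_mono)
        have "r powr (2 * \<beta>) \<le> r powr (2 * \<gamma>)" using \<gamma> r1 by (intro powr_mono) auto
        also have "\<dots> = (r powr \<gamma>)\<^sup>2" using r1 by (simp add: powr_powr mult.commute flip: powr_numeral)
        finally have "4 * r powr (2 * \<beta>) / g\<^sup>2 \<le> 4 * (r powr \<gamma>)\<^sup>2 / g\<^sup>2" using g by (intro divide_right_mono) auto
        also have "\<dots> = 4 / c\<^sup>2" using r1 c by (simp add: g_def power_mult_distrib)
        also have "\<dots> \<le> 4 / c" using c by (intro divide_left_mono) (auto simp: power2_eq_square)
        finally show "4 * r powr (2 * \<beta>) / g\<^sup>2 \<le> 4 / c" .
        have "r powr (2 * \<beta> + \<alpha> - 1) \<le> r powr \<gamma>" using \<gamma> r1 by (intro powr_mono) auto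
        then have "2 * Q * r powr (2 * \<beta> + \<alpha> - 1) / g \<le> 2 * Q * r powr \<gamma> / g"
          using g PQ by (intro divide_right_mono mult_left_mono) auto
        also have "\<dots> = 2 * Q / c" using r1 c by (simp add: g_def)
        finally show "2 * Q * r powr (2 * \<beta> + \<alpha> - 1) / g \<le> 2 * Q / c" .
      qed (use PQ in auto)
      also have "\<dots> = P * (4 + 2 * Q) / c" by (simp add: distrib_left add_divide_distrib)
      finally show ?thesis using c(2) by linarith
    qed
    ultimately show ?thesis by (simp add: g_def)
  qed
  have "c > 0" "r0 \<ge> 1" using c(1) by (simp_all add: r0_def)
  then show ?thesis using main by blast
qed

end

section \<open>Counting eigenvalues by the argument of the determinant\<close>

context
  fixes D :: "'a::complex_hilbert set" and A0 :: "'a \<Rightarrow> 'a" and R :: real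
    and M :: nat and g e :: "nat \<Rightarrow> 'a"
  assumes lin: "linear_operator D A0" and ball: "ball 0 R \<subseteq> op_resolvent_set D A0"
    and nonzero: "\<exists>w\<in>ball 0 R. pert_det D A0 M g e w \<noteq> 0"
begin

abbreviation (input) "pdet \<equiv> pert_det D A0 M g e"
abbreviation (input) "pert_op \<equiv> (\<lambda>x. A0 x + rank_pert M g e x)"

text \<open>The exponents are algebraic multiplicities: near \<open>z\<close> the other linear
  factors times \<open>h\<close> form a continuous nonvanishing cofactor, so the root space has a
  basis of \<open>n z\<close> elements.\<close>

lemma pert_det_factorization:
  assumes \<rho>: "\<rho> < R"
  obtains n h where "finite {z \<in> cball 0 \<rho>. pdet z = 0}" "h holomorphic_on ball 0 R"
    "\<And>w. w \<in> cball 0 \<rho> \<Longrightarrow> h w \<noteq> 0"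
    "\<And>w. w \<in> ball 0 R \<Longrightarrow> pdet w = (\<Prod>z\<in>{z \<in> cball 0 \<rho>. pdet z = 0}. (w - z) ^ n z) * h w"
    "\<And>z. z \<in> cball 0 \<rho> \<Longrightarrow> pdet z = 0 \<Longrightarrow>
      algebraic_multiplicity D pert_op z = n z \<and> (\<exists>F. finite F \<and> root_space D pert_op z \<subseteq> complex_vector.span F)"
proof -
  have holo: "pdet holomorphic_on ball 0 R" by (rule pert_det_holomorphic[OF lin open_ball ball])
  have sub: "cball 0 \<rho> \<subseteq> ball 0 R" using \<rho> by auto
  obtain n h where fin: "finite {z \<in> cball 0 \<rho>. pdet z = 0}" and h: "h holomorphic_on ball 0 R"
    "\<And>w. w \<in> cball 0 \<rho> \<Longrightarrow> h w \<noteq> 0"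
    "\<And>w. w \<in> ball 0 R \<Longrightarrow> pdet w = (\<Prod>z\<in>{z \<in> cball 0 \<rho>. pdet z = 0}. (w - z) ^ n z) * h w"
    using holomorphic_factorization[OF holo open_ball connected_ball compact_cball sub nonzero] by blast
  have mult: "algebraic_multiplicity D pert_op z = n z \<and> (\<exists>F. finite F \<and> root_space D pert_op z \<subseteq> complex_vector.span F)"
    if z: "z \<in> cball 0 \<rho>" "pdet z = 0" for z
  proof -
    let ?Z = "{z \<in> cball 0 \<rho>. pdet z = 0}"
    define k where "k w = (\<Prod>y\<in>?Z - {z}. (w - y) ^ n y) * h w" for w
    have zU: "z \<in> ball 0 R" using z sub by blast
    have "pdet w = (w - z) ^ n z * k w" if "w \<in> ball 0 R" for w
      unfolding h(3)[OF that] k_def using prod.remove[OF fin, of z "\<lambda>y. (w - y) ^ n y"] z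
      by (simp add: mult.assoc)
    moreover have "eventually (\<lambda>w. w \<in> ball 0 R) (at z)"
      using zU by (metis eventually_at_topological open_ball)
    ultimately have ev: "eventually (\<lambda>w. pdet w = (w - z) ^ n z * k w) (at z)" by (auto elim: eventually_mono)
    have "isCont h z" using holomorphic_on_imp_continuous_on[OF h(1)] zU
      by (simp add: continuous_on_eq_continuous_at)
    then have cont: "isCont k z" unfolding k_def by (intro continuous_intros)
    have kz: "k z \<noteq> 0" using h(2) z fin by (auto simp: k_def)
    obtain b where b: "finite b" "\<not> complex_vector.dependent b" "card b = n z"
      "complex_vector.span b = root_space D pert_op z"
      using root_space_basis[OF lin open_ball ball zU ev cont kz] by blast
    have "algebraic_multiplicity D pert_op z = n z"
      unfolding algebraic_multiplicity_def b(4)[symmetric]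
      using complex_vector.dim_span_eq_card_independent[of b] b by simp
    then show ?thesis using b by blast
  qed
  show thesis by (rule that[OF fin h mult])
qed

lemma spectrum_in_ball_iff: "z \<in> ball 0 R \<Longrightarrow> z \<in> op_spectrum D pert_op \<longleftrightarrow> pdet z = 0"
  using pert_spectrum_iff(1)[OF lin, of z] ball by blast

lemma pert_discrete:
  assumes z: "z \<in> ball 0 R"
  shows "\<not> z islimpt op_spectrum D pert_op"
    and "z \<in> op_spectrum D pert_op \<Longrightarrow> op_eigenvalue D pert_op z \<and>
      (\<exists>F. finite F \<and> root_space D pert_op z \<subseteq> complex_vector.span F)"
proof -
  define \<rho> where "\<rho> = (cmod z + R) / 2"
  have \<rho>: "cmod z < \<rho>" "\<rho> < R" using z by (auto simp: \<rho>_def)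
  obtain n h where fin: "finite {z \<in> cball 0 \<rho>. pdet z = 0}" "h holomorphic_on ball 0 R"
    "\<And>w. w \<in> cball 0 \<rho> \<Longrightarrow> h w \<noteq> 0"
    "\<And>w. w \<in> ball 0 R \<Longrightarrow> pdet w = (\<Prod>z\<in>{z \<in> cball 0 \<rho>. pdet z = 0}. (w - z) ^ n z) * h w"
    and mult: "\<And>z. z \<in> cball 0 \<rho> \<Longrightarrow> pdet z = 0 \<Longrightarrow>
      algebraic_multiplicity D pert_op z = n z \<and> (\<exists>F. finite F \<and> root_space D pert_op z \<subseteq> complex_vector.span F)"
    by (rule pert_det_factorization[OF \<rho>(2)], rule that)
  have "ball 0 \<rho> \<inter> op_spectrum D pert_op \<subseteq> {z \<in> cball 0 \<rho>. pdet z = 0}"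
    using spectrum_in_ball_iff \<rho> by auto
  then have "finite (ball 0 \<rho> \<inter> op_spectrum D pert_op)" using fin finite_subset by blast
  moreover have "op_spectrum D pert_op \<inter> ball z (\<rho> - cmod z) \<subseteq> ball 0 \<rho> \<inter> op_spectrum D pert_op"
  proof
    fix x assume "x \<in> op_spectrum D pert_op \<inter> ball z (\<rho> - cmod z)"
    then show "x \<in> ball 0 \<rho> \<inter> op_spectrum D pert_op"
      using norm_triangle_ineq2[of x z] by (simp add: dist_norm norm_minus_commute)
  qed
  ultimately have "finite (op_spectrum D pert_op \<inter> ball z (\<rho> - cmod z))" by (rule finite_subset[rotated])
  then show "\<not> z islimpt op_spectrum D pert_op"
    unfolding islimpt_eq_infinite_ball using \<rho>(1) by (meson diff_gt_0_iff_gt)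
  show "op_eigenvalue D pert_op z \<and> (\<exists>F. finite F \<and> root_space D pert_op z \<subseteq> complex_vector.span F)"
    if zs: "z \<in> op_spectrum D pert_op"
  proof
    show "op_eigenvalue D pert_op z" using pert_spectrum_iff(2)[OF lin _ zs] ball z by blast
    have "pdet z = 0" using spectrum_in_ball_iff[OF z] zs by simp
    then show "\<exists>F. finite F \<and> root_space D pert_op z \<subseteq> complex_vector.span F" using mult[of z] \<rho> by simp
  qed
qed

text \<open>The argument principle, read off the factorization: each linear factor turns once, the
  zero-free cofactor not at all.\<close>

lemma pert_det_argument:
  assumes \<rho>: "0 < \<rho>" "\<rho> < R" and nz: "\<And>z. cmod z = \<rho> \<Longrightarrow> pdet z \<noteq> 0"
  shows "arg_change (\<lambda>u. pdet (circle_point \<rho> u)) (- pi) pi (2 * pi * eigenvalue_count D pert_op \<rho>)"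
proof -
  let ?Z = "{z \<in> cball 0 \<rho>. pdet z = 0}"
  obtain n h where fin: "finite ?Z" and h: "h holomorphic_on ball 0 R"
    "\<And>w. w \<in> cball 0 \<rho> \<Longrightarrow> h w \<noteq> 0"
    "\<And>w. w \<in> ball 0 R \<Longrightarrow> pdet w = (\<Prod>z\<in>?Z. (w - z) ^ n z) * h w"
    and mult: "\<And>z. z \<in> cball 0 \<rho> \<Longrightarrow> pdet z = 0 \<Longrightarrow>
      algebraic_multiplicity D pert_op z = n z \<and> (\<exists>F. finite F \<and> root_space D pert_op z \<subseteq> complex_vector.span F)"
    by (rule pert_det_factorization[OF \<rho>(2)], rule that)
  have inside: "cmod z < \<rho>" if "z \<in> ?Z" for z using that nz[of z] by (auto simp: less_le)
  have spec: "{z. z \<in> op_spectrum D pert_op \<and> cmod z < \<rho>} = ?Z"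
    using spectrum_in_ball_iff \<rho> inside by auto
  have count: "real (eigenvalue_count D pert_op \<rho>) = (\<Sum>z\<in>?Z. real (n z))"
    unfolding eigenvalue_count_def spec using mult by simp
  have "arg_change (\<lambda>u. \<Prod>z\<in>?Z. (circle_point \<rho> u - z) ^ n z) (- pi) pi (\<Sum>z\<in>?Z. real (n z) * (2 * pi))"
    by (intro arg_change_prod fin arg_change_power arg_change_linear_inside inside)
  moreover have "arg_change (\<lambda>u. h (circle_point \<rho> u)) (- pi) pi 0"
    by (rule arg_change_zero_free)
      (use h \<rho> in \<open>auto intro!: holomorphic_on_imp_continuous_on intro: holomorphic_on_subset\<close>)
  ultimately have "arg_change (\<lambda>u. (\<Prod>z\<in>?Z. (circle_point \<rho> u - z) ^ n z) * h (circle_point \<rho> u)) (- pi) pi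
      ((\<Sum>z\<in>?Z. real (n z) * (2 * pi)) + 0)" by (rule arg_change_mult)
  then have "arg_change (\<lambda>u. pdet (circle_point \<rho> u)) (- pi) pi ((\<Sum>z\<in>?Z. real (n z) * (2 * pi)) + 0)"
    by (rule arg_change_cong) (use h(3) \<rho> in \<open>simp add: norm_circle_point\<close>)
  moreover have "(\<Sum>z\<in>?Z. real (n z) * (2 * pi)) + 0 = 2 * pi * eigenvalue_count D pert_op \<rho>"
    unfolding count by (simp add: sum_distrib_left mult.commute)
  ultimately show ?thesis by simp
qed

end

text \<open>On such an arc the sine increases, so each linear factor has increasing imaginary part
  and contributes at most \<open>2 * pi\<close>, wherever its zero lies. At most
  \<open>4 * L\<close> zeros give \<open>8 * pi * L\<close>; the logarithm of the cofactor deviates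
  by at most \<open>6 * L\<close> from its value at \<open>p\<close> at either end.\<close>

lemma arg_change_near_point:
  assumes holo: "h holomorphic_on ball p R" and R: "R > 0" and L: "L > 0"
    and upper: "\<And>w. w \<in> ball p R \<Longrightarrow> cmod (h w) \<le> exp L" and lower: "exp (- L) \<le> cmod (h p)"
    and \<rho>: "\<rho> > 0" and \<theta>: "0 < \<theta>" "\<theta> \<le> pi / 2"
    and arc: "\<And>u. u \<in> {- \<theta>..\<theta>} \<Longrightarrow> circle_point \<rho> u \<in> ball p (R / 8)"
    and nz: "\<And>u. u \<in> {- \<theta>..\<theta>} \<Longrightarrow> h (circle_point \<rho> u) \<noteq> 0"
    and \<delta>: "arg_change (\<lambda>u. h (circle_point \<rho> u)) (- \<theta>) \<theta> \<delta>"
  shows "\<bar>\<delta>\<bar> \<le> 8 * pi * L + 12 * L"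
proof -
  obtain Z n l where Z: "finite Z" "real (\<Sum>z\<in>Z. n z) \<le> 4 * L" and l: "continuous_on (ball p (R/8)) l"
    and fac: "\<And>w. w \<in> ball p (R/8) \<Longrightarrow> h w = (\<Prod>z\<in>Z. (w - z) ^ n z) * exp (l w)"
    and osc: "\<And>w. w \<in> ball p (R/8) \<Longrightarrow> cmod (l w - l p) \<le> 6 * L"
    using zero_count_and_log_bound[OF holo R L upper lower] by blast
  have "\<exists>\<delta>. arg_change (\<lambda>u. (circle_point \<rho> u - z) ^ n z) (- \<theta>) \<theta> \<delta> \<and> \<bar>\<delta>\<bar> \<le> n z * (2 * pi)"
    if z: "z \<in> Z" for z
  proof (cases "n z = 0")
    case True
    then show ?thesis using arg_change_1 by auto
  next
    case False
    have "circle_point \<rho> u - z \<noteq> 0" if u: "u \<in> {- \<theta>..\<theta>}" for u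
      using nz[OF u] fac[OF arc[OF u]] z Z(1) False by (auto simp: prod_zero_iff)
    then obtain \<delta>' where d: "arg_change (\<lambda>u. circle_point \<rho> u - z) (- \<theta>) \<theta> \<delta>'"
      by (rule arg_change_exists[rotated]) (auto intro: continuous_intros)
    have "\<bar>\<delta>'\<bar> \<le> 2 * pi"
    proof (rule arg_change_monotone_Im[OF _ d])
      fix u v assume uv: "u \<in> {- \<theta>..\<theta>}" "v \<in> {- \<theta>..\<theta>}" "u < v"
      then have "sin u < sin v" using \<theta> by (intro sin_monotone_2pi) auto
      then show "Im (circle_point \<rho> u - z) < Im (circle_point \<rho> v - z)"
        using \<rho> by (simp add: circle_point_def)
    qed (use \<theta> in simp)
    then have "\<bar>real (n z) * \<delta>'\<bar> \<le> n z * (2 * pi)" by (simp add: abs_mult mult_left_mono)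
    with arg_change_power[OF d, of "n z"] show ?thesis by blast
  qed
  then obtain \<Delta> where \<Delta>: "\<And>z. z \<in> Z \<Longrightarrow> arg_change (\<lambda>u. (circle_point \<rho> u - z) ^ n z) (- \<theta>) \<theta> (\<Delta> z)"
    "\<And>z. z \<in> Z \<Longrightarrow> \<bar>\<Delta> z\<bar> \<le> n z * (2 * pi)" by metis
  have "continuous_on {- \<theta>..\<theta>} (\<lambda>u. l (circle_point \<rho> u))"
    by (rule continuous_on_compose2[OF l continuous_circle_point]) (use arc in auto)
  then have "arg_change (\<lambda>u. exp (l (circle_point \<rho> u))) (- \<theta>) \<theta>
      (Im (l (circle_point \<rho> \<theta>)) - Im (l (circle_point \<rho> (- \<theta>))))"
    by (rule arg_changeI) auto
  from arg_change_mult[OF arg_change_prod[OF Z(1) \<Delta>(1)] this]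
  have "arg_change (\<lambda>u. h (circle_point \<rho> u)) (- \<theta>) \<theta>
      ((\<Sum>z\<in>Z. \<Delta> z) + (Im (l (circle_point \<rho> \<theta>)) - Im (l (circle_point \<rho> (- \<theta>)))))"
    by (rule arg_change_cong) (assumption | rule fac[OF arc, symmetric])+
  then have eq: "\<delta> = (\<Sum>z\<in>Z. \<Delta> z) + (Im (l (circle_point \<rho> \<theta>)) - Im (l (circle_point \<rho> (- \<theta>))))"
    using arg_change_unique[OF _ \<delta>] \<theta> by simp
  have "\<bar>\<Sum>z\<in>Z. \<Delta> z\<bar> \<le> (\<Sum>z\<in>Z. n z * (2 * pi))"
    by (rule sum_abs[THEN order_trans]) (rule sum_mono[OF \<Delta>(2)])
  also have "\<dots> = real (\<Sum>z\<in>Z. n z) * (2 * pi)" by (simp add: sum_distrib_right)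
  also have "\<dots> \<le> (4 * L) * (2 * pi)" using Z(2) by (intro mult_right_mono) auto
  finally have 1: "\<bar>\<Sum>z\<in>Z. \<Delta> z\<bar> \<le> 8 * pi * L" by (simp add: mult_ac)
  have 2: "\<bar>Im (l (circle_point \<rho> u)) - Im (l p)\<bar> \<le> 6 * L" if "u \<in> {- \<theta>..\<theta>}" for u
    using osc[OF arc[OF that]] abs_Im_le_cmod[of "l (circle_point \<rho> u) - l p"] by simp
  show ?thesis using eq 1 2[of \<theta>] 2[of "- \<theta>"] \<theta> by (simp add: abs_le_iff)
qed

section \<open>Comparison of the counting functions\<close>

context diagonal_operator
begin

definition eig_vecs :: "(nat \<Rightarrow> nat) \<Rightarrow> nat \<Rightarrow> 'a" where
  "eig_vecs \<sigma> i = \<phi> (\<sigma> i)"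

text \<open>The weights sit in the functionals while the vectors \<open>eig_vecs \<sigma>\<close>
  are the same for all diagonals, because chaining of determinants demands a common
  \<open>e\<close>. The enumeration \<open>\<sigma>\<close> makes it possible to list the moved
  eigenvalues first.\<close>

definition shift_vecs :: "(nat \<Rightarrow> nat) \<Rightarrow> (nat \<Rightarrow> real) \<Rightarrow> (nat \<Rightarrow> real) \<Rightarrow> nat \<Rightarrow> 'a" where
  "shift_vecs \<sigma> \<nu> \<nu>' i = complex_of_real (\<nu> (\<sigma> i) - \<nu>' (\<sigma> i)) *\<^sub>C \<phi> (\<sigma> i)"

lemma shift_vecs_diff:
  "shift_vecs \<sigma> \<nu> \<nu>'' i - shift_vecs \<sigma> \<nu>' \<nu>'' i = shift_vecs \<sigma> \<nu> \<nu>' i"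
  by (simp add: shift_vecs_def flip: complex_vector.scale_left_diff_distrib of_real_diff)

lemma rank_pert_shift:
  "rank_pert N (shift_vecs \<sigma> \<nu> \<nu>') (eig_vecs \<sigma>) x
    = (\<Sum>i<N. (complex_of_real (\<nu> (\<sigma> i) - \<nu>' (\<sigma> i)) * cinner x (\<phi> (\<sigma> i))) *\<^sub>C \<phi> (\<sigma> i))"
  by (simp add: rank_pert_def shift_vecs_def eig_vecs_def cinner_scaleC_right)

lemma modified_shift:
  assumes "bij_betw \<sigma> {..<M} {..<M}"
  shows "modified M \<nu>' x + rank_pert M (shift_vecs \<sigma> \<nu> \<nu>') (eig_vecs \<sigma>) x = modified M \<nu> x"
proof -
  have "rank_pert M (shift_vecs \<sigma> \<nu> \<nu>') (eig_vecs \<sigma>) x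
      = (\<Sum>k<M. (complex_of_real (\<nu> k - \<nu>' k) * cinner x (\<phi> k)) *\<^sub>C \<phi> k)"
    unfolding rank_pert_shift by (rule sum.reindex_bij_betw[OF assms])
  then show ?thesis
    by (simp add: modified_def sum.distrib[symmetric] scaleC_add_left[symmetric] distrib_right[symmetric] add.assoc)
qed

lemma norm_shift_le:
  assumes inj: "inj_on \<sigma> {..<N}" and K: "\<And>i. i < N \<Longrightarrow> \<bar>\<nu> (\<sigma> i) - \<nu>' (\<sigma> i)\<bar> \<le> K" "K \<ge> 0"
  shows "norm (rank_pert N (shift_vecs \<sigma> \<nu> \<nu>') (eig_vecs \<sigma>) x) \<le> K * norm x"
proof (rule power2_le_imp_le)
  let ?c = "\<lambda>k. \<nu> k - \<nu>' k"
  have "rank_pert N (shift_vecs \<sigma> \<nu> \<nu>') (eig_vecs \<sigma>) x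
      = (\<Sum>k\<in>\<sigma> ` {..<N}. (complex_of_real (?c k) * cinner x (\<phi> k)) *\<^sub>C \<phi> k)"
    unfolding rank_pert_shift by (simp add: sum.reindex[OF inj])
  then have "(norm (rank_pert N (shift_vecs \<sigma> \<nu> \<nu>') (eig_vecs \<sigma>) x))\<^sup>2
      = (\<Sum>k\<in>\<sigma> ` {..<N}. (cmod (complex_of_real (?c k) * cinner x (\<phi> k)))\<^sup>2)"
    by (simp only: norm_finite_comb[of "\<sigma> ` {..<N}"] finite_imageI finite_lessThan)
  also have "\<dots> \<le> (\<Sum>k\<in>\<sigma> ` {..<N}. K\<^sup>2 * (cmod (cinner x (\<phi> k)))\<^sup>2)"
  proof (rule sum_mono)
    fix k assume "k \<in> \<sigma> ` {..<N}"
    then have "\<bar>?c k\<bar> \<le> K" using K(1) by auto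
    then have "(cmod (complex_of_real (?c k) * cinner x (\<phi> k)))\<^sup>2 \<le> (K * cmod (cinner x (\<phi> k)))\<^sup>2"
      unfolding norm_mult norm_of_real by (intro power_mono mult_right_mono) auto
    then show "(cmod (complex_of_real (?c k) * cinner x (\<phi> k)))\<^sup>2 \<le> K\<^sup>2 * (cmod (cinner x (\<phi> k)))\<^sup>2"
      by (simp only: power_mult_distrib)
  qed
  also have "\<dots> = K\<^sup>2 * (\<Sum>k\<in>\<sigma> ` {..<N}. (cmod (cinner x (\<phi> k)))\<^sup>2)" by (simp add: sum_distrib_left)
  also have "\<dots> \<le> K\<^sup>2 * (\<Sum>k<Suc (Max (\<sigma> ` {..<N})). (cmod (cinner x (\<phi> k)))\<^sup>2)"
    by (intro mult_left_mono sum_mono2) (auto simp: less_Suc_eq_le)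
  also have "\<dots> \<le> K\<^sup>2 * (norm x)\<^sup>2" by (intro mult_left_mono bessel) auto
  finally show "(norm (rank_pert N (shift_vecs \<sigma> \<nu> \<nu>') (eig_vecs \<sigma>) x))\<^sup>2 \<le> (K * norm x)\<^sup>2"
    by (simp add: power_mult_distrib)
qed (use K in simp)

end

context perturbed_diagonal
begin

lemma perturbed_shift:
  assumes "bij_betw \<sigma> {..<M} {..<M}"
  shows "(\<lambda>x. perturbed M \<nu>' t x + rank_pert M (shift_vecs \<sigma> \<nu> \<nu>') (eig_vecs \<sigma>) x) = perturbed M \<nu> t"
proof
  fix x
  show "perturbed M \<nu>' t x + rank_pert M (shift_vecs \<sigma> \<nu> \<nu>') (eig_vecs \<sigma>) x = perturbed M \<nu> t x"
    unfolding perturbed_def using modified_shift[OF assms, of \<nu>' x \<nu>] by (simp add: algebra_simps)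
qed

lemma perturbed_original: "perturbed M \<mu> 1 = (\<lambda>x. T x + B x)"
  by (simp add: perturbed_def modified_def fun_eq_iff scaleC_one)

lemma norm_resolvent_le:
  assumes "admissible M \<nu> z d" "0 \<le> t" "t \<le> 1"
  shows "norm (resolvent D (perturbed M \<nu> t) z y) \<le> 2 / d * norm y"
  using perturbed_bounded_below[OF assms(1) resolvent_in[OF perturbed_resolvent[OF assms]] assms(2,3)]
  by (simp add: resolvent_right[OF perturbed_resolvent[OF assms]])

text \<open>The vector \<open>x\<close> is held fixed: its residual at a neighbouring parameter is
  linear in the two increments, with \<open>B\<close> evaluated at \<open>x\<close> alone, and the
  resolvents are uniformly bounded by \<open>2 / d\<close>.\<close>

lemma resolvent_jointly_continuous:
  assumes ad: "\<And>z. z \<in> V \<Longrightarrow> admissible M \<nu> z d"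
  shows "continuous_on ({0..1::real} \<times> V) (\<lambda>p. cinner (resolvent D (perturbed M \<nu> (fst p)) (snd p) y) g)"
  unfolding continuous_on_def
proof
  let ?S = "{0..1::real} \<times> V"
  let ?R = "\<lambda>q. resolvent D (perturbed M \<nu> (fst q)) (snd q) y"
  fix p assume p: "p \<in> ?S"
  then have p': "0 \<le> fst p" "fst p \<le> 1" "snd p \<in> V" by auto
  define x where "x = ?R p"
  have res: "snd q \<in> op_resolvent_set D (perturbed M \<nu> (fst q))" if "q \<in> ?S" for q
    using that by (intro perturbed_resolvent[OF ad]) auto
  have xD: "x \<in> D" unfolding x_def by (rule resolvent_in[OF res[OF p]])
  have est: "norm (?R q - x) \<le> 2 / d * (\<bar>fst p - fst q\<bar> * norm (B x) + cmod (snd q - snd p) * norm x)"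
    if q: "q \<in> ?S" for q
  proof -
    let ?w = "y - (perturbed M \<nu> (fst q) x - snd q *\<^sub>C x)"
    have q': "0 \<le> fst q" "fst q \<le> 1" "snd q \<in> V" using q by auto
    have "?w = (perturbed M \<nu> (fst p) x - snd p *\<^sub>C x) - (perturbed M \<nu> (fst q) x - snd q *\<^sub>C x)"
      using resolvent_right[OF res[OF p], of y] by (simp add: x_def)
    also have "\<dots> = complex_of_real (fst p - fst q) *\<^sub>C B x + (snd q - snd p) *\<^sub>C x"
      by (simp add: perturbed_def scaleC_algebra)
    finally have "norm ?w \<le> \<bar>fst p - fst q\<bar> * norm (B x) + cmod (snd q - snd p) * norm x"
      by (metis norm_of_real norm_scaleC norm_triangle_ineq)
    moreover have "?R q - x = resolvent D (perturbed M \<nu> (fst q)) (snd q) ?w"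
      unfolding resolvent_diff[OF linear_perturbed res[OF q], of y] resolvent_left[OF res[OF q] xD] ..
    then have "norm (?R q - x) \<le> 2 / d * norm ?w"
      using norm_resolvent_le[OF ad[OF q'(3)] q'(1,2)] by simp
    moreover have "d > 0" using ad[OF q'(3)] by (simp add: admissible_def)
    ultimately show ?thesis using mult_left_mono[of "norm ?w" _ "2 / d"] by (meson divide_nonneg_pos order_trans zero_le_numeral)
  qed
  have "((\<lambda>q. ?R q - x) \<longlongrightarrow> 0) (at p within ?S)"
  proof (rule Lim_null_comparison)
    show "eventually (\<lambda>q. norm (?R q - x)
        \<le> 2 / d * (\<bar>fst p - fst q\<bar> * norm (B x) + cmod (snd q - snd p) * norm x)) (at p within ?S)"
      using est by (auto simp: eventually_at_filter)
    have "((\<lambda>q. 2 / d * (\<bar>fst p - fst q\<bar> * norm (B x) + cmod (snd q - snd p) * norm x))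
        \<longlongrightarrow> 2 / d * (\<bar>fst p - fst p\<bar> * norm (B x) + cmod (snd p - snd p) * norm x)) (at p within ?S)"
      by (intro tendsto_intros)
    then show "((\<lambda>q. 2 / d * (\<bar>fst p - fst q\<bar> * norm (B x) + cmod (snd q - snd p) * norm x)) \<longlongrightarrow> 0) (at p within ?S)"
      by simp
  qed
  then have "((\<lambda>q. cinner (?R q) g) \<longlongrightarrow> cinner x g) (at p within ?S)"
    by (intro bounded_linear.tendsto[OF bounded_linear_cinner_left]) (simp add: LIM_zero_iff)
  then show "((\<lambda>q. cinner (?R q) g) \<longlongrightarrow> cinner (?R p) g) (at p within ?S)" by (simp add: x_def)
qed

definition block :: "(nat \<Rightarrow> nat) \<Rightarrow> nat \<Rightarrow> (nat \<Rightarrow> real) \<Rightarrow> (nat \<Rightarrow> real) \<Rightarrow> complex \<Rightarrow> nat \<Rightarrow> nat \<Rightarrow> complex" where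
  "block \<sigma> M \<nu> \<nu>' z i j = cinner (resolvent D (perturbed M \<nu>' 1) z (eig_vecs \<sigma> j)) (shift_vecs \<sigma> \<nu> \<nu>' i)"

text \<open>Where no eigenvalue moves, \<open>shift_vecs\<close> vanishes and the row is that of the
  identity. The factor 1 is the value at \<open>s = 1\<close> of the scaling in
  \<open>block_spectrum\<close>.\<close>

lemma pert_det_block:
  assumes "N \<le> M" and id: "\<And>i. N \<le> i \<Longrightarrow> i < M \<Longrightarrow> \<nu> (\<sigma> i) = \<nu>' (\<sigma> i)"
  shows "pert_det D (perturbed M \<nu>' 1) M (shift_vecs \<sigma> \<nu> \<nu>') (eig_vecs \<sigma>) z
    = det_fun N (\<lambda>i j. (if i = j then 1 else 0) + 1 * block \<sigma> M \<nu> \<nu>' z i j)"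
  unfolding pert_det_def pert_entry_def[abs_def] block_def mult_1
  by (rule det_fun_leading_block[OF assms(1)]) (simp add: shift_vecs_def id)

text \<open>An eigenvalue \<open>x\<close> of the block comes from \<open>v\<close> with \<open>(A' - z) v = y\<close> and \<open>(A - A') v = x y\<close>, so
  that \<open>(A' + s (A - A') - z) v = (1 + s x) y\<close>.\<close>

definition block_spectrum where
  "block_spectrum \<sigma> M \<nu> \<nu>' z N as \<longleftrightarrow> length as = N \<and>
     (\<forall>s. det_fun N (\<lambda>i j. (if i = j then 1 else 0) + s * block \<sigma> M \<nu> \<nu>' z i j) = (\<Prod>x\<leftarrow>as. 1 + s * x)) \<and>
     (\<forall>x\<in>set as. \<exists>y v. y \<noteq> 0 \<and> v \<in> D \<and> perturbed M \<nu>' 1 v - z *\<^sub>C v = y \<and>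
       rank_pert M (shift_vecs \<sigma> \<nu> \<nu>') (eig_vecs \<sigma>) v = x *\<^sub>C y)"

text \<open>An eigenvector \<open>c\<close> of the block gives \<open>y\<close>, the combination of
  the \<open>eig_vecs \<sigma> j\<close>, nonzero by orthonormality, and \<open>v\<close> is the
  resolvent applied to \<open>y\<close>. In this form the eigenvalue \<open>x\<close> can be
  estimated by operator norms.\<close>

lemma block_spectrum_exists:
  assumes bij: "bij_betw \<sigma> {..<M} {..<M}" and NM: "N \<le> M"
    and id: "\<And>i. N \<le> i \<Longrightarrow> i < M \<Longrightarrow> \<nu> (\<sigma> i) = \<nu>' (\<sigma> i)"
    and z: "z \<in> op_resolvent_set D (perturbed M \<nu>' 1)"
  shows "\<exists>as. block_spectrum \<sigma> M \<nu> \<nu>' z N as"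
proof -
  obtain as where as: "length as = N"
    "\<And>s. det_fun N (\<lambda>i j. (if i = j then 1 else 0) + s * block \<sigma> M \<nu> \<nu>' z i j) = (\<Prod>x\<leftarrow>as. 1 + s * x)"
    "\<And>x. x \<in> set as \<Longrightarrow> \<exists>c. (\<exists>i<N. c i \<noteq> 0) \<and> (\<forall>i<N. (\<Sum>j<N. block \<sigma> M \<nu> \<nu>' z i j * c j) = x * c i)"
    using det_fun_eigenvalues[of N "block \<sigma> M \<nu> \<nu>' z"] by blast
  have "\<exists>y v. y \<noteq> 0 \<and> v \<in> D \<and> perturbed M \<nu>' 1 v - z *\<^sub>C v = y \<and>
       rank_pert M (shift_vecs \<sigma> \<nu> \<nu>') (eig_vecs \<sigma>) v = x *\<^sub>C y" if x: "x \<in> set as" for x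
  proof -
    obtain c i0 where c: "i0 < N" "c i0 \<noteq> 0" "\<And>i. i < N \<Longrightarrow> (\<Sum>j<N. block \<sigma> M \<nu> \<nu>' z i j * c j) = x * c i"
      using as(3)[OF x] by blast
    define y where "y = (\<Sum>j<N. c j *\<^sub>C eig_vecs \<sigma> j)"
    define v where "v = resolvent D (perturbed M \<nu>' 1) z y"
    have inj: "inj_on \<sigma> {..<N}" using bij NM by (auto simp: bij_betw_def intro: inj_on_subset)
    have "cinner y (\<phi> (\<sigma> i0)) = (\<Sum>j<N. if j = i0 then c j else 0)"
      unfolding y_def cinner_sum_left eig_vecs_def
      using c(1) inj by (intro sum.cong) (auto simp: cinner_scaleC_left cinner_basis inj_on_def)
    then have y: "y \<noteq> 0" using c(1,2) by auto
    have v: "v \<in> D" unfolding v_def by (rule resolvent_in[OF z])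
    have coef: "cinner v (shift_vecs \<sigma> \<nu> \<nu>' i) = x * c i" if "i < N" for i
      unfolding v_def y_def resolvent_sum[OF linear_perturbed z] c(3)[OF that, symmetric] block_def
      by (simp add: cinner_sum_left cinner_scaleC_left mult.commute)
    have rank: "rank_pert M (shift_vecs \<sigma> \<nu> \<nu>') (eig_vecs \<sigma>) v
        = (\<Sum>i<N. cinner v (shift_vecs \<sigma> \<nu> \<nu>' i) *\<^sub>C eig_vecs \<sigma> i)"
      unfolding rank_pert_def using NM id
      by (intro sum.mono_neutral_right) (auto simp: shift_vecs_def)
    have "(\<Sum>i<N. cinner v (shift_vecs \<sigma> \<nu> \<nu>' i) *\<^sub>C eig_vecs \<sigma> i) = x *\<^sub>C y"
      unfolding y_def scaleC_sum_right by (intro sum.cong) (auto simp: coef scaleC_scaleC)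
    then have rank': "rank_pert M (shift_vecs \<sigma> \<nu> \<nu>') (eig_vecs \<sigma>) v = x *\<^sub>C y" using rank by simp
    have eq: "perturbed M \<nu>' 1 v - z *\<^sub>C v = y" unfolding v_def by (rule resolvent_right[OF z])
    show ?thesis using y v eq rank' by (intro exI[of _ y] exI[of _ v] conjI)
  qed
  then show ?thesis
    unfolding block_spectrum_def using as(1,2) by (intro exI[of _ as] conjI allI ballI)
qed

lemma rank_pert_interpolate:
  "rank_pert M (shift_vecs \<sigma> (\<lambda>k. (1 - s) * \<nu>' k + s * \<nu> k) \<nu>') (eig_vecs \<sigma>) v
    = complex_of_real s *\<^sub>C rank_pert M (shift_vecs \<sigma> \<nu> \<nu>') (eig_vecs \<sigma>) v"
proof -
  have "(1 - s) * \<nu>' k + s * \<nu> k - \<nu>' k = s * (\<nu> k - \<nu>' k)" for k by (simp add: algebra_simps)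
  then show ?thesis
    unfolding rank_pert_shift scaleC_sum_right by (simp add: scaleC_scaleC mult.assoc)
qed

lemma block_eigenvector_interpolate:
  assumes bij: "bij_betw \<sigma> {..<M} {..<M}"
    and v: "perturbed M \<nu>' 1 v - z *\<^sub>C v = y" "rank_pert M (shift_vecs \<sigma> \<nu> \<nu>') (eig_vecs \<sigma>) v = x *\<^sub>C y"
  shows "perturbed M (\<lambda>k. (1 - s) * \<nu>' k + s * \<nu> k) 1 v - z *\<^sub>C v = (1 + complex_of_real s * x) *\<^sub>C y"
proof -
  have "perturbed M (\<lambda>k. (1 - s) * \<nu>' k + s * \<nu> k) 1 v
      = perturbed M \<nu>' 1 v + complex_of_real s *\<^sub>C x *\<^sub>C y"
    unfolding perturbed_shift[OF bij, of \<nu>' 1 "\<lambda>k. (1 - s) * \<nu>' k + s * \<nu> k", symmetric]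
      rank_pert_interpolate v(2) ..
  then show ?thesis using v(1) by (simp add: scaleC_algebra scaleC_one algebra_simps)
qed

lemma modified_basis: "modified M \<nu> (\<phi> k) = complex_of_real (if k < M then \<nu> k else \<mu> k) *\<^sub>C \<phi> k"
proof -
  have "(\<Sum>j<M. (complex_of_real (\<nu> j - \<mu> j) * cinner (\<phi> k) (\<phi> j)) *\<^sub>C \<phi> j)
      = (\<Sum>j<M. if k = j then complex_of_real (\<nu> k - \<mu> k) *\<^sub>C \<phi> k else 0)"
    by (intro sum.cong) (auto simp: cinner_basis)
  then show ?thesis
    by (simp add: modified_def T_basis scaleC_add_left[symmetric])
qed

text \<open>Without \<open>B\<close> the resolvent acts on basis vectors by scalars, so the matrix
  is diagonal.\<close>

lemma pert_det_unperturbed: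
  assumes bij: "bij_betw \<sigma> {..<M} {..<M}" and ad: "admissible M \<nu>' z d"
  shows "pert_det D (perturbed M \<nu>' 0) M (shift_vecs \<sigma> \<nu> \<nu>') (eig_vecs \<sigma>) z
    = (\<Prod>k<M. (z - \<nu> k) * inverse (z - \<nu>' k))"
proof -
  have nz: "complex_of_real (\<nu>' k) - z \<noteq> 0" for k
    using ad unfolding admissible_def by (metis norm_zero not_le)
  have z: "z \<in> op_resolvent_set D (perturbed M \<nu>' 0)" using perturbed_resolvent[OF ad] by simp
  have R: "resolvent D (perturbed M \<nu>' 0) z (\<phi> k) = (1 / (complex_of_real (\<nu>' k) - z)) *\<^sub>C \<phi> k" for k
  proof (rule resolvent_eqI[OF z])
    let ?c = "1 / (complex_of_real (\<nu>' k) - z)"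
    have "(if k < M then \<nu>' k else \<mu> k) = \<nu>' k" using ad by (auto simp: admissible_def)
    then have "perturbed M \<nu>' 0 (?c *\<^sub>C \<phi> k) = ?c *\<^sub>C complex_of_real (\<nu>' k) *\<^sub>C \<phi> k"
      using linear_operatorD(3)[OF linear_modified[of M \<nu>'] basis_in_domain[of k], of ?c]
      by (simp add: perturbed_def modified_basis)
    then have "perturbed M \<nu>' 0 (?c *\<^sub>C \<phi> k) - z *\<^sub>C ?c *\<^sub>C \<phi> k
        = (?c * complex_of_real (\<nu>' k) - z * ?c) *\<^sub>C \<phi> k"
      by (simp only: scaleC_scaleC complex_vector.scale_left_diff_distrib)
    also have "?c * complex_of_real (\<nu>' k) - z * ?c = 1"
      using nz[of k] by (simp add: diff_divide_distrib[symmetric])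
    finally show "perturbed M \<nu>' 0 (?c *\<^sub>C \<phi> k) - z *\<^sub>C ?c *\<^sub>C \<phi> k = \<phi> k"
      by (simp only: scaleC_one)
  qed (simp add: basis_in_domain)
  have inj: "inj_on \<sigma> {..<M}" using bij by (simp add: bij_betw_def)
  have "pert_det D (perturbed M \<nu>' 0) M (shift_vecs \<sigma> \<nu> \<nu>') (eig_vecs \<sigma>) z
      = det_fun M (\<lambda>i j. if i = j then (z - \<nu> (\<sigma> i)) * inverse (z - \<nu>' (\<sigma> i)) else 0)"
    unfolding pert_det_def
  proof (rule det_fun_cong)
    fix i j assume ij: "i < M" "j < M"
    have "pert_entry D (perturbed M \<nu>' 0) (shift_vecs \<sigma> \<nu> \<nu>') (eig_vecs \<sigma>) z i j
        = (if i = j then 1 else 0) + (\<nu> (\<sigma> i) - \<nu>' (\<sigma> i)) * (1 / (\<nu>' (\<sigma> j) - z)) * (if \<sigma> j = \<sigma> i then 1 else 0)"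
      by (simp add: pert_entry_def eig_vecs_def shift_vecs_def R cinner_scaleC_left cinner_scaleC_right cinner_basis)
    moreover have "\<sigma> j = \<sigma> i \<longleftrightarrow> i = j" using inj ij by (auto simp: inj_on_def)
    moreover have "1 + (\<nu> (\<sigma> i) - \<nu>' (\<sigma> i)) * (1 / (\<nu>' (\<sigma> i) - z)) = (z - \<nu> (\<sigma> i)) * inverse (z - \<nu>' (\<sigma> i))"
    proof -
      have "z - \<nu>' (\<sigma> i) \<noteq> 0" using nz[of "\<sigma> i"] by auto
      then show ?thesis using nz[of "\<sigma> i"] by (simp add: divide_simps) (simp add: algebra_simps)
    qed
    ultimately show "pert_entry D (perturbed M \<nu>' 0) (shift_vecs \<sigma> \<nu> \<nu>') (eig_vecs \<sigma>) z i j
        = (if i = j then (z - \<nu> (\<sigma> i)) * inverse (z - \<nu>' (\<sigma> i)) else 0)" by (cases "i = j") auto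
  qed
  also have "\<dots> = (\<Prod>i<M. (z - \<nu> (\<sigma> i)) * inverse (z - \<nu>' (\<sigma> i)))" by (rule det_fun_diagonal)
  also have "\<dots> = (\<Prod>k<M. (z - \<nu> k) * inverse (z - \<nu>' k))" by (rule prod.reindex_bij_betw[OF bij])
  finally show ?thesis .
qed

end

lemma enumeration_with_initial_segment:
  assumes "J \<subseteq> {..<M::nat}"
  obtains \<sigma> where "bij_betw \<sigma> {..<M} {..<M}" "\<sigma> ` {..<card J} = J"
proof -
  define xs where "xs = sorted_list_of_set J @ sorted_list_of_set ({..<M} - J)"
  have fin: "finite J" using assms finite_subset by blast
  have set: "set xs = {..<M}" using assms fin by (auto simp: xs_def)
  have dist: "distinct xs" using fin by (auto simp: xs_def)
  have len: "length xs = M" using distinct_card[OF dist] set by simp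
  have "(!) xs ` {..<card J} = (!) (sorted_list_of_set J) ` {..<length (sorted_list_of_set J)}"
    by (auto simp: xs_def nth_append intro!: image_cong)
  also have "\<dots> = set (sorted_list_of_set J)" by (auto simp: set_conv_nth)
  finally have "(!) xs ` {..<card J} = J" using fin by simp
  moreover have "bij_betw ((!) xs) {..<M} {..<M}" using bij_betw_nth[OF dist _ set[symmetric]] len by simp
  ultimately show thesis using that by blast
qed

section \<open>The reference operator without spectrum in a disc, and the scale
  \<open>g\<close>\<close>

locale noncondensing_perturbation = perturbed_diagonal +
  fixes \<alpha> \<beta> \<gamma> b :: real and l :: nat
  assumes \<mu>_gt_1: "\<And>k. \<mu> k > 1" and \<mu>_mono: "mono \<mu>" and \<alpha>_pos: "\<alpha> > 0"
    and l: "\<And>s. s > 0 \<Longrightarrow> finite {k. \<mu> k powr \<alpha> \<in> {s<..s + 1}} \<and> card {k. \<mu> k powr \<alpha> \<in> {s<..s + 1}} \<le> l"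
    and b_pos: "b > 0" and B_bound: "\<And>k. norm (B (\<phi> k)) \<le> b * \<mu> k powr \<beta>"
    and \<gamma>: "\<gamma> \<ge> 0" "\<gamma> \<ge> \<beta>" "\<gamma> \<ge> 2 * \<beta> + \<alpha> - 1" "\<gamma> < 1"
begin

lemma summable_powers: "summable (\<lambda>k. \<mu> k powr (2 * \<beta> - 2))"
  using \<gamma> by (intro summable_\<mu>[OF \<mu>_gt_1 \<alpha>_pos l]) auto

text \<open>For a monotone sequence, infinitely many members below \<open>r\<close> means all
  members, and then the terms of the convergent series stay away from zero.\<close>

lemma finite_below: "finite {k. \<mu> k < r}"
proof (rule ccontr)
  assume inf: "infinite {k. \<mu> k < r}"
  have below: "\<mu> k < r" for k
  proof -
    obtain j where "j \<ge> k" "\<mu> j < r" using inf unfolding infinite_nat_iff_unbounded_le by blast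
    then show ?thesis using monoD[OF \<mu>_mono, of k j] by linarith
  qed
  have r: "r > 1" using below[of 0] \<mu>_gt_1[of 0] by linarith
  have "(\<lambda>k. \<mu> k powr (2 * \<beta> - 2)) \<longlonglongrightarrow> 0" by (rule summable_LIMSEQ_zero[OF summable_powers])
  moreover have "r powr (2 * \<beta> - 2) \<le> \<mu> k powr (2 * \<beta> - 2)" for k
    using below[of k] \<mu>_gt_1[of k] \<gamma> by (intro powr_mono2') auto
  ultimately have "r powr (2 * \<beta> - 2) \<le> 0" by (intro LIMSEQ_le_const) auto
  then show False using r by simp
qed

lemma eventually_above: "\<exists>m. \<forall>k\<ge>m. \<mu> k \<ge> r"
proof -
  have "{k. \<mu> k < r} \<noteq> UNIV" using finite_below[of r] by (metis infinite_UNIV_nat)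
  then obtain m where "\<not> \<mu> m < r" by blast
  then have m: "r \<le> \<mu> m" by simp
  have "r \<le> \<mu> k" if "k \<ge> m" for k using m monoD[OF \<mu>_mono that] by simp
  then show ?thesis by blast
qed

lemma count_below_mono: "r \<le> s \<Longrightarrow> count_below \<mu> r \<le> count_below \<mu> s"
  unfolding count_below_def by (intro card_mono finite_below) auto

definition far :: "nat \<Rightarrow> real \<Rightarrow> nat \<Rightarrow> real" where
  "far M S k = (if k < M then S else \<mu> k)"

text \<open>The cutoff \<open>M\<close> brings the tail of the Hilbert-Schmidt sum below 1/8; there
  \<open>\<mu> k \<ge> 2 * R\<close> makes the distance at least \<open>\<mu> k / 2\<close>, whence
  the factor 4. Only then is \<open>S\<close> chosen, at distance at least \<open>1 + 8 * Q\<close>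
  from the disc, so that the first \<open>M\<close> terms contribute at most
  \<open>Q / (1 + 8 * Q) \<le> 1/8\<close>.\<close>

lemma far_admissible:
  assumes R: "R > 1"
  obtains M S where "\<And>k. k \<ge> M \<Longrightarrow> \<mu> k \<ge> 2 * R" "S > R"
    "\<And>z. z \<in> ball 0 R \<Longrightarrow> admissible M (far M S) z 1"
proof -
  have "summable (\<lambda>k. 4 * b\<^sup>2 * \<mu> k powr (2 * \<beta> - 2))" by (rule summable_mult[OF summable_powers])
  then obtain M1 where M1: "\<And>m n. m \<ge> M1 \<Longrightarrow> norm (\<Sum>k=m..<n. 4 * b\<^sup>2 * \<mu> k powr (2 * \<beta> - 2)) < 1/8"
    unfolding summable_Cauchy by (metis zero_less_divide_1_iff zero_less_numeral)
  obtain M2 where M2: "\<And>k. k \<ge> M2 \<Longrightarrow> \<mu> k \<ge> 2 * R" using eventually_above by blast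
  define M where "M = max M1 M2"
  define Q where "Q = (\<Sum>k<M. (norm (B (\<phi> k)))\<^sup>2)"
  have Q: "Q \<ge> 0" by (auto simp: Q_def intro: sum_nonneg)
  define S where "S = R + 1 + 8 * Q"
  have above: "\<mu> k \<ge> 2 * R" if "k \<ge> M" for k using M2 that by (simp add: M_def)
  have SR: "S > R" using Q by (simp add: S_def)
  have adm: "admissible M (far M S) z 1" if z: "z \<in> ball 0 R" for z
    unfolding admissible_def
  proof (intro conjI allI impI)
    have zR: "cmod z < R" using z by simp
    have low: "cmod (complex_of_real x - z) \<ge> \<bar>x\<bar> - R" for x
      using norm_triangle_ineq2[of "complex_of_real x" z] zR by simp
    have head: "cmod (complex_of_real (far M S k) - z) \<ge> 1 + 8 * Q" if "k < M" for k
      using low[of S] that R Q by (simp add: far_def S_def)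
    have tail: "cmod (complex_of_real (far M S k) - z) \<ge> \<mu> k / 2" if "k \<ge> M" for k
      using low[of "\<mu> k"] that above[OF that] R by (simp add: far_def)
    show "1 \<le> cmod (complex_of_real (far M S k) - z)" for k
      using head[of k] tail[of k] above[of k] R Q by (cases "k < M") auto
    fix n
    let ?t = "\<lambda>k. (norm (B (\<phi> k)) / cmod (complex_of_real (far M S k) - z))\<^sup>2"
    have "(\<Sum>k<n. ?t k) \<le> (\<Sum>k<max M n. ?t k)" by (intro sum_mono2) auto
    also have "{..<max M n} = {..<M} \<union> {M..<max M n}" by auto
    also have "(\<Sum>k\<in>{..<M} \<union> {M..<max M n}. ?t k) = (\<Sum>k<M. ?t k) + (\<Sum>k=M..<max M n. ?t k)"
      by (rule sum.union_disjoint) auto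
    also have "(\<Sum>k<M. ?t k) \<le> (\<Sum>k<M. (norm (B (\<phi> k)))\<^sup>2 / (1 + 8 * Q))"
    proof (rule sum_mono)
      fix k assume k: "k \<in> {..<M}"
      have "1 + 8 * Q \<le> (1 + 8 * Q)\<^sup>2" using Q by (simp add: power2_eq_square)
      also have "\<dots> \<le> (cmod (complex_of_real (far M S k) - z))\<^sup>2"
        using head[of k] k Q by (intro power_mono) auto
      finally show "?t k \<le> (norm (B (\<phi> k)))\<^sup>2 / (1 + 8 * Q)"
        unfolding power_divide using Q by (intro divide_left_mono mult_pos_pos) auto
    qed
    also have "\<dots> = Q / (1 + 8 * Q)" by (simp add: Q_def sum_divide_distrib)
    also have "\<dots> \<le> 1/8" using Q by (simp add: field_simps)
    also have "(\<Sum>k=M..<max M n. ?t k) \<le> (\<Sum>k=M..<max M n. 4 * b\<^sup>2 * \<mu> k powr (2 * \<beta> - 2))"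
    proof (rule sum_mono)
      fix k assume k: "k \<in> {M..<max M n}"
      have pos: "\<mu> k > 0" using \<mu>_gt_1[of k] by linarith
      have "norm (B (\<phi> k)) / cmod (complex_of_real (far M S k) - z) \<le> (b * \<mu> k powr \<beta>) / (\<mu> k / 2)"
        using tail[of k] k pos b_pos by (intro frac_le B_bound) auto
      then have "?t k \<le> ((b * \<mu> k powr \<beta>) / (\<mu> k / 2))\<^sup>2" by (intro power_mono) auto
      also have "\<dots> = 4 * b\<^sup>2 * ((\<mu> k powr \<beta>)\<^sup>2 / (\<mu> k)\<^sup>2)" by (simp add: power_divide power_mult_distrib)
      also have "(\<mu> k powr \<beta>)\<^sup>2 / (\<mu> k)\<^sup>2 = \<mu> k powr (2 * \<beta> - 2)"
      proof -
        have "(\<mu> k powr \<beta>)\<^sup>2 = \<mu> k powr (\<beta> + \<beta>)" by (simp only: power2_eq_square powr_add)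
        then show ?thesis using pos by (simp add: powr_diff powr_numeral)
      qed
      finally show "?t k \<le> 4 * b\<^sup>2 * \<mu> k powr (2 * \<beta> - 2)" .
    qed
    also have "\<dots> \<le> 1/8" using M1[of M "max M n"] by (simp add: M_def)
    finally show "(\<Sum>k<n. ?t k) \<le> 1/4" by simp
  qed (auto simp: far_def)
  show thesis by (rule that[OF above SR adm])
qed

text \<open>At the scale \<open>g = c * r powr \<gamma>\<close> a spectral gap of size \<open>g\<close> near \<open>r\<close> suffices for admissibility,
  even after moving eigenvalues by up to \<open>200 * g\<close>.\<close>

definition good_scale :: "real \<Rightarrow> real \<Rightarrow> bool" where
  "good_scale r g \<longleftrightarrow> r \<ge> 1 \<and> g > 0 \<and> 1000 * g \<le> r \<and>
    (\<forall>M \<nu> z d. (\<forall>k\<ge>M. \<nu> k = \<mu> k) \<longrightarrow> (\<forall>k. \<bar>\<nu> k - \<mu> k\<bar> \<le> 200 * g) \<longrightarrow> \<bar>cmod z - r\<bar> \<le> 100 * g \<longrightarrow>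
      g \<le> d \<longrightarrow> (\<forall>k. d \<le> cmod (complex_of_real (\<nu> k) - z)) \<longrightarrow> admissible M \<nu> z d)"

lemma good_scale_admissible:
  assumes "good_scale r g" "\<And>k. k \<ge> M \<Longrightarrow> \<nu> k = \<mu> k" "\<And>k. \<bar>\<nu> k - \<mu> k\<bar> \<le> 200 * g" "\<bar>cmod z - r\<bar> \<le> 100 * g"
    "g \<le> d" "\<And>k. d \<le> cmod (complex_of_real (\<nu> k) - z)"
  shows "admissible M \<nu> z d"
  using assms unfolding good_scale_def by blast

lemma good_scale_exists: "\<exists>c>0. \<exists>r0\<ge>1. \<forall>r\<ge>r0. good_scale r (c * r powr \<gamma>)"
proof -
  \<comment> \<open>The 400 absorbs all displacements: \<open>\<bar>\<mu> k - r\<bar> + g\<close> is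
    at most \<open>301 * g\<close> plus the distance of \<open>\<nu> k\<close> to \<open>z\<close>,
    hence at most 302 times that distance.\<close>
  define \<epsilon> where "\<epsilon> = 1 / (4 * (400 * b)\<^sup>2)"
  have \<epsilon>: "\<epsilon> > 0" using b_pos by (simp add: \<epsilon>_def)
  obtain c r1 where c: "c > 0" "r1 \<ge> 1"
    "\<And>r n. r \<ge> r1 \<Longrightarrow> (\<Sum>k<n. \<mu> k powr (2 * \<beta>) / (\<bar>\<mu> k - r\<bar> + c * r powr \<gamma>)\<^sup>2) \<le> \<epsilon>"
    using resolvent_sum_small[OF \<mu>_gt_1 \<alpha>_pos l _ \<gamma>(2,3) \<epsilon>] \<gamma> by force
  \<comment> \<open>From this radius on \<open>1000 * g \<le> r\<close>; here
    \<open>\<gamma> < 1\<close> enters.\<close>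
  define r0 where "r0 = max r1 ((1000 * c) powr (1 / (1 - \<gamma>)))"
  have "good_scale r (c * r powr \<gamma>)" if r: "r \<ge> r0" for r
  proof -
    define g where "g = c * r powr \<gamma>"
    have r1: "r \<ge> r1" "r \<ge> 1" using r c(2) by (auto simp: r0_def)
    have g: "g > 0" using c(1) r1 by (simp add: g_def)
    have "1000 * c = ((1000 * c) powr (1 / (1 - \<gamma>))) powr (1 - \<gamma>)"
      using \<gamma> c(1) by (simp add: powr_powr)
    also have "\<dots> \<le> r powr (1 - \<gamma>)" using r \<gamma> by (intro powr_mono2) (auto simp: r0_def)
    finally have "1000 * c * r powr \<gamma> \<le> r powr (1 - \<gamma>) * r powr \<gamma>" by (intro mult_right_mono) auto
    also have "\<dots> = r" using r1 by (simp flip: powr_add)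
    finally have small: "1000 * g \<le> r" by (simp add: g_def)
    have "admissible M \<nu> z d"
      if h: "\<forall>k\<ge>M. \<nu> k = \<mu> k" "\<forall>k. \<bar>\<nu> k - \<mu> k\<bar> \<le> 200 * g" "\<bar>cmod z - r\<bar> \<le> 100 * g"
        "g \<le> d" "\<forall>k. d \<le> cmod (complex_of_real (\<nu> k) - z)" for M \<nu> z d
      unfolding admissible_def
    proof (intro conjI allI impI)
      show "0 < d" using h(4) g by linarith
      fix n
      have "(norm (B (\<phi> k)) / cmod (complex_of_real (\<nu> k) - z))\<^sup>2
          \<le> (400 * b)\<^sup>2 * (\<mu> k powr (2 * \<beta>) / (\<bar>\<mu> k - r\<bar> + g)\<^sup>2)" for k
      proof -
        have dk: "g \<le> cmod (complex_of_real (\<nu> k) - z)" using h(4,5) order_trans by blast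
        have "\<bar>\<nu> k\<bar> - cmod z \<le> cmod (complex_of_real (\<nu> k) - z)" "cmod z - \<bar>\<nu> k\<bar> \<le> cmod (complex_of_real (\<nu> k) - z)"
          using norm_triangle_ineq2[of "complex_of_real (\<nu> k)" z] norm_triangle_ineq2[of z "complex_of_real (\<nu> k)"]
          by (simp_all add: norm_minus_commute)
        moreover have "\<bar>\<nu> k - \<mu> k\<bar> \<le> 200 * g" "\<mu> k > 0" using h(2) \<mu>_gt_1[of k] by auto
        ultimately have "\<bar>\<mu> k - r\<bar> + g \<le> 400 * cmod (complex_of_real (\<nu> k) - z)"
          using h(3) dk by linarith
        moreover have "\<bar>\<mu> k - r\<bar> + g > 0" using g by simp
        ultimately have "norm (B (\<phi> k)) / cmod (complex_of_real (\<nu> k) - z) \<le> (b * \<mu> k powr \<beta>) / ((\<bar>\<mu> k - r\<bar> + g) / 400)"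
          using b_pos by (intro frac_le B_bound) auto
        then have "(norm (B (\<phi> k)) / cmod (complex_of_real (\<nu> k) - z))\<^sup>2
            \<le> ((b * \<mu> k powr \<beta>) / ((\<bar>\<mu> k - r\<bar> + g) / 400))\<^sup>2" by (intro power_mono) auto
        also have "\<dots> = (400 * b)\<^sup>2 * ((\<mu> k powr \<beta>)\<^sup>2 / (\<bar>\<mu> k - r\<bar> + g)\<^sup>2)"
          by (simp add: power_divide power_mult_distrib)
        also have "(\<mu> k powr \<beta>)\<^sup>2 = \<mu> k powr (\<beta> + \<beta>)" by (simp only: power2_eq_square powr_add)
        also have "\<beta> + \<beta> = 2 * \<beta>" by simp
        finally show ?thesis .
      qed
      then have "(\<Sum>k<n. (norm (B (\<phi> k)) / cmod (complex_of_real (\<nu> k) - z))\<^sup>2)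
          \<le> (\<Sum>k<n. (400 * b)\<^sup>2 * (\<mu> k powr (2 * \<beta>) / (\<bar>\<mu> k - r\<bar> + g)\<^sup>2))" by (rule sum_mono)
      also have "\<dots> = (400 * b)\<^sup>2 * (\<Sum>k<n. \<mu> k powr (2 * \<beta>) / (\<bar>\<mu> k - r\<bar> + g)\<^sup>2)"
        by (simp only: sum_distrib_left)
      also have "\<dots> \<le> (400 * b)\<^sup>2 * \<epsilon>"
        using c(3)[OF r1(1)] unfolding g_def by (intro mult_left_mono) auto
      also have "\<dots> = 1/4" using b_pos by (simp add: \<epsilon>_def)
      finally show "(\<Sum>k<n. (norm (B (\<phi> k)) / cmod (complex_of_real (\<nu> k) - z))\<^sup>2) \<le> 1/4" .
    qed (use h in auto)
    then show ?thesis unfolding good_scale_def g_def[symmetric] using r1 g small by blast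
  qed
  then show ?thesis using c(1,2) by (intro exI[of _ c] conjI exI[of _ r0]) (auto simp: r0_def)
qed

text \<open>The point \<open>- r\<close> shows that the determinant does not vanish identically: its
  distance to the positive spectrum of \<open>T\<close> exceeds \<open>r\<close>, so it is in the
  resolvent set of \<open>A\<close>.\<close>

lemma ball_facts:
  assumes good: "good_scale r g" and MS: "S > 2 * r" "\<And>z. z \<in> ball 0 (2 * r) \<Longrightarrow> admissible M (far M S) z 1"
    and bij: "bij_betw \<sigma> {..<M} {..<M}"
  shows "ball 0 (2 * r) \<subseteq> op_resolvent_set D (perturbed M (far M S) 1)"
    and "\<exists>w\<in>ball 0 (2 * r). pert_det D (perturbed M (far M S) 1) M (shift_vecs \<sigma> \<mu> (far M S)) (eig_vecs \<sigma>) w \<noteq> 0"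
proof -
  show res: "ball 0 (2 * r) \<subseteq> op_resolvent_set D (perturbed M (far M S) 1)"
    using MS(2) by (auto intro!: perturbed_resolvent)
  have r: "r \<ge> 1" "g > 0" "1000 * g \<le> r" using good by (auto simp: good_scale_def)
  define w where "w = complex_of_real (- r)"
  have w: "w \<in> ball 0 (2 * r)" using r by (simp add: w_def)
  have "admissible M \<mu> w g"
  proof (rule good_scale_admissible[OF good])
    fix k
    have "complex_of_real (\<mu> k) - w = complex_of_real (\<mu> k + r)" by (simp add: w_def)
    then have "cmod (complex_of_real (\<mu> k) - w) = \<mu> k + r"
      using \<mu>_gt_1[of k] r by (simp only: norm_of_real)
    then show "g \<le> cmod (complex_of_real (\<mu> k) - w)" using \<mu>_gt_1[of k] r by linarith
  qed (use r in \<open>auto simp: w_def\<close>)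
  then have "w \<in> op_resolvent_set D (perturbed M \<mu> 1)" by (intro perturbed_resolvent) auto
  then have "pert_det D (perturbed M (far M S) 1) M (shift_vecs \<sigma> \<mu> (far M S)) (eig_vecs \<sigma>) w \<noteq> 0"
    using pert_spectrum_iff(1)[OF linear_perturbed, of w M "far M S" 1 M "shift_vecs \<sigma> \<mu> (far M S)" "eig_vecs \<sigma>"]
      res w unfolding perturbed_shift[OF bij] op_spectrum_def by blast
  with w show "\<exists>w\<in>ball 0 (2 * r). pert_det D (perturbed M (far M S) 1) M (shift_vecs \<sigma> \<mu> (far M S)) (eig_vecs \<sigma>) w \<noteq> 0"
    by blast
qed

text \<open>Discreteness is local, and each \<open>z\<close> lies in a disc of radius
  \<open>2 * r\<close> for a sufficiently large \<open>r\<close>.\<close>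

lemma discrete: "discrete_spectrum D (\<lambda>x. T x + B x)"
proof -
  obtain c r0 where c: "r0 \<ge> 1" "\<And>r. r \<ge> r0 \<Longrightarrow> good_scale r (c * r powr \<gamma>)"
    using good_scale_exists by blast
  have "\<not> z islimpt op_spectrum D (\<lambda>x. T x + B x) \<and> (z \<in> op_spectrum D (\<lambda>x. T x + B x) \<longrightarrow>
      op_eigenvalue D (\<lambda>x. T x + B x) z \<and> (\<exists>F. finite F \<and> root_space D (\<lambda>x. T x + B x) z \<subseteq> complex_vector.span F))" for z
  proof -
    define r where "r = max r0 (cmod z)"
    have good: "good_scale r (c * r powr \<gamma>)" by (rule c(2)) (simp add: r_def)
    have r: "r \<ge> 1" using c(1) by (simp add: r_def)
    then have r2: "2 * r > 1" by simp
    obtain M S where "\<And>k. k \<ge> M \<Longrightarrow> \<mu> k \<ge> 2 * (2 * r)" and MS: "S > 2 * r" "\<And>z. z \<in> ball 0 (2 * r) \<Longrightarrow> admissible M (far M S) z 1"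
      by (rule far_admissible[OF r2], rule that)
    have bij: "bij_betw id {..<M} {..<M}" by simp
    have z: "z \<in> ball 0 (2 * r)" using r by (auto simp: r_def)
    note pd = pert_discrete[OF linear_perturbed ball_facts[OF good MS bij] z, unfolded perturbed_shift[OF bij] perturbed_original]
    show ?thesis using pd by blast
  qed
  then show ?thesis unfolding discrete_spectrum_def by blast
qed

end

section \<open>Comparison of \<open>A\<close> with the operator that has a spectral gap\<close>

lemma norm_prod_list_le:
  fixes f :: "'b \<Rightarrow> complex"
  assumes "\<And>x. x \<in> set xs \<Longrightarrow> cmod (f x) \<le> K" "K \<ge> 0"
  shows "cmod (\<Prod>x\<leftarrow>xs. f x) \<le> K ^ length xs"
  using assms(1) by (induction xs) (auto simp: norm_mult intro!: mult_mono assms(2))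

lemma norm_prod_list_ge:
  fixes f :: "'b \<Rightarrow> complex"
  assumes "\<And>x. x \<in> set xs \<Longrightarrow> K \<le> cmod (f x)" "K \<ge> 0"
  shows "K ^ length xs \<le> cmod (\<Prod>x\<leftarrow>xs. f x)"
  using assms(1) by (induction xs) (auto simp: norm_mult intro!: mult_mono zero_le_power assms(2))

context noncondensing_perturbation
begin

text \<open>The window is closed on the left and open on the right to match the strict inequality in
  \<open>count_below\<close>: the number of moved eigenvalues is a difference of two of its
  values.\<close>

definition moved :: "real \<Rightarrow> real \<Rightarrow> nat \<Rightarrow> real" where
  "moved r g k = (if r - 100 * g \<le> \<mu> k \<and> \<mu> k < r + 100 * g then r + 100 * g else \<mu> k)"

context
  fixes r g \<rho> S :: real and M N :: nat and \<sigma> :: "nat \<Rightarrow> nat"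
  assumes good: "good_scale r g" and \<rho>: "r - g < \<rho>" "\<rho> \<le> r"
    and M: "\<And>k. k \<ge> M \<Longrightarrow> \<mu> k \<ge> 2 * (2 * r)" and S: "S > 2 * r"
    and far_ad: "\<And>z. z \<in> ball 0 (2 * r) \<Longrightarrow> admissible M (far M S) z 1"
    and bij: "bij_betw \<sigma> {..<M} {..<M}" and NM: "N \<le> M"
    and \<sigma>N: "\<And>i. i < M \<Longrightarrow> i < N \<longleftrightarrow> r - 100 * g \<le> \<mu> (\<sigma> i) \<and> \<mu> (\<sigma> i) < r + 100 * g"
    and no_spectrum: "\<And>z. cmod z = \<rho> \<Longrightarrow> z \<notin> op_spectrum D (\<lambda>x. T x + B x)"
begin

lemma scale: "r \<ge> 1" "g > 0" "1000 * g \<le> r"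
  using good by (auto simp: good_scale_def)

lemma \<rho>_pos: "\<rho> > 0" "\<rho> < 2 * r" "999 * g < \<rho>"
  using \<rho> scale by linarith+

lemma moved_facts:
  "k \<ge> M \<Longrightarrow> moved r g k = \<mu> k" "\<bar>moved r g k - \<mu> k\<bar> \<le> 200 * g" "100 * g \<le> \<bar>moved r g k - r\<bar>"
  "moved r g k \<ge> 1"
  using M[of k] scale \<mu>_gt_1[of k] by (auto simp: moved_def)

text \<open>Of the half-width \<open>100 * g\<close> of the gap at least \<open>55 * g\<close>
  remains.\<close>

lemma moved_admissible:
  assumes "\<bar>cmod z - r\<bar> \<le> 45 * g" shows "admissible M (moved r g) z (50 * g)"
proof (rule good_scale_admissible[OF good moved_facts(1,2)])
  fix k
  have "\<bar>moved r g k - cmod z\<bar> \<le> cmod (complex_of_real (moved r g k) - z)"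
    using norm_triangle_ineq3[of "complex_of_real (moved r g k)" z] moved_facts(4)[of k] by simp
  then show "50 * g \<le> cmod (complex_of_real (moved r g k) - z)"
    using moved_facts(3)[of k] assms scale by linarith
qed (use assms scale in auto)

text \<open>The angle at which the circle has height \<open>2 * g\<close> over the real axis. Beyond
  it, points of the circle keep away from all nonnegative reals without any gap.\<close>

definition gap_angle where "gap_angle = arcsin (2 * g / \<rho>)"

lemma gap_angle_facts: "0 < gap_angle" "gap_angle \<le> pi / 2" "\<rho> * sin gap_angle = 2 * g"
proof -
  have q: "0 < 2 * g / \<rho>" "2 * g / \<rho> \<le> 1" using \<rho>_pos scale by (auto simp: field_simps)
  then have "arcsin 0 < gap_angle" unfolding gap_angle_def by (intro arcsin_less_arcsin) auto
  then show "0 < gap_angle" by simp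
  show "gap_angle \<le> pi / 2" unfolding gap_angle_def using q by (intro arcsin_ubound) auto
  show "\<rho> * sin gap_angle = 2 * g" unfolding gap_angle_def using q \<rho>_pos by (subst sin_arcsin) auto
qed

text \<open>In the right half plane the imaginary part alone suffices; for a point in the left half
  plane no nonnegative real is closer than the origin, which is at distance
  \<open>\<rho>\<close>.\<close>

lemma distance_off_axis:
  assumes u: "gap_angle \<le> \<bar>u\<bar>" "\<bar>u\<bar> \<le> pi" and \<nu>: "\<nu> \<ge> 0"
  shows "g \<le> cmod (complex_of_real \<nu> - circle_point \<rho> u)"
proof (cases "\<bar>u\<bar> \<le> pi / 2")
  case True
  have "sin gap_angle \<le> sin \<bar>u\<bar>" using gap_angle_facts u True by (intro sin_monotone_2pi_le) auto
  also have "sin \<bar>u\<bar> \<le> \<bar>sin u\<bar>" by (cases "u \<ge> 0") auto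
  finally have "2 * g \<le> \<rho> * \<bar>sin u\<bar>" using gap_angle_facts(3) \<rho>_pos by (metis less_imp_le mult_left_mono)
  also have "\<dots> = \<bar>Im (complex_of_real \<nu> - circle_point \<rho> u)\<bar>"
    using \<rho>_pos by (simp add: circle_point_def abs_mult)
  also have "\<dots> \<le> cmod (complex_of_real \<nu> - circle_point \<rho> u)" by (rule abs_Im_le_cmod)
  finally show ?thesis using scale by linarith
next
  case False
  have "cos \<bar>u\<bar> \<le> cos (pi / 2)" using False u by (intro cos_monotone_0_pi_le) auto
  then have "cos u \<le> 0" by simp
  then have c: "0 \<le> - (\<rho> * cos u)" using \<rho>_pos by (simp add: mult_nonneg_nonpos)
  have "\<rho>\<^sup>2 = (- (\<rho> * cos u))\<^sup>2 + (\<rho> * sin u)\<^sup>2"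
    by (simp add: power_mult_distrib distrib_left[symmetric] add.commute)
  also have "\<dots> \<le> (\<nu> - \<rho> * cos u)\<^sup>2 + (\<rho> * sin u)\<^sup>2"
    using c \<nu> by (intro add_right_mono power_mono) auto
  also have "\<dots> = (cmod (complex_of_real \<nu> - circle_point \<rho> u))\<^sup>2"
    by (simp add: cmod_power2 circle_point_def)
  finally have "\<rho> \<le> cmod (complex_of_real \<nu> - circle_point \<rho> u)" by (rule power2_le_imp_le) simp
  then show ?thesis using \<rho>_pos scale by linarith
qed

lemma circle_moved_admissible: "admissible M (moved r g) z (50 * g)" if "cmod z = \<rho>"
  by (rule moved_admissible) (use that \<rho> scale in auto)

text \<open>Intermediate diagonals may have entries anywhere in the window, so the gap is lost; the
  distance to the real half line replaces it.\<close>

lemma interpolated_admissible: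
  assumes u: "gap_angle \<le> \<bar>u\<bar>" "\<bar>u\<bar> \<le> pi" and s: "0 \<le> s" "s \<le> 1"
  shows "admissible M (\<lambda>k. (1 - s) * moved r g k + s * \<mu> k) (circle_point \<rho> u) g"
proof (rule good_scale_admissible[OF good])
  fix k
  show "(1 - s) * moved r g k + s * \<mu> k = \<mu> k" if "k \<ge> M"
    using moved_facts(1)[OF that] by (simp add: algebra_simps)
  have "(1 - s) * moved r g k + s * \<mu> k - \<mu> k = (1 - s) * (moved r g k - \<mu> k)"
    by (simp add: algebra_simps)
  also have "\<bar>\<dots>\<bar> \<le> 1 * \<bar>moved r g k - \<mu> k\<bar>" unfolding abs_mult using s by (intro mult_right_mono) auto
  also have "\<dots> \<le> 200 * g" using moved_facts(2)[of k] by simp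
  finally show "\<bar>(1 - s) * moved r g k + s * \<mu> k - \<mu> k\<bar> \<le> 200 * g" .
  have "0 \<le> (1 - s) * moved r g k + s * \<mu> k"
    using s moved_facts(4)[of k] \<mu>_gt_1[of k] by (intro add_nonneg_nonneg mult_nonneg_nonneg) auto
  then show "g \<le> cmod (complex_of_real ((1 - s) * moved r g k + s * \<mu> k) - circle_point \<rho> u)"
    by (rule distance_off_axis[OF u])
qed (use \<rho> \<rho>_pos scale in \<open>auto simp: norm_circle_point\<close>)

text \<open>The gap keeps the circle in the resolvent set for every \<open>t\<close>, which reduces
  the claim to the explicit product at \<open>t = 0\<close>. There an entry of \<open>moved\<close>
  inside the circle contributes \<open>2 * pi\<close>, one outside nothing, and the poles at
  \<open>S\<close> lie outside. Inside are exactly the eigenvalues below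
  \<open>r - 100 * g\<close>.\<close>

lemma arg_change_moved:
  "arg_change (\<lambda>u. pert_det D (perturbed M (far M S) 1) M (shift_vecs \<sigma> (moved r g) (far M S)) (eig_vecs \<sigma>)
     (circle_point \<rho> u)) (- pi) pi (2 * pi * count_below \<mu> (r - 100 * g))"
proof -
  define H where "H t u = pert_det D (perturbed M (far M S) t) M (shift_vecs \<sigma> (moved r g) (far M S)) (eig_vecs \<sigma>)
     (circle_point \<rho> u)" for t u
  have circ: "cmod (circle_point \<rho> u) = \<rho>" for u using \<rho>_pos by (simp add: norm_circle_point)
  have far_circle: "admissible M (far M S) z 1" if "z \<in> sphere 0 \<rho>" for z
    using that \<rho>_pos by (intro far_ad) auto
  have cont: "continuous_on ({0..1} \<times> {- pi..pi}) (\<lambda>x. H (fst x) (snd x))"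
    unfolding H_def pert_det_def pert_entry_def
  proof (intro continuous_on_det_fun continuous_on_add continuous_on_const)
    fix i j
    let ?k = "\<lambda>p. cinner (resolvent D (perturbed M (far M S) (fst p)) (snd p) (eig_vecs \<sigma> j))
      (shift_vecs \<sigma> (moved r g) (far M S) i)"
    have pair: "continuous_on ({0..1::real} \<times> {- pi..pi}) (\<lambda>x. (fst x, circle_point \<rho> (snd x)))"
      by (intro continuous_on_Pair continuous_on_fst continuous_on_id
          continuous_on_compose2[OF continuous_circle_point continuous_on_snd[OF continuous_on_id]]) auto
    have "continuous_on ({0..1} \<times> {- pi..pi}) (\<lambda>x. ?k (fst x, circle_point \<rho> (snd x)))"
      by (rule continuous_on_compose2[OF resolvent_jointly_continuous[where V = "sphere 0 \<rho>", OF far_circle] pair]) (use circ in auto)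
    then show "continuous_on ({0..1} \<times> {- pi..pi}) (\<lambda>x. cinner (resolvent D (perturbed M (far M S) (fst x))
        (circle_point \<rho> (snd x)) (eig_vecs \<sigma> j)) (shift_vecs \<sigma> (moved r g) (far M S) i))"
      by simp
  qed
  have nz: "H t u \<noteq> 0" if t: "t \<in> {0..1}" for t u
  proof -
    have "circle_point \<rho> u \<in> op_resolvent_set D (perturbed M (moved r g) t)"
      using t by (intro perturbed_resolvent[OF circle_moved_admissible[OF circ]]) auto
    moreover have "circle_point \<rho> u \<in> op_resolvent_set D (perturbed M (far M S) t)"
      using t circ by (intro perturbed_resolvent[OF far_circle]) auto
    ultimately show ?thesis
      using pert_spectrum_iff(1)[OF linear_perturbed, of "circle_point \<rho> u" M "far M S" t M
          "shift_vecs \<sigma> (moved r g) (far M S)" "eig_vecs \<sigma>"]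
      unfolding perturbed_shift[OF bij] op_spectrum_def H_def by blast
  qed
  have H0: "arg_change (H 0) (- pi) pi (\<Sum>k<M. if moved r g k < \<rho> then 2 * pi else 0)"
  proof -
    have "arg_change (\<lambda>u. (circle_point \<rho> u - complex_of_real (moved r g k)) * inverse (circle_point \<rho> u - complex_of_real (far M S k)))
        (- pi) pi ((if moved r g k < \<rho> then 2 * pi else 0) + - 0)" if k: "k \<in> {..<M}" for k
    proof (intro arg_change_mult arg_change_inverse)
      show "arg_change (\<lambda>u. circle_point \<rho> u - complex_of_real (far M S k)) (- pi) pi 0"
        using k \<rho>_pos S scale by (intro arg_change_linear_outside) (auto simp: far_def)
      have "moved r g k \<noteq> \<rho>" using moved_facts(3)[of k] \<rho> scale by auto
      then show "arg_change (\<lambda>u. circle_point \<rho> u - complex_of_real (moved r g k)) (- pi) pi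
          (if moved r g k < \<rho> then 2 * pi else 0)"
        using arg_change_linear_inside[of "complex_of_real (moved r g k)" \<rho>]
          arg_change_linear_outside[of \<rho> "complex_of_real (moved r g k)"] moved_facts(4)[of k] \<rho>_pos
        by auto
    qed
    then have "arg_change (\<lambda>u. \<Prod>k<M. (circle_point \<rho> u - complex_of_real (moved r g k)) * inverse (circle_point \<rho> u - complex_of_real (far M S k)))
        (- pi) pi (\<Sum>k<M. (if moved r g k < \<rho> then 2 * pi else 0) + - 0)"
      by (intro arg_change_prod) auto
    then have "arg_change (H 0) (- pi) pi (\<Sum>k<M. (if moved r g k < \<rho> then 2 * pi else 0) + - 0)"
      by (rule arg_change_cong) (use circ in \<open>simp add: H_def pert_det_unperturbed[OF bij far_circle]\<close>)
    then show ?thesis by simp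
  qed
  obtain \<delta> where \<delta>: "arg_change (H 1) (- pi) pi \<delta>"
  proof (rule arg_change_exists)
    show "continuous_on {- pi..pi} (H 1)"
    proof -
      have "continuous_on {- pi..pi} (\<lambda>u. (1::real, u))" by (rule continuous_on_Pair[OF continuous_on_const continuous_on_id])
      then have "continuous_on {- pi..pi} (\<lambda>u. H (fst (1::real, u)) (snd (1::real, u)))"
        by (rule continuous_on_compose2[OF cont]) auto
      then show ?thesis by simp
    qed
  qed (use nz in auto)
  have "(\<Sum>k<M. if moved r g k < \<rho> then 2 * pi else 0) = \<delta>"
    by (rule arg_change_homotopy[OF cont _ _ _ H0 \<delta>]) (use nz in \<open>auto simp: H_def circle_point_pi\<close>)
  moreover have "(\<Sum>k<M. if moved r g k < \<rho> then 2 * pi else 0) = 2 * pi * count_below \<mu> (r - 100 * g)"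
  proof -
    have "{k \<in> {..<M}. moved r g k < \<rho>} = {k. \<mu> k < r - 100 * g}"
    proof (intro equalityI subsetI)
      fix k assume "k \<in> {k. \<mu> k < r - 100 * g}"
      then show "k \<in> {k \<in> {..<M}. moved r g k < \<rho>}"
        using M[of k] scale \<rho> by (cases "k < M") (auto simp: moved_def)
    qed (use scale \<rho> in \<open>auto simp: moved_def split: if_splits\<close>)
    then show ?thesis by (simp add: count_below_def sum.If_cases Int_def)
  qed
  ultimately show ?thesis using \<delta> unfolding H_def by simp
qed

definition det_quotient where
  "det_quotient z = pert_det D (perturbed M (moved r g) 1) M (shift_vecs \<sigma> \<mu> (moved r g)) (eig_vecs \<sigma>) z"

lemma unmoved: "N \<le> i \<Longrightarrow> i < M \<Longrightarrow> \<mu> (\<sigma> i) = moved r g (\<sigma> i)"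
  using \<sigma>N[of i] by (auto simp: moved_def)

lemma quotient_block:
  "det_quotient z = det_fun N (\<lambda>i j. (if i = j then 1 else 0) + 1 * block \<sigma> M \<mu> (moved r g) z i j)"
  unfolding det_quotient_def by (rule pert_det_block[where \<nu> = \<mu> and \<nu>' = "moved r g", OF NM unmoved])

text \<open>A vanishing factor \<open>1 + s * x\<close> would yield an eigenvector of the
  interpolated operator at a point of the arc, where that operator is admissible. So the product
  bound applies to the eigenvalues of the block, which are selected separately at each
  \<open>u\<close>.\<close>

lemma far_arc:
  fixes v w :: real
  assumes ab: "v \<le> w" and arc: "\<And>u. u \<in> {v..w} \<Longrightarrow> gap_angle \<le> \<bar>u\<bar> \<and> \<bar>u\<bar> \<le> pi"
    and \<delta>: "arg_change (\<lambda>u. det_quotient (circle_point \<rho> u)) v w \<delta>"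
  shows "\<bar>\<delta>\<bar> \<le> 2 * pi * N"
proof -
  let ?bl = "\<lambda>u. block \<sigma> M \<mu> (moved r g) (circle_point \<rho> u)"
  define H where "H s u = det_fun N (\<lambda>i j. (if i = j then 1 else 0) + complex_of_real s * ?bl u i j)" for s u
  have circ: "cmod (circle_point \<rho> u) = \<rho>" for u using \<rho>_pos by (simp add: norm_circle_point)
  have res: "circle_point \<rho> u \<in> op_resolvent_set D (perturbed M (moved r g) 1)" for u
    by (intro perturbed_resolvent[OF circle_moved_admissible[OF circ]]) auto
  define as where "as u = (SOME as. block_spectrum \<sigma> M \<mu> (moved r g) (circle_point \<rho> u) N as)" for u
  have spec: "block_spectrum \<sigma> M \<mu> (moved r g) (circle_point \<rho> u) N (as u)" for u
    unfolding as_def by (rule someI_ex, rule block_spectrum_exists[OF bij NM _ res], rule unmoved)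
  have as: "\<And>u. length (as u) = N"
    "\<And>u s. det_fun N (\<lambda>i j. (if i = j then 1 else 0) + s * ?bl u i j) = (\<Prod>x\<leftarrow>as u. 1 + s * x)"
    using spec unfolding block_spectrum_def by blast+
  show ?thesis
  proof (rule arg_change_product_bound[OF _ ab, of H as])
    have bl_cont: "continuous_on {v..w} (\<lambda>u. ?bl u i j)" for i j
    proof -
      let ?k = "\<lambda>p. cinner (resolvent D (perturbed M (moved r g) (fst p)) (snd p) (eig_vecs \<sigma> j))
        (shift_vecs \<sigma> \<mu> (moved r g) i)"
      have pair: "continuous_on {v..w} (\<lambda>u. (1::real, circle_point \<rho> u))" by (intro continuous_intros)
      have ad: "admissible M (moved r g) z (50 * g)" if "z \<in> sphere 0 \<rho>" for z
        using that by (intro circle_moved_admissible) simp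
      have "continuous_on {v..w} (\<lambda>u. ?k (1, circle_point \<rho> u))"
        by (rule continuous_on_compose2[OF resolvent_jointly_continuous[where V = "sphere 0 \<rho>", OF ad] pair])
          (use circ in auto)
      then show ?thesis by (simp add: block_def)
    qed
    show "continuous_on ({0..1} \<times> {v..w}) (\<lambda>x. H (fst x) (snd x))"
      unfolding H_def
      by (intro continuous_on_det_fun continuous_intros continuous_on_compose2[OF bl_cont]) auto
    fix s u assume s: "s \<in> {0..1::real}" and u: "u \<in> {v..w}"
    show H: "H s u = (\<Prod>x\<leftarrow>as u. 1 + complex_of_real s * x)" unfolding H_def by (rule as(2))
    show "H s u \<noteq> 0"
    proof
      assume "H s u = 0"
      then obtain x where x: "x \<in> set (as u)" "1 + complex_of_real s * x = 0"
        unfolding H by (auto simp: prod_list_zero_iff)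
      obtain y x' where v: "y \<noteq> 0" "x' \<in> D" "perturbed M (moved r g) 1 x' - circle_point \<rho> u *\<^sub>C x' = y"
        "rank_pert M (shift_vecs \<sigma> \<mu> (moved r g)) (eig_vecs \<sigma>) x' = x *\<^sub>C y"
        using spec[of u] x(1) unfolding block_spectrum_def by blast
      have ad: "admissible M (\<lambda>k. (1 - s) * moved r g k + s * \<mu> k) (circle_point \<rho> u) g"
        using arc[OF u] s by (intro interpolated_admissible) auto
      have "x' = 0"
        using perturbed_bounded_below[OF ad v(2), of 1] block_eigenvector_interpolate[OF bij v(3,4), of s] x(2)
        by simp
      then show False using v(1,3) linear_operatorD(4)[OF linear_perturbed] by simp
    qed
  next
    show "arg_change (H 1) v w \<delta>"
      by (rule arg_change_cong[OF \<delta>]) (simp add: quotient_block H_def)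
  qed (use as(1) in auto)
qed

text \<open>For an eigenvalue \<open>x\<close> of the block, \<open>x *\<^sub>C y\<close> is the
  shift of \<open>v\<close>, of norm at most \<open>200 * g\<close> times that of \<open>v\<close>,
  and the norm of \<open>v\<close> is at most \<open>2 / (50 * g)\<close> times that of
  \<open>y\<close>. So \<open>cmod x \<le> 8\<close>.\<close>

lemma quotient_upper:
  assumes z: "admissible M (moved r g) z (50 * g)" shows "cmod (det_quotient z) \<le> 9 ^ N"
proof -
  have res: "z \<in> op_resolvent_set D (perturbed M (moved r g) 1)" by (rule perturbed_resolvent[OF z]) auto
  obtain as where spec: "block_spectrum \<sigma> M \<mu> (moved r g) z N as"
    using block_spectrum_exists[where \<nu> = \<mu> and \<nu>' = "moved r g", OF bij NM unmoved res] by blast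
  have as: "length as = N"
    "det_fun N (\<lambda>i j. (if i = j then 1 else 0) + 1 * block \<sigma> M \<mu> (moved r g) z i j) = (\<Prod>x\<leftarrow>as. 1 + 1 * x)"
    using spec unfolding block_spectrum_def by blast+
  have "cmod (1 + 1 * x) \<le> 9" if x: "x \<in> set as" for x
  proof -
    obtain y v where v: "y \<noteq> 0" "v \<in> D" "perturbed M (moved r g) 1 v - z *\<^sub>C v = y"
      "rank_pert M (shift_vecs \<sigma> \<mu> (moved r g)) (eig_vecs \<sigma>) v = x *\<^sub>C y"
      using spec x unfolding block_spectrum_def by blast
    have "cmod x * norm y = norm (rank_pert M (shift_vecs \<sigma> \<mu> (moved r g)) (eig_vecs \<sigma>) v)"
      by (simp add: v(4) norm_scaleC)
    also have "\<dots> \<le> (200 * g) * norm v"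
      using bij scale moved_facts(2)
      by (intro norm_shift_le) (auto simp: bij_betw_def abs_minus_commute)
    also have "\<dots> \<le> (200 * g) * (2 / (50 * g) * norm y)"
      using perturbed_bounded_below[OF z v(2), of 1] v(3) scale by (intro mult_left_mono) auto
    also have "\<dots> = 8 * norm y" using scale by simp
    finally have "cmod x \<le> 8" using v(1) by simp
    then show ?thesis using norm_triangle_ineq[of 1 x] by simp
  qed
  then have "cmod (\<Prod>x\<leftarrow>as. 1 + 1 * x) \<le> 9 ^ length as" by (intro norm_prod_list_le) auto
  then show ?thesis unfolding quotient_block as(2) as(1) .
qed

text \<open>Here the resolvent of \<open>A\<close> bounds \<open>v\<close> by \<open>2 / g\<close>
  times the norm of \<open>(1 + x) y\<close>. Splitting \<open>y\<close> into
  \<open>(1 + x) y\<close> and \<open>- x y\<close> produces the constant 1 + 200 * 2 = 401.\<close>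

lemma quotient_lower:
  assumes z: "admissible M (moved r g) z (50 * g)" and z': "admissible M \<mu> z g"
  shows "(1 / 401) ^ N \<le> cmod (det_quotient z)"
proof -
  have res: "z \<in> op_resolvent_set D (perturbed M (moved r g) 1)" by (rule perturbed_resolvent[OF z]) auto
  obtain as where spec: "block_spectrum \<sigma> M \<mu> (moved r g) z N as"
    using block_spectrum_exists[where \<nu> = \<mu> and \<nu>' = "moved r g", OF bij NM unmoved res] by blast
  have as: "length as = N"
    "det_fun N (\<lambda>i j. (if i = j then 1 else 0) + 1 * block \<sigma> M \<mu> (moved r g) z i j) = (\<Prod>x\<leftarrow>as. 1 + 1 * x)"
    using spec unfolding block_spectrum_def by blast+
  have "1 / 401 \<le> cmod (1 + 1 * x)" if x: "x \<in> set as" for x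
  proof -
    obtain y v where v: "y \<noteq> 0" "v \<in> D" "perturbed M (moved r g) 1 v - z *\<^sub>C v = y"
      "rank_pert M (shift_vecs \<sigma> \<mu> (moved r g)) (eig_vecs \<sigma>) v = x *\<^sub>C y"
      using spec x unfolding block_spectrum_def by blast
    define m where "m = cmod (1 + 1 * x) * norm y"
    have eq: "perturbed M \<mu> 1 v - z *\<^sub>C v = (1 + 1 * x) *\<^sub>C y"
      using block_eigenvector_interpolate[OF bij v(3,4), of 1] by simp
    have v_le: "norm v \<le> 2 / g * m"
      using perturbed_bounded_below[OF z' v(2), of 1] unfolding eq by (simp add: norm_scaleC m_def)
    have "y = (1 + 1 * x) *\<^sub>C y - x *\<^sub>C y" by (simp add: scaleC_add_left scaleC_one)
    then have "norm y \<le> norm ((1 + 1 * x) *\<^sub>C y) + norm (x *\<^sub>C y)" by (metis norm_triangle_ineq4)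
    also have "norm ((1 + 1 * x) *\<^sub>C y) = m" by (simp only: norm_scaleC m_def)
    also have "norm (x *\<^sub>C y) \<le> (200 * g) * norm v"
      unfolding v(4)[symmetric] using bij scale moved_facts(2)
      by (intro norm_shift_le) (auto simp: bij_betw_def abs_minus_commute)
    also have "\<dots> \<le> (200 * g) * (2 / g * m)" using v_le scale by (intro mult_left_mono) auto
    also have "m + (200 * g) * (2 / g * m) = 401 * m" using scale by simp
    finally have "1 * norm y \<le> (401 * cmod (1 + 1 * x)) * norm y" by (simp add: m_def)
    then have "1 \<le> 401 * cmod (1 + 1 * x)" using v(1) by (subst (asm) mult_le_cancel_right) auto
    then show ?thesis by simp
  qed
  then have "(1 / 401) ^ length as \<le> cmod (\<Prod>x\<leftarrow>as. 1 + 1 * x)" by (intro norm_prod_list_ge) auto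
  then show ?thesis unfolding quotient_block as(2) as(1) .
qed

text \<open>The radius \<open>40 * g\<close> and the distance of at most \<open>g\<close> between
  \<open>\<rho>\<close> and \<open>r\<close> stay within the margin of
  \<open>45 * g\<close>.\<close>

lemma near_ball:
  assumes "z \<in> ball (circle_point \<rho> (- gap_angle)) (40 * g)" shows "admissible M (moved r g) z (50 * g)"
proof (rule moved_admissible)
  have "\<bar>cmod z - \<rho>\<bar> \<le> cmod (z - circle_point \<rho> (- gap_angle))"
    using norm_triangle_ineq3[of z "circle_point \<rho> (- gap_angle)"] \<rho>_pos by (simp add: norm_circle_point)
  then show "\<bar>cmod z - r\<bar> \<le> 45 * g"
    using assms \<rho> scale by (simp add: dist_norm norm_minus_commute)
qed

text \<open>The arc has height \<open>4 * g\<close>, and its width is at most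
  \<open>\<rho> * (sin gap_angle)\<^sup>2\<close>, which equals \<open>2 * g * sin gap_angle\<close>
  and is at most \<open>g / 2\<close>. This stays below \<open>5 * g\<close>, one eighth of the
  radius on which the quotient is bounded.\<close>

lemma near_arc_in_ball:
  assumes u: "u \<in> {- gap_angle..gap_angle}"
  shows "circle_point \<rho> u \<in> ball (circle_point \<rho> (- gap_angle)) (40 * g / 8)"
proof -
  let ?d = "circle_point \<rho> u - circle_point \<rho> (- gap_angle)"
  have "sin (- gap_angle) \<le> sin u" "sin u \<le> sin gap_angle"
    using u gap_angle_facts by (intro sin_monotone_2pi_le; simp)+
  then have "\<bar>\<rho> * (sin u + sin gap_angle)\<bar> \<le> \<rho> * (2 * sin gap_angle)"
    unfolding abs_mult using \<rho>_pos by (intro mult_mono) auto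
  then have Im: "\<bar>Im ?d\<bar> \<le> 4 * g" using gap_angle_facts(3) by (simp add: circle_point_def algebra_simps)
  have "cos gap_angle \<le> cos \<bar>u\<bar>" using u gap_angle_facts by (intro cos_monotone_0_pi_le) auto
  then have cu: "cos gap_angle \<le> cos u" by simp
  have c0: "0 \<le> cos gap_angle" using gap_angle_facts by (intro cos_ge_zero) auto
  have "1 - cos gap_angle \<le> 1 - (cos gap_angle)\<^sup>2" using c0 by (simp add: power2_eq_square mult_left_le_one_le)
  also have "\<dots> = (sin gap_angle)\<^sup>2" by (simp add: sin_squared_eq)
  finally have "\<bar>cos u - cos gap_angle\<bar> \<le> (sin gap_angle)\<^sup>2" using cu cos_le_one[of u] by linarith
  then have "\<bar>\<rho> * (cos u - cos gap_angle)\<bar> \<le> \<rho> * (sin gap_angle)\<^sup>2"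
    unfolding abs_mult using \<rho>_pos by (intro mult_mono) auto
  also have "\<dots> = 2 * g * sin gap_angle" using gap_angle_facts(3) by (simp add: power2_eq_square)
  also have "\<dots> \<le> 2 * g * (1 / 4)"
  proof (intro mult_left_mono)
    have "\<rho> * sin gap_angle \<le> \<rho> * (1 / 4)" using gap_angle_facts(3) \<rho>_pos scale by linarith
    then show "sin gap_angle \<le> 1 / 4" using \<rho>_pos by (subst (asm) mult_le_cancel_left_pos) auto
  qed (use scale in simp)
  finally have Re: "\<bar>Re ?d\<bar> \<le> g / 2" by (simp add: circle_point_def algebra_simps)
  have "cmod ?d \<le> \<bar>Re ?d\<bar> + \<bar>Im ?d\<bar>" by (rule cmod_le)
  then have "cmod ?d < 5 * g" using Re Im scale by linarith
  then show ?thesis by (simp add: dist_norm norm_minus_commute)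
qed

text \<open>The quotient turns by \<open>2 * pi\<close> times the difference of the counts. Each of
  the two arcs off the axis accounts for at most \<open>2 * pi * N\<close>, the arc near the axis
  for \<open>8 * pi * L + 12 * L\<close>, and \<open>12 \<le> 4 * pi\<close>.\<close>

lemma count_difference:
  "\<bar>real (eigenvalue_count D (\<lambda>x. T x + B x) \<rho>) - real (count_below \<mu> (r - 100 * g))\<bar>
    \<le> 2 * N + 6 * (N * ln 401 + 1)"
proof -
  define f where "f = pert_det D (perturbed M (far M S) 1) M (shift_vecs \<sigma> \<mu> (far M S)) (eig_vecs \<sigma>)"
  define f1 where "f1 = pert_det D (perturbed M (far M S) 1) M (shift_vecs \<sigma> (moved r g) (far M S)) (eig_vecs \<sigma>)"
  let ?n = "eigenvalue_count D (\<lambda>x. T x + B x) \<rho>" and ?c = "count_below \<mu> (r - 100 * g)"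
  note bs = ball_facts[OF good S far_ad bij]
  have circ: "cmod (circle_point \<rho> u) = \<rho>" for u using \<rho>_pos by (simp add: norm_circle_point)
  have in_far: "z \<in> op_resolvent_set D (perturbed M (far M S) 1)" if "cmod z = \<rho>" for z
    using bs(1) that \<rho>_pos by auto
  have f_nz: "f z \<noteq> 0" if "cmod z = \<rho>" for z
    using pert_spectrum_iff(1)[OF linear_perturbed in_far[OF that], of M "shift_vecs \<sigma> \<mu> (far M S)" "eig_vecs \<sigma>"]
      no_spectrum[OF that]
    unfolding perturbed_shift[OF bij] perturbed_original f_def by blast
  have f_quot: "f z = det_quotient z * f1 z" if "cmod z = \<rho>" for z
  proof -
    have z1: "z \<in> op_resolvent_set D (\<lambda>x. perturbed M (far M S) 1 x
        + rank_pert M (shift_vecs \<sigma> (moved r g) (far M S)) (eig_vecs \<sigma>) x)"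
      unfolding perturbed_shift[OF bij]
      by (rule perturbed_resolvent[OF circle_moved_admissible[OF that]]) auto
    show ?thesis
      using pert_det_chain[OF linear_perturbed in_far[OF that] z1, of "shift_vecs \<sigma> \<mu> (far M S)"]
      unfolding perturbed_shift[OF bij] shift_vecs_diff f_def f1_def det_quotient_def .
  qed
  have "arg_change (\<lambda>u. f (circle_point \<rho> u)) (- pi) pi (2 * pi * ?n)"
    using pert_det_argument[OF linear_perturbed bs \<rho>_pos(1,2)] f_nz
    unfolding f_def perturbed_shift[OF bij] perturbed_original by blast
  moreover have "arg_change (\<lambda>u. inverse (f1 (circle_point \<rho> u))) (- pi) pi (- (2 * pi * ?c))"
    unfolding f1_def by (rule arg_change_inverse[OF arg_change_moved])
  ultimately have "arg_change (\<lambda>u. f (circle_point \<rho> u) * inverse (f1 (circle_point \<rho> u))) (- pi) pi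
      (2 * pi * ?n + - (2 * pi * ?c))" by (rule arg_change_mult)
  then have total: "arg_change (\<lambda>u. det_quotient (circle_point \<rho> u)) (- pi) pi (2 * pi * ?n + - (2 * pi * ?c))"
  proof (rule arg_change_cong)
    fix u
    show "f (circle_point \<rho> u) * inverse (f1 (circle_point \<rho> u)) = det_quotient (circle_point \<rho> u)"
      using f_quot[OF circ, of u] f_nz[OF circ, of u] by simp
  qed
  have q_nz: "det_quotient (circle_point \<rho> u) \<noteq> 0" for u
    using f_quot[OF circ, of u] f_nz[OF circ, of u] by auto
  obtain \<delta>1 \<delta>' where 1: "arg_change (\<lambda>u. det_quotient (circle_point \<rho> u)) (- pi) (- gap_angle) \<delta>1"
    "arg_change (\<lambda>u. det_quotient (circle_point \<rho> u)) (- gap_angle) pi \<delta>'" "2 * pi * ?n + - (2 * pi * ?c) = \<delta>1 + \<delta>'"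
    by (rule arg_change_split[OF total, of "- gap_angle"]) (use gap_angle_facts pi_gt_zero in auto)
  obtain \<delta>2 \<delta>3 where 2: "arg_change (\<lambda>u. det_quotient (circle_point \<rho> u)) (- gap_angle) gap_angle \<delta>2"
    "arg_change (\<lambda>u. det_quotient (circle_point \<rho> u)) gap_angle pi \<delta>3" "\<delta>' = \<delta>2 + \<delta>3"
    by (rule arg_change_split[OF 1(2), of gap_angle]) (use gap_angle_facts pi_gt_zero in auto)
  have b1: "\<bar>\<delta>1\<bar> \<le> 2 * pi * N" by (rule far_arc[OF _ _ 1(1)]) (use gap_angle_facts in auto)
  have b3: "\<bar>\<delta>3\<bar> \<le> 2 * pi * N" by (rule far_arc[OF _ _ 2(2)]) (use gap_angle_facts in auto)
  \<comment> \<open>\<open>exp L\<close> dominates \<open>401 ^ N\<close> and with it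
    \<open>9 ^ N\<close>; the summand 1 keeps \<open>L\<close> positive when
    \<open>N = 0\<close>.\<close>
  define L where "L = N * ln 401 + 1"
  have L: "L > 0" by (simp add: L_def add_nonneg_pos)
  have exp_ge: "401 ^ N \<le> exp L"
  proof -
    have "(401::real) ^ N = exp (N * ln 401)" by (simp add: exp_of_nat_mult)
    then show ?thesis by (simp add: L_def)
  qed
  \<comment> \<open>The centre is an end of the near arc, \<open>2 * g\<close> below the axis: there
    \<open>A\<close> has a bounded resolvent, so the quotient has a lower bound.\<close>
  define p where "p = circle_point \<rho> (- gap_angle)"
  have p_ad: "admissible M \<mu> p g"
  proof (rule good_scale_admissible[OF good])
    show "g \<le> cmod (complex_of_real (\<mu> k) - p)" for k
      unfolding p_def using gap_angle_facts \<mu>_gt_1[of k] by (intro distance_off_axis) auto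
  qed (use circ \<rho> scale in \<open>auto simp: p_def\<close>)
  have b2: "\<bar>\<delta>2\<bar> \<le> 8 * pi * L + 12 * L"
  proof (rule arg_change_near_point[OF _ _ L _ _ \<rho>_pos(1) gap_angle_facts(1,2) _ q_nz 2(1)])
    show "det_quotient holomorphic_on ball p (40 * g)"
      unfolding det_quotient_def[abs_def]
      by (rule pert_det_holomorphic[OF linear_perturbed open_ball])
        (use near_ball in \<open>auto simp: p_def intro!: perturbed_resolvent\<close>)
    show "cmod (det_quotient w) \<le> exp L" if "w \<in> ball p (40 * g)" for w
    proof -
      have "cmod (det_quotient w) \<le> 9 ^ N" using that by (intro quotient_upper near_ball) (simp add: p_def)
      also have "(9::real) ^ N \<le> 401 ^ N" by (intro power_mono) auto
      finally show ?thesis using exp_ge by simp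
    qed
    have "exp (- L) \<le> inverse (401 ^ N)" unfolding exp_minus using exp_ge by (intro le_imp_inverse_le) auto
    also have "\<dots> = (1 / 401) ^ N" by (simp only: inverse_eq_divide power_one_over)
    also have "\<dots> \<le> cmod (det_quotient p)"
      using scale by (intro quotient_lower p_ad near_ball) (simp add: p_def)
    finally show "exp (- L) \<le> cmod (det_quotient p)" .
    show "40 * g > 0" using scale by simp
    show "circle_point \<rho> u \<in> ball p (40 * g / 8)" if "u \<in> {- gap_angle..gap_angle}" for u
      unfolding p_def by (rule near_arc_in_ball[OF that])
  qed
  have "2 * pi * (real ?n - real ?c) = \<delta>1 + (\<delta>2 + \<delta>3)"
    using 1(3) 2(3) by (simp add: right_diff_distrib)
  then have "2 * pi * \<bar>real ?n - real ?c\<bar> = \<bar>\<delta>1 + (\<delta>2 + \<delta>3)\<bar>"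
    using abs_mult[of "2 * pi" "real ?n - real ?c"] by simp
  also have "\<dots> \<le> 2 * pi * N + (8 * pi * L + 12 * L) + 2 * pi * N" using b1 b2 b3 by linarith
  also have "\<dots> \<le> 2 * pi * (2 * N + 6 * L)"
  proof -
    have "3 * L \<le> pi * L" using L pi_gt3 by (intro mult_right_mono) auto
    then show ?thesis by (simp add: algebra_simps)
  qed
  finally show ?thesis unfolding L_def using pi_gt_zero by simp
qed

end

text \<open>The number of moved eigenvalues is the bracket. Passing from \<open>r - 100 * g\<close>
  back to \<open>r\<close> costs it once more, which raises the coefficient 2 to 3.\<close>

lemma main_estimate:
  assumes good: "good_scale r g"
  shows "\<bar>real (eigenvalue_count D (\<lambda>x. T x + B x) r) - real (count_below \<mu> r)\<bar>
    \<le> (3 + 6 * ln 401) * (real (count_below \<mu> (r + 100 * g)) - real (count_below \<mu> (r - 100 * g))) + 6"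
proof -
  let ?A = "\<lambda>x. T x + B x"
  have rg: "r \<ge> 1" "g > 0" "1000 * g \<le> r" using good by (auto simp: good_scale_def)
  have r2: "2 * r > 1" using rg by simp
  obtain M S where M: "\<And>k. k \<ge> M \<Longrightarrow> \<mu> k \<ge> 2 * (2 * r)" and S: "S > 2 * r"
    and far_ad: "\<And>z. z \<in> ball 0 (2 * r) \<Longrightarrow> admissible M (far M S) z 1"
    by (rule far_admissible[OF r2], rule that)
  define J where "J = {k. r - 100 * g \<le> \<mu> k \<and> \<mu> k < r + 100 * g}"
  have JM: "J \<subseteq> {..<M}"
  proof
    fix k assume "k \<in> J"
    then have "\<mu> k < 2 * (2 * r)" using rg by (auto simp: J_def)
    then show "k \<in> {..<M}" using M[of k] by (meson leI lessThan_iff not_le)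
  qed
  obtain \<sigma> where \<sigma>: "bij_betw \<sigma> {..<M} {..<M}" "\<sigma> ` {..<card J} = J"
    using enumeration_with_initial_segment[OF JM] by blast
  have NM: "card J \<le> M" using card_mono[OF _ JM] by simp
  have \<sigma>N: "i < card J \<longleftrightarrow> r - 100 * g \<le> \<mu> (\<sigma> i) \<and> \<mu> (\<sigma> i) < r + 100 * g" if i: "i < M" for i
  proof -
    have "i < card J \<longleftrightarrow> \<sigma> i \<in> \<sigma> ` {..<card J}"
    proof
      assume "\<sigma> i \<in> \<sigma> ` {..<card J}"
      then obtain j where "j < card J" "\<sigma> i = \<sigma> j" by auto
      moreover have "j < M" using \<open>j < card J\<close> NM by simp
      ultimately show "i < card J" using \<sigma>(1) i unfolding bij_betw_def inj_on_def by auto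
    qed auto
    then show ?thesis unfolding \<sigma>(2) by (simp add: J_def)
  qed
  define F where "F = {z. z \<in> op_spectrum D ?A \<and> cmod z < r}"
  have finF: "finite F" unfolding F_def by (rule finite_spectrum_in_disc[OF discrete])
  \<comment> \<open>\<open>A\<close> may have eigenvalues of modulus \<open>r\<close>. A radius
    \<open>\<rho>\<close> strictly between \<open>m\<close> and \<open>r\<close> avoids the spectrum
    and encloses the same eigenvalues; including \<open>r - g\<close> in the maximum keeps
    \<open>\<rho>\<close> within \<open>g\<close> of \<open>r\<close>.\<close>
  define m where "m = Max (insert (r - g) (cmod ` F))"
  have m: "r - g \<le> m" "\<And>z. z \<in> F \<Longrightarrow> cmod z \<le> m" "m < r"
    unfolding m_def using finF rg by (auto simp: F_def)
  define \<rho> where "\<rho> = (m + r) / 2"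
  have \<rho>: "r - g < \<rho>" "\<rho> < r" "m < \<rho>" using m rg by (auto simp: \<rho>_def)
  have no_spec: "z \<notin> op_spectrum D ?A" if "cmod z = \<rho>" for z
    using m(2)[of z] \<rho> that by (auto simp: F_def)
  have "{z. z \<in> op_spectrum D ?A \<and> cmod z < \<rho>} = F" using m(2) \<rho> by (force simp: F_def)
  then have count: "eigenvalue_count D ?A \<rho> = eigenvalue_count D ?A r"
    by (simp add: eigenvalue_count_def F_def)
  have "count_below \<mu> (r + 100 * g) = count_below \<mu> (r - 100 * g) + card J"
  proof -
    have "{k. \<mu> k < r + 100 * g} = {k. \<mu> k < r - 100 * g} \<union> J" using rg by (auto simp: J_def)
    moreover have "finite J" using JM finite_subset by blast
    ultimately show ?thesis
      unfolding count_below_def by (simp add: card_Un_disjoint finite_below J_def disjoint_iff)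
  qed
  moreover have "\<bar>real (eigenvalue_count D ?A r) - real (count_below \<mu> (r - 100 * g))\<bar>
      \<le> 2 * card J + 6 * (card J * ln 401 + 1)"
    using count_difference[OF good \<rho>(1) less_imp_le[OF \<rho>(2)] M S far_ad \<sigma>(1) NM \<sigma>N no_spec] count by simp
  moreover have "count_below \<mu> (r - 100 * g) \<le> count_below \<mu> r" "count_below \<mu> r \<le> count_below \<mu> (r + 100 * g)"
    using rg by (auto intro!: count_below_mono)
  ultimately show ?thesis by (simp add: algebra_simps)
qed

end

theorem theorem1:
  fixes DT DB :: "'a :: {complex_hilbert, second_countable_topology} set"
    and T B :: "'a \<Rightarrow> 'a"
    and \<mu> :: "nat \<Rightarrow> real"
    and \<phi> :: "nat \<Rightarrow> 'a"
    and \<alpha> \<beta> \<gamma> b :: real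
  assumes T_self_adjoint: "self_adjoint DT T"
    and T_discrete: "discrete_spectrum DT T"
    and T_spectrum: "op_spectrum DT T = range (\<lambda>k. complex_of_real (\<mu> k))"
    and T_multiplicity:
      "\<And>k. algebraic_multiplicity DT T (complex_of_real (\<mu> k)) = card {j. \<mu> j = \<mu> k}"
    and \<mu>_gt_1: "\<And>k. 1 < \<mu> k"
    and \<mu>_mono: "mono \<mu>"
    and \<phi>_complete: "complete_orthonormal \<phi>"
    and \<phi>_eigenvector: "\<And>k. \<phi> k \<in> DT \<and> T (\<phi> k) = complex_of_real (\<mu> k) *\<^sub>C \<phi> k"
    and \<alpha>_pos: "\<alpha> > 0"
    and growth: "Limsup at_top (\<lambda>r. ereal (real (count_below \<mu> r) / r powr \<alpha>)) < \<infinity>"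
    and non_condensing: "alpha_non_condensing \<alpha> \<mu>"
    and B_linear: "linear_operator DB B"
    and B_domain: "DT \<subseteq> DB"
    and B_relatively_bounded: "relatively_bounded DT T B"
    and b_pos: "b > 0"
    and \<beta>_less_1: "\<beta> < 1"
    and B_bound: "\<And>k. norm (B (\<phi> k)) \<le> b * \<mu> k powr \<beta>"
    and \<gamma>_eq: "\<gamma> = Max {0, \<beta>, 2 * \<beta> + \<alpha> - 1}"
    and \<gamma>_less_1: "\<gamma> < 1"
  shows "discrete_spectrum DT (\<lambda>x. T x + B x) \<and>
    (\<exists>a C C1. a > 0 \<and> C > 0 \<and> C1 > 0 \<and>
      (\<forall>r>0. \<bar>real (eigenvalue_count DT (\<lambda>x. T x + B x) r) - real (count_below \<mu> r)\<bar>
        \<le> C * (real (count_below \<mu> (r + a * r powr \<gamma>))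
                - real (count_below \<mu> (r - a * r powr \<gamma>))) + C1))"
proof -
  obtain l where l: "\<And>t. t > 0 \<Longrightarrow> finite {k. \<mu> k powr \<alpha> \<in> {t<..t + 1}} \<and>
      card {k. \<mu> k powr \<alpha> \<in> {t<..t + 1}} \<le> l"
    using non_condensing unfolding alpha_non_condensing_def non_condensing_def by blast
  have \<gamma>_ge: "\<gamma> \<ge> 0" "\<gamma> \<ge> \<beta>" "\<gamma> \<ge> 2 * \<beta> + \<alpha> - 1"
    unfolding \<gamma>_eq by (auto intro: Max_ge)
  interpret noncondensing_perturbation \<phi> DT T \<mu> DB B \<alpha> \<beta> \<gamma> b l
    by unfold_locales (use assms l \<gamma>_ge in auto)
  let ?A = "\<lambda>x. T x + B x"
  obtain c r0 where c: "c > 0" "r0 \<ge> 1" "\<And>r. r \<ge> r0 \<Longrightarrow> good_scale r (c * r powr \<gamma>)"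
    using good_scale_exists by blast
  define C where "C = 3 + 6 * ln (401 :: real)"
  \<comment> \<open>Below \<open>r0\<close> no scale is available; both counts are then bounded by
    their values at \<open>r0\<close>.\<close>
  define C1 where "C1 = 6 + real (eigenvalue_count DT ?A r0) + real (count_below \<mu> r0)"
  have C: "C > 0" "C1 > 0" by (simp_all add: C_def C1_def add_pos_nonneg)
  have "\<bar>real (eigenvalue_count DT ?A r) - real (count_below \<mu> r)\<bar>
      \<le> C * (real (count_below \<mu> (r + 100 * c * r powr \<gamma>)) - real (count_below \<mu> (r - 100 * c * r powr \<gamma>))) + C1"
    if r: "r > 0" for r
  proof (cases "r \<ge> r0")
    case True
    have "6 \<le> C1" by (simp add: C1_def)
    then show ?thesis
      using main_estimate[OF c(3)[OF True]] unfolding C_def[symmetric] by (simp only: mult.assoc)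
  next
    case False
    have "eigenvalue_count DT ?A r \<le> eigenvalue_count DT ?A r0"
      unfolding eigenvalue_count_def
      by (rule sum_mono2[OF finite_spectrum_in_disc[OF discrete]]) (use False in auto)
    moreover have "count_below \<mu> r \<le> count_below \<mu> r0" using False by (intro count_below_mono) simp
    ultimately have "\<bar>real (eigenvalue_count DT ?A r) - real (count_below \<mu> r)\<bar> \<le> C1"
      by (simp add: C1_def)
    moreover have "count_below \<mu> (r - 100 * c * r powr \<gamma>) \<le> count_below \<mu> (r + 100 * c * r powr \<gamma>)"
    proof (rule count_below_mono)
      have "0 \<le> 100 * c * r powr \<gamma>" using c(1) by simp
      then show "r - 100 * c * r powr \<gamma> \<le> r + 100 * c * r powr \<gamma>" by linarith
    qed
    then have "0 \<le> C * (real (count_below \<mu> (r + 100 * c * r powr \<gamma>)) - real (count_below \<mu> (r - 100 * c * r powr \<gamma>)))"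
      using C by (intro mult_nonneg_nonneg) auto
    ultimately show ?thesis by linarith
  qed
  then show ?thesis
    using discrete c(1) C by (intro conjI exI[of _ "100 * c"] exI[of _ C] exI[of _ C1]) auto
qed

end
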